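(* Let $\Phi\in C^2(\mathbb{R}^d)$ be such that there is $\lambda\in\mathbb{R}$ with $D^2\Phi(x)\ge\lambda\,\mathrm{Id}$ for all $x\in\mathbb{R}^d$. Let $2<m\le\infty$, let $0<M_1\le M_2$, and let $\rho_{01}\in\mathcal{P}_{2,M_1}(\mathbb{R}^d)$, $\rho_{02}\in\mathcal{P}_{2,M_2}(\mathbb{R}^d)$ be two densities with $\rho_{01}\le\rho_{02}$ a.e. (in the case $m=\infty$ assume in addition $\|\rho_{0i}\|_\infty\le1$ for $i=1,2$). For given $h>0$, let $\rho_1,\rho_2$ be the respective minimizers $$\rho_i:=\underset{\rho\in\mathcal{P}_{2,M_i}(\mathbb{R}^d)}{\mathrm{argmin}}\Big[E_m[\rho]+\frac1{2h}W_2^2(\rho,\rho_{0i})\Big],\qquad i=1,2.$$ Then $\rho_1\le\rho_2$ a.e.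
   Context: $\mathcal{P}_{2,A}(\mathbb{R}^d)$ is the set of nonnegative measures on $\mathbb{R}^d$ of total mass $A>0$ with finite second moment. For regular (absolutely continuous) $\mu_1,\mu_2\in\mathcal{P}_{2,A}(\mathbb{R}^d)$, $W_2^2(\mu_1,\mu_2):=\inf_{T_\#\mu_1=\mu_2}\int_{\mathbb{R}^d}|T(x)-x|^2\mu_1(x)\,dx$. The energy is $E_m[\rho]:=\mathcal{S}_m[\rho]+\int_{\mathbb{R}^d}\rho\,\Phi\,dx$ for $1<m\le\infty$, where $\mathcal{S}_m[\rho]=\int\frac1m\rho^m\,dx$ for $1<m<\infty$ (with $+\infty$ if $\rho$ is not absolutely continuous), $\mathcal{S}_\infty[\rho]=0$ if $\|\rho\|_{L^\infty}\le1$ and $\mathcal{S}_\infty[\rho]=+\infty$ otherwise. The semi-convexity of $\Phi$ serves to guarantee existence of the minimizers $\rho_i$. *)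

theory Defs
  imports "HOL-Probability.Probability"
begin

text \<open>Second derivatives are iterated Frechet derivatives:
  \<open>D2 f x v w\<close> is \<open>\<langle>D\<^sup>2f(x) v, w\<rangle>\<close>.\<close>

definition D2 :: "('a::euclidean_space \<Rightarrow> real) \<Rightarrow> 'a \<Rightarrow> 'a \<Rightarrow> 'a \<Rightarrow> real" where
  "D2 f x v w = frechet_derivative (\<lambda>y. frechet_derivative f (at y) v) (at x) w"

text \<open>In finite dimension, continuity of all second directional derivatives is the same as
  continuity of \<open>x \<mapsto> D\<^sup>2f(x)\<close>. The differentiability clauses are needed because
  \<open>frechet_derivative\<close> is an arbitrary function where the derivative does not exist.\<close>

definition C2 :: "('a::euclidean_space \<Rightarrow> real) \<Rightarrow> bool" where
  "C2 f \<longleftrightarrow>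
     (\<forall>x. f differentiable (at x)) \<and>
     (\<forall>v x. (\<lambda>y. frechet_derivative f (at y) v) differentiable (at x)) \<and>
     (\<forall>v w. continuous_on UNIV (\<lambda>x. D2 f x v w))"

text \<open>\<open>D\<^sup>2f(x) \<ge> \<lambda> Id\<close> for all \<open>x\<close>, in the order of quadratic forms.\<close>

definition hessian_bounded_below :: "('a::euclidean_space \<Rightarrow> real) \<Rightarrow> real \<Rightarrow> bool" where
  "hessian_bounded_below f lam \<longleftrightarrow> (\<forall>x v. lam * (v \<bullet> v) \<le> D2 f x v v)"

definition P2 :: "real \<Rightarrow> ('a::euclidean_space) measure set" where
  "P2 A = {\<mu>. sets \<mu> = sets borel \<and> emeasure \<mu> UNIV = ennreal A \<and>
              (\<integral>\<^sup>+ x. ennreal ((norm x)\<^sup>2) \<partial>\<mu>) < \<infinity>}"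

abbreviation regular :: "('a::euclidean_space) measure \<Rightarrow> bool" where
  "regular \<mu> \<equiv> absolutely_continuous lborel \<mu>"

text \<open>The Lebesgue density. It is meaningful only for regular measures: on other measures
  \<open>RN_deriv\<close> is the zero function, so regularity is always required separately.\<close>

abbreviation dens :: "('a::euclidean_space) measure \<Rightarrow> 'a \<Rightarrow> ennreal" where
  "dens \<mu> \<equiv> RN_deriv lborel \<mu>"

definition transport_maps ::
  "('a::euclidean_space) measure \<Rightarrow> 'a measure \<Rightarrow> ('a \<Rightarrow> 'a) set" where
  "transport_maps \<mu> \<nu> = {T. T \<in> borel_measurable \<mu> \<and> distr \<mu> borel T = \<nu>}"

text \<open>Squared Wasserstein distance in Monge form, to be used for regular measures of equal mass.
  The infimum over the empty set is \<open>\<infinity>\<close>.\<close>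

definition W2_sq :: "('a::euclidean_space) measure \<Rightarrow> 'a measure \<Rightarrow> ennreal" where
  "W2_sq \<mu> \<nu> = (INF T\<in>transport_maps \<mu> \<nu>. \<integral>\<^sup>+ x. ennreal ((norm (T x - x))\<^sup>2) \<partial>\<mu>)"

text \<open>The internal energy. A measure that is not regular has no density in \<open>L\<^sup>\<infinity>\<close>,
  so its energy is \<open>\<infinity>\<close> in the case \<open>m = \<infinity>\<close> too. The density of a
  finite measure is finite almost everywhere, so \<open>enn2real\<close> loses nothing.\<close>

definition internal_energy :: "ereal \<Rightarrow> ('a::euclidean_space) measure \<Rightarrow> ereal" where
  "internal_energy m \<mu> =
     (if \<not> regular \<mu> then \<infinity>
      else if m = \<infinity> then (if esssup lborel (dens \<mu>) \<le> 1 then 0 else \<infinity>)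
      else enn2ereal (\<integral>\<^sup>+ x. ennreal
             (1 / real_of_ereal m * enn2real (dens \<mu> x) powr real_of_ereal m) \<partial>lborel))"

text \<open>The integral \<open>\<integral> f d\<mu>\<close> with values in \<open>(-\<infinity>, \<infinity>]\<close>. For \<open>\<mu>\<close> with finite
  second moment and \<open>f\<close> in \<open>C\<^sup>2\<close> with Hessian bounded below, \<open>f\<close> is bounded below by a
  quadratic polynomial, so that the integral of the negative part is finite and
  \<open>\<infinity> - \<infinity>\<close> does not occur.\<close>

definition potential_energy ::
  "('a::euclidean_space \<Rightarrow> real) \<Rightarrow> 'a measure \<Rightarrow> ereal" where
  "potential_energy f \<mu> =
     enn2ereal (\<integral>\<^sup>+ x. ennreal (f x) \<partial>\<mu>) - enn2ereal (\<integral>\<^sup>+ x. ennreal (- f x) \<partial>\<mu>)"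

definition energy ::
  "ereal \<Rightarrow> ('a::euclidean_space \<Rightarrow> real) \<Rightarrow> 'a measure \<Rightarrow> ereal" where
  "energy m f \<mu> = internal_energy m \<mu> + potential_energy f \<mu>"

text \<open>The functional of the minimizing movement (JKO) step with time step \<open>h\<close>, started
  at \<open>\<mu>\<^sub>0\<close>. At a measure that is not regular the energy is \<open>\<infinity>\<close>, so the value of
  \<open>W2_sq\<close> is irrelevant there.\<close>

definition JKO_functional ::
  "ereal \<Rightarrow> ('a::euclidean_space \<Rightarrow> real) \<Rightarrow> real \<Rightarrow> 'a measure \<Rightarrow> 'a measure \<Rightarrow> ereal" where
  "JKO_functional m f h \<mu>\<^sub>0 \<mu> =
     energy m f \<mu> + ereal (1 / (2 * h)) * enn2ereal (W2_sq \<mu> \<mu>\<^sub>0)"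

end

theory Submission
  imports Defs
begin

text \<open>Let \<open>r1\<close>, \<open>r2\<close> be the densities of the two minimizers, let \<open>\<gamma>1\<close>, \<open>\<gamma>2\<close> be near-optimal plans
  to \<open>\<rho>01 \<le> \<rho>02\<close>, and suppose that \<open>r1 > r2\<close> on a set of positive measure. A piece of \<open>\<gamma>1\<close> and a
  piece of \<open>\<gamma>2\<close> with the same target marginal are exchanged, half of each. The pieces solve a fixed
  point equation which guarantees that the new first marginals \<open>r1 + s/2\<close> and \<open>r2 - s/2\<close> lie between
  \<open>r1\<close> and \<open>r2\<close> pointwise and that \<open>s = r2 - r1\<close> where \<open>r1 > r2\<close>. By convexity the sum of the internal
  energies does not increase; the sums of the potential energies and of the transport costs do not
  change. But in the new plan for the first problem some target points are reached both
  from inside a fixed box and from outside of it, which an optimal plan cannot do: exchanging the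
  targets \<open>y\<close> and \<open>y + v\<close> for a suitable translation \<open>v\<close> gains a fixed amount of transport cost,
  whatever the near-optimal plans were. This contradicts minimality. Since plans replace maps
  throughout, one needs that the Monge infimum from an absolutely continuous source is bounded by
  the cost of every plan.\<close>

section \<open>Transport maps from absolutely continuous measures\<close>

text \<open>Strictness cannot come from the internal energy, which for
  \<open>m = \<infinity>\<close> takes only the values 0 and infinity; it must come from the
  transport cost. Exchanging halves serves this: the first plan keeps half of the piece
  \<open>u\<close> beside half of the piece \<open>w\<close> that replaces it, both with the same
  target density. The two pieces really differ: where \<open>r1\<close> has more mass than
  \<open>r2\<close>, \<open>u\<close> exceeds \<open>w\<close> by at least \<open>r1 - r2\<close>,
  so over a box with such an excess some targets of \<open>u\<close> from inside must be targets of
  \<open>w\<close> from outside. Optimal maps are replaced by maps with errors \<open>c / 4\<close>,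
  so the saving \<open>c\<close> has to be fixed before the maps are chosen. Hence the box depends
  on \<open>r1\<close> and \<open>r2\<close> only, and the overlap estimate uses nothing about the
  target densities except the common bound \<open>r02\<close>. The translation may depend on the
  maps; what is bounded below is its length times the overlapping mass. The order of the initial
  densities enters in the fixed point equation: the targets of any piece of \<open>r1\<close> must
  be a fraction \<open>g\<close> of \<open>r02\<close> with \<open>g \<le> 1\<close>, so that
  \<open>r2\<close> can supply the replacement.\<close>

lemma ternary_digit:
  fixes e :: "nat \<Rightarrow> bool"
  defines "c \<equiv> (\<Sum>k. of_bool (e k) * (1/3) ^ Suc k :: real)"
  shows "\<lfloor>3 ^ Suc n * c\<rfloor> - 3 * \<lfloor>3 ^ n * c\<rfloor> = of_bool (e n)"
proof -
  \<comment> \<open>\<open>t n\<close> is the fractional part of \<open>3 ^ n * c\<close>: as the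
    digits are only 0 and 1, the tail is at most 1/2, and the integer part changes by exactly one
    digit per step.\<close>
  define t where "t n = (\<Sum>k. of_bool (e (n + k)) * (1/3) ^ Suc k :: real)" for n
  have geo: "(\<lambda>k. (1/3) ^ Suc k :: real) sums (1/2)"
    using sums_mult[OF geometric_sums[of "1/3::real"], of "1/3"] by simp
  have summ: "summable (\<lambda>k. of_bool (e (n + k)) * (1/3) ^ Suc k :: real)" for n
    by (rule summable_comparison_test'[OF sums_summable[OF geo], of 0]) auto
  have t_sums: "(\<lambda>k. of_bool (e (n + k)) * (1/3) ^ Suc k :: real) sums t n" for n
    unfolding t_def using summ by (rule summable_sums)
  have t0: "0 \<le> t n" for n
    using sums_le[OF _ sums_zero t_sums[of n]] by simp
  have t1: "t n < 1" for n
    using sums_le[OF _ t_sums[of n] geo] by simp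
  have step: "3 * t n = of_bool (e n) + t (Suc n)" for n
  proof -
    have "t n = of_bool (e n) * (1/3) + (\<Sum>k. of_bool (e (n + Suc k)) * (1/3) ^ Suc (Suc k))"
      unfolding t_def using suminf_split_head[OF summ[of n]] by simp
    also have "(\<Sum>k. of_bool (e (n + Suc k)) * (1/3) ^ Suc (Suc k)) = (1/3) * t (Suc n)"
      unfolding t_def by (subst suminf_mult[OF summ, symmetric]) (simp add: mult_ac)
    finally show ?thesis by simp
  qed
  have c: "c = t 0" by (simp add: c_def t_def)
  have N: "\<exists>N::int. 3 ^ n * c = of_int N + t n" for n
  proof (induction n)
    case 0
    then show ?case by (auto simp: c intro: exI[of _ 0])
  next
    case (Suc n)
    then obtain N :: int where "3 ^ n * c = of_int N + t n" by auto
    then have "3 ^ Suc n * c = of_int (3 * N + of_bool (e n)) + t (Suc n)"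
      using step[of n] by simp
    then show ?case by blast
  qed
  obtain N :: int where N: "3 ^ n * c = of_int N + t n" using N by blast
  then have "3 ^ Suc n * c = of_int (3 * N + of_bool (e n)) + t (Suc n)"
    using step[of n] by simp
  then have "\<lfloor>3 ^ Suc n * c\<rfloor> = 3 * N + of_bool (e n)"
    using t0[of "Suc n"] t1[of "Suc n"] by (intro floor_unique) simp_all
  moreover have "\<lfloor>3 ^ n * c\<rfloor> = N"
    using N t0[of n] t1[of n] by (simp add: floor_unique)
  ultimately show ?thesis by simp
qed

text \<open>A point is encoded by the truth values of \<open>x \<bullet> i < q\<close> for basis vectors \<open>i\<close> and rationals \<open>q\<close>,
  read as ternary digits 0 and 1, so that no carries make the expansion ambiguous.\<close>

lemma borel_encoding_real:
  obtains c :: "'b::euclidean_space \<Rightarrow> real" and d :: "real \<Rightarrow> 'b"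
  where "c \<in> borel_measurable borel" "d \<in> borel_measurable borel" "\<And>x. d (c x) = x"
proof -
  define q :: "nat \<Rightarrow> real" where "q l = real_of_rat (from_nat l)" for l
  define e :: "nat \<Rightarrow> 'b \<Rightarrow> bool" where
    "e n x \<longleftrightarrow> x \<bullet> from_nat_into Basis (fst (prod_decode n)) < q (snd (prod_decode n))" for n x
  define c :: "'b \<Rightarrow> real" where "c x = (\<Sum>k. of_bool (e k x) * (1/3) ^ Suc k)" for x
  define dig where "dig n r \<longleftrightarrow> \<lfloor>3 ^ Suc n * r\<rfloor> - 3 * \<lfloor>3 ^ n * r\<rfloor> = 1" for n and r :: real
  \<comment> \<open>A coordinate is recovered as the infimum of the rationals above it; rationals
    whose digit is 0 are discarded by the value \<open>\<infinity>\<close>.\<close>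
  define d :: "real \<Rightarrow> 'b" where "d r = (\<Sum>i\<in>Basis. real_of_ereal (INF l. if dig (prod_encode (to_nat_on Basis i, l)) r
       then ereal (q l) else \<infinity>) *\<^sub>R i)" for r
  have [measurable]: "Measurable.pred borel (e n)" for n
    unfolding e_def by measurable
  have [measurable]: "Measurable.pred borel (dig n)" for n
    unfolding dig_def by measurable
  have "c \<in> borel_measurable borel" unfolding c_def by measurable
  moreover have "d \<in> borel_measurable borel" unfolding d_def by measurable
  moreover have "d (c x) = x" for x
  proof -
    have dig: "dig n (c x) \<longleftrightarrow> e n x" for n
      unfolding dig_def c_def ternary_digit by simp
    have "(INF l. if dig (prod_encode (to_nat_on Basis i, l)) (c x) then ereal (q l) else \<infinity>) = ereal (x \<bullet> i)"
      if i: "i \<in> Basis" for i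
    proof -
      have e: "e (prod_encode (to_nat_on Basis i, l)) x \<longleftrightarrow> x \<bullet> i < q l" for l
        using i by (simp add: e_def countable_finite)
      show ?thesis
        unfolding dig e
      proof (rule antisym)
        show "(INF l. if x \<bullet> i < q l then ereal (q l) else \<infinity>) \<le> ereal (x \<bullet> i)"
        proof (rule dense_ge)
          fix z assume "ereal (x \<bullet> i) < z"
          then obtain z' where z': "ereal (x \<bullet> i) < ereal z'" "ereal z' < z" using ereal_dense2 by blast
          then obtain r where r: "x \<bullet> i < real_of_rat r" "real_of_rat r < z'"
            using of_rat_dense[of "x \<bullet> i" z'] by auto
          have q: "q (to_nat r) = real_of_rat r" by (simp add: q_def)
          have "(INF l. if x \<bullet> i < q l then ereal (q l) else \<infinity>) \<le> (if x \<bullet> i < q (to_nat r) then ereal (q (to_nat r)) else \<infinity>)"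
            by (rule INF_lower) simp
          also have "\<dots> \<le> z" using r z' unfolding q
            by (smt (verit, best) ereal_less_eq(3) less_imp_le order_trans)
          finally show "(INF l. if x \<bullet> i < q l then ereal (q l) else \<infinity>) \<le> z" .
        qed
        show "ereal (x \<bullet> i) \<le> (INF l. if x \<bullet> i < q l then ereal (q l) else \<infinity>)"
          by (rule INF_greatest) auto
      qed
    qed
    then have "d (c x) = (\<Sum>i\<in>Basis. (x \<bullet> i) *\<^sub>R i)" unfolding d_def by (intro sum.cong) auto
    then show ?thesis by (simp add: euclidean_representation)
  qed
  ultimately show thesis using that by blast
qed

text \<open>Without atoms the cdf is continuous, so a nonempty sublevel set with
  \<open>t < 1\<close> is a closed half line ending at a point where the cdf equals
  \<open>t\<close>. This is the probability integral transform: the cdf is uniformly distributed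
  under \<open>M\<close>. An empty sublevel set forces \<open>t = 0\<close>.\<close>

lemma atomless_measure_cdf_le:
  assumes "real_distribution M" "\<And>x. measure M {x} = 0" "0 \<le> t" "t \<le> 1"
  shows "measure M {x. cdf M x \<le> t} = t"
proof -
  interpret real_distribution M by fact
  have cont: "isCont (cdf M) x" for x using isCont_cdf assms(2) by blast
  let ?S = "{x. cdf M x \<le> t}"
  show ?thesis
  proof (cases "t = 1 \<or> ?S = {}")
    case True
    then show ?thesis
    proof
      assume "t = 1"
      then have "?S = UNIV" using cdf_bounded_prob by auto
      then show ?thesis using prob_space \<open>t = 1\<close> by simp
    next
      assume e: "?S = {}"
      have "\<not> 0 < t"
      proof
        assume "0 < t"
        then have "eventually (\<lambda>x. cdf M x < t) at_bot"
          using cdf_lim_at_bot order_tendstoD(2) by blast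
        then obtain x where "cdf M x < t" using eventually_happens' trivial_limit_at_bot_linorder by blast
        then have "x \<in> ?S" by simp
        then show False using e by blast
      qed
      then show ?thesis using e assms by simp
    qed
  next
    case False
    then have "t < 1" "?S \<noteq> {}" using assms by auto
    then have "eventually (\<lambda>x. t < cdf M x) at_top"
      using cdf_lim_at_top_prob order_tendstoD(1) by blast
    then obtain b where b: "t < cdf M b" using eventually_happens' trivial_limit_at_top_linorder by blast
    have bdd: "x \<le> b" if "x \<in> ?S" for x
      using that b cdf_nondecreasing[of b x] by force
    then have bdd': "bdd_above ?S" by (rule bdd_aboveI)
    have cl: "closed ?S" by (intro closed_Collect_le continuous_intros continuous_at_imp_continuous_on ballI cont)
    define s where "s = Sup ?S"
    have s: "s \<in> ?S" unfolding s_def using closed_contains_Sup[OF \<open>?S \<noteq> {}\<close> bdd' cl] .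
    have "\<not> cdf M s < t"
    proof
      assume "cdf M s < t"
      then have "eventually (\<lambda>x. cdf M x < t) (at_right s)"
        using cont[of s] order_tendstoD(2) unfolding isCont_def
        by (metis filterlim_at_split)
      then obtain u where "u > s" "\<And>y. y > s \<Longrightarrow> y < u \<Longrightarrow> cdf M y < t"
        by (auto simp: eventually_at_right_field)
      moreover obtain y where "s < y" "y < u" using dense \<open>u > s\<close> by blast
      ultimately have "y \<in> ?S" by force
      then have "y \<le> s" unfolding s_def using bdd' by (rule cSup_upper)
      then show False using \<open>s < y\<close> by simp
    qed
    then have F: "cdf M s = t" using s by simp
    have "?S = {..s}"
    proof safe
      fix x assume "cdf M x \<le> t" then show "x \<le> s" unfolding s_def using bdd' by (intro cSup_upper) auto
    next
      fix x assume "x \<le> s" then show "cdf M x \<le> t" using cdf_nondecreasing F by metis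
    qed
    then show ?thesis using F by (simp add: cdf_def2)
  qed
qed

text \<open>Monotone rearrangement: the cdf of \<open>M\<close> maps \<open>M\<close> to the uniform
  distribution on the unit interval, and the quantile function of \<open>N\<close> maps that to
  \<open>N\<close>.\<close>

lemma transport_map_real:
  assumes M: "real_distribution M" "\<And>x. measure M {x} = 0" and N: "real_distribution N"
  obtains \<tau> :: "real \<Rightarrow> real" where "\<tau> \<in> borel_measurable borel" "distr M borel \<tau> = N"
proof -
  interpret M: cdf_distribution M unfolding cdf_distribution_def by fact
  interpret N: cdf_distribution N unfolding cdf_distribution_def by fact
  note cle = atomless_measure_cdf_le[OF M]
  have [measurable_cong]: "sets M = sets borel" by simp
  \<comment> \<open>The default 0 is taken on an \<open>M\<close>-null set only, as
    \<open>pos\<close> and \<open>lt1\<close> show.\<close>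
  define \<tau> where "\<tau> x = (if cdf M x \<in> {0<..<1} then Inf {z. cdf M x \<le> cdf N z} else 0)" for x
  have "(\<lambda>w. if w \<in> {0<..<1} then Inf {z. w \<le> cdf N z} else 0) \<in> borel_measurable borel"
  proof -
    have "(\<lambda>w. if w \<in> {0<..<1} then Inf {z. w \<le> cdf N z} else 0)
        = (\<lambda>w. indicator {0<..<1} w *\<^sub>R Inf {z. w \<le> cdf N z})" by auto
    then show ?thesis using N.measurable_CI by (simp add: borel_measurable_restrict_space_iff)
  qed
  then have \<tau>[measurable]: "\<tau> \<in> borel_measurable borel"
    unfolding \<tau>_def by measurable
  have pos: "AE x in M. 0 < cdf M x"
    using cle[of 0] by (intro AE_I'[of "{x. cdf M x \<le> 0}"]) (auto simp: null_sets_def M.emeasure_eq_measure)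
  have "1 - 1 / Suc n \<le> measure M {x. cdf M x < 1}" for n
  proof -
    have "1 - 1 / Suc n = measure M {x. cdf M x \<le> 1 - 1 / Suc n}"
      by (subst cle) (auto simp: field_simps)
    also have "\<dots> \<le> measure M {x. cdf M x < 1}"
      by (intro M.finite_measure_mono) (auto intro: le_less_trans)
    finally show ?thesis .
  qed
  then have "1 \<le> measure M {x. cdf M x < 1}"
    by (intro tendsto_upperbound[of "\<lambda>n. 1 - 1 / Suc n" 1 sequentially])
       (use LIMSEQ_inverse_real_of_nat_add_minus[of 1] in \<open>auto simp: divide_inverse\<close>)
  then have "measure M {x. cdf M x < 1} = 1" using M.prob_le_1 by (simp add: antisym)
  then have lt1: "AE x in M. cdf M x < 1"
    using M.prob_eq_1[of "{x. cdf M x < 1}"] by simp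
  have "distr M borel \<tau> = N"
  proof (rule cdf_unique)
    show "real_distribution (distr M borel \<tau>)" by simp
    show "real_distribution N" by fact
    show "cdf (distr M borel \<tau>) = cdf N"
    proof
      fix z
      have "cdf (distr M borel \<tau>) z = measure M {x. \<tau> x \<le> z}"
        by (simp add: cdf_def measure_distr vimage_def)
      also have "\<dots> = measure M {x. cdf M x \<le> cdf N z}"
      proof (rule M.finite_measure_eq_AE)
        show "AE x in M. x \<in> {x. \<tau> x \<le> z} \<longleftrightarrow> x \<in> {x. cdf M x \<le> cdf N z}"
          using pos lt1
        proof eventually_elim
          case (elim x)
          then show ?case using N.pseudoinverse[of "cdf M x" z] by (simp add: \<tau>_def)
        qed
      qed simp_all
      also have "\<dots> = cdf N z" by (rule cle) (auto simp: N.cdf_nonneg N.cdf_bounded_prob)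
      finally show "cdf (distr M borel \<tau>) z = cdf N z" .
    qed
  qed
  with \<tau> that show thesis by blast
qed

text \<open>One coordinate suffices as a source of randomness: hyperplanes are Lebesgue null, so the
  law of \<open>x \<bullet> b\<close> has no atoms. The target is coded into the reals, reached
  there by the one-dimensional map and decoded. No control of the cost is claimed. The factor
  \<open>k\<close> normalises the common mass; for \<open>A \<le> 0\<close> both measures
  vanish.\<close>

lemma transport_map_exists:
  fixes \<mu> :: "'a::euclidean_space measure" and N :: "'b::euclidean_space measure"
  assumes \<mu>: "sets \<mu> = sets borel" "absolutely_continuous lborel \<mu>" "emeasure \<mu> UNIV = ennreal A"
    and N: "sets N = sets borel" "emeasure N UNIV = ennreal A"
  obtains \<tau> :: "'a \<Rightarrow> 'b" where "\<tau> \<in> borel_measurable borel" "distr \<mu> borel \<tau> = N"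
proof (cases "A > 0")
  case False
  then have z: "emeasure \<mu> UNIV = 0" "emeasure N UNIV = 0" using \<mu> N by (auto simp: ennreal_neg)
  have [measurable_cong]: "sets \<mu> = sets borel" by fact
  have "distr \<mu> borel (\<lambda>_. 0) = N"
  proof (rule measure_eqI)
    fix S :: "'b set" assume "S \<in> sets (distr \<mu> borel (\<lambda>_. 0))"
    have "emeasure N S \<le> emeasure N UNIV" by (rule emeasure_mono) (auto simp: N(1))
    moreover have "emeasure (distr \<mu> borel (\<lambda>_. 0::'b)) S \<le> emeasure (distr \<mu> borel (\<lambda>_. 0::'b)) UNIV"
      by (rule emeasure_mono) auto
    moreover have "emeasure (distr \<mu> borel (\<lambda>_. 0::'b)) UNIV = 0"
      using z \<mu>(1) by (simp add: emeasure_distr sets_eq_imp_space_eq[of \<mu> borel])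
    ultimately show "emeasure (distr \<mu> borel (\<lambda>_. 0)) S = emeasure N S" using z by simp
  qed (simp add: N)
  then show thesis using that[of "\<lambda>_. 0"] by simp
next
  case True
  obtain c :: "'b \<Rightarrow> real" and d where cd[measurable]: "c \<in> borel_measurable borel" "d \<in> borel_measurable borel"
    and dc: "\<And>x. d (c x) = x" using borel_encoding_real by blast
  obtain b :: 'a where b: "b \<in> Basis" by (meson nonempty_Basis ex_in_conv)
  have [measurable_cong]: "sets \<mu> = sets borel" "sets N = sets borel" by fact+
  have sp: "space \<mu> = UNIV" "space N = UNIV"
    using sets_eq_imp_space_eq[OF \<mu>(1)] sets_eq_imp_space_eq[OF N(1)] by simp_all
  define k where "k = ennreal (1 / A)"
  have k: "k * ennreal A = 1" using True by (simp add: k_def ennreal_mult[symmetric])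
  define M' where "M' = distr (scale_measure k \<mu>) borel (\<lambda>x. x \<bullet> b)"
  define N' where "N' = distr (scale_measure k N) borel c"
  have pM: "prob_space (scale_measure k \<mu>)" using \<mu> k sp by (auto intro!: prob_spaceI simp: space_scale_measure)
  have pN: "prob_space (scale_measure k N)" using N k sp by (auto intro!: prob_spaceI simp: space_scale_measure)
  have M': "real_distribution M'" unfolding M'_def
    by (intro prob_space.real_distribution_distr pM) simp
  have N': "real_distribution N'" unfolding N'_def
    by (intro prob_space.real_distribution_distr pN) simp
  have at: "measure M' {t} = 0" for t
  proof -
    have "negligible {x. x \<bullet> b = t}" using negligible_standard_hyperplane[OF b] .
    then have "{x. x \<bullet> b = t} \<in> null_sets lebesgue" by (simp add: negligible_iff_null_sets)
    then have "{x. x \<bullet> b = t} \<in> null_sets lborel"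
      by (subst (asm) null_sets_completion_iff) auto
    then have "{x. x \<bullet> b = t} \<in> null_sets \<mu>" using \<mu>(2) by (auto simp: absolutely_continuous_def)
    then have "emeasure M' {t} = 0" unfolding M'_def
      by (subst emeasure_distr) (auto simp: space_scale_measure sp vimage_def null_sets_def)
    then show ?thesis by (simp add: measure_def)
  qed
  obtain \<tau> where \<tau>[measurable]: "\<tau> \<in> borel_measurable borel" and d\<tau>: "distr M' borel \<tau> = N'"
    using transport_map_real[OF M' at N'] by blast
  define T where "T x = d (\<tau> (x \<bullet> b))" for x
  have T[measurable]: "T \<in> borel_measurable borel" unfolding T_def by measurable
  have "distr \<mu> borel T = N"
  proof (rule measure_eqI)
    fix S assume "S \<in> sets (distr \<mu> borel T)"
    then have S[measurable]: "S \<in> sets borel" by simp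
    have "k * emeasure \<mu> (T -` S) = emeasure (distr M' borel \<tau>) (d -` S)"
    proof -
      have dS: "d -` S \<in> sets borel" "\<tau> -` d -` S \<in> sets borel"
        by (simp_all add: measurable_sets_borel[OF cd(2)] measurable_sets_borel[OF \<tau>] S)
      have "emeasure (distr M' borel \<tau>) (d -` S) = emeasure M' (\<tau> -` d -` S)"
        using dS by (subst emeasure_distr) (auto simp: M'_def)
      also have "\<dots> = emeasure (scale_measure k \<mu>) (T -` S)"
        unfolding M'_def using dS by (subst emeasure_distr) (auto simp: space_scale_measure sp T_def vimage_def)
      finally show ?thesis by simp
    qed
    also have "\<dots> = k * emeasure N S" unfolding d\<tau> N'_def
      using measurable_sets_borel[OF cd(2) S]
      by (subst emeasure_distr) (auto simp: space_scale_measure sp dc vimage_def)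
    finally have "ennreal A * (k * emeasure \<mu> (T -` S)) = ennreal A * (k * emeasure N S)" by simp
    then have "emeasure \<mu> (T -` S) = emeasure N S"
      using k by (simp add: mult.assoc[symmetric] mult.commute[of _ k])
    then show "emeasure (distr \<mu> borel T) S = emeasure N S"
      by (subst emeasure_distr) (auto simp: sp)
  qed (simp add: N)
  then show thesis using that T by blast
qed

section \<open>The Monge infimum is bounded by the cost of any plan\<close>

lemma borel_measurable_fst_snd:
  "(fst :: 'a::topological_space \<times> 'b::topological_space \<Rightarrow> 'a) \<in> borel_measurable borel"
  "(snd :: 'a \<times> 'b \<Rightarrow> 'b) \<in> borel_measurable borel"
  by (rule borel_measurable_continuous_onI, intro continuous_intros)+

text \<open>Space is cut into countably many cells, a point belonging to the first member of a dense
  sequence within distance \<open>t\<close>; two points of a cell are less than \<open>2 * t\<close>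
  apart. Since \<open>\<mu>\<close> is the first marginal of \<open>\<gamma>\<close>, each cell has
  the same mass as the part of \<open>\<gamma>\<close> lying over it, and
  \<open>transport_map_exists\<close>, with the product space as target, carries one onto the other.
  The glued map keeps its first component in the cell of \<open>x\<close>.\<close>

lemma near_identity_transport:
  fixes \<gamma> :: "('a::euclidean_space \<times> 'a) measure"
  assumes \<mu>: "sets \<mu> = sets borel" "absolutely_continuous lborel \<mu>" "emeasure \<mu> UNIV = ennreal A"
    and \<gamma>: "sets \<gamma> = sets borel" "distr \<gamma> borel fst = \<mu>" and t: "0 < t"
  obtains \<tau> where "\<tau> \<in> borel_measurable borel" "distr \<mu> borel \<tau> = \<gamma>"
    "AE x in \<mu>. dist (fst (\<tau> x)) x < 2 * t"
proof -
  have [measurable_cong]: "sets \<mu> = sets borel" "sets \<gamma> = sets borel" by fact+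
  have sp: "space \<mu> = UNIV" "space \<gamma> = UNIV"
    using sets_eq_imp_space_eq[OF \<mu>(1)] sets_eq_imp_space_eq[OF \<gamma>(1)] by simp_all
  obtain D :: "'a set" where D: "countable D" "\<And>X. open X \<Longrightarrow> X \<noteq> {} \<Longrightarrow> \<exists>d\<in>D. d \<in> X"
    using countable_dense_setE by blast
  have "D \<noteq> {}" using D(2)[of UNIV] by auto
  define q where "q = from_nat_into D"
  have near: "\<exists>n. dist x (q n) < t" for x
  proof -
    obtain d where "d \<in> D" "dist x d < t" using D(2)[of "ball x t"] t by auto
    then show ?thesis unfolding q_def using D(1) from_nat_into_surj by metis
  qed
  define idx where "idx x = (LEAST n. dist x (q n) < t)" for x
  have idx: "dist x (q (idx x)) < t" for x unfolding idx_def using near[of x] by (rule LeastI_ex)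
  have [measurable]: "idx \<in> measurable borel (count_space UNIV)" unfolding idx_def by measurable
  have Q[measurable]: "{x. idx x = n} \<in> sets borel" for n by measurable
  have Q2[measurable]: "{z::'a\<times>'a. idx (fst z) = n} \<in> sets borel" for n
    using measurable_sets_borel[OF borel_measurable_fst_snd(1) Q[of n]] by (simp add: vimage_def)
  define \<mu>n where "\<mu>n n = density \<mu> (indicator {x. idx x = n})" for n
  define \<gamma>n where "\<gamma>n n = density \<gamma> (indicator {z. idx (fst z) = n})" for n
  have em\<mu>: "emeasure (\<mu>n n) S = emeasure \<mu> (S \<inter> {x. idx x = n})" if "S \<in> sets borel" for n S
    unfolding \<mu>n_def using that
    by (subst emeasure_density) (auto simp: indicator_inter_arith[symmetric] Int_commute)
  have em\<gamma>: "emeasure (\<gamma>n n) S = emeasure \<gamma> (S \<inter> {z. idx (fst z) = n})" if "S \<in> sets borel" for n S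
    unfolding \<gamma>n_def using that
    by (subst emeasure_density) (auto simp: indicator_inter_arith[symmetric] Int_commute)
  have "\<exists>\<tau>. \<tau> \<in> borel_measurable borel \<and> distr (\<mu>n n) borel \<tau> = \<gamma>n n" for n
  proof -
    have fin: "emeasure \<mu> {x. idx x = n} \<noteq> \<infinity>"
    proof -
      have "emeasure \<mu> {x. idx x = n} \<le> emeasure \<mu> UNIV" by (intro emeasure_mono) (auto simp: \<mu>)
      then show ?thesis using \<mu>(3) by (auto simp: top_unique)
    qed
    have "emeasure \<mu> {x. idx x = n} = emeasure \<gamma> {z. idx (fst z) = n}"
      unfolding \<gamma>(2)[symmetric] using borel_measurable_fst_snd(1)
      by (subst emeasure_distr) (auto simp: sp vimage_def measurable_cong_sets[OF \<gamma>(1) refl])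
    then have "emeasure (\<mu>n n) UNIV = emeasure (\<gamma>n n) UNIV" by (simp add: em\<mu> em\<gamma>)
    moreover have "emeasure (\<mu>n n) UNIV = ennreal (measure \<mu> {x. idx x = n})"
      using fin by (subst em\<mu>) (simp_all add: emeasure_eq_ennreal_measure)
    moreover have "absolutely_continuous lborel (\<mu>n n)"
      unfolding absolutely_continuous_def
    proof
      fix N assume "N \<in> null_sets (lborel :: 'a measure)"
      then have "N \<in> null_sets \<mu>" using \<mu>(2) by (auto simp: absolutely_continuous_def)
      then show "N \<in> null_sets (\<mu>n n)"
        by (auto simp: null_sets_def em\<mu> \<mu>n_def[THEN arg_cong[where f=sets]] \<mu>(1) intro: emeasure_eq_0)
    qed
    moreover have "sets (\<mu>n n) = sets borel" "sets (\<gamma>n n) = sets borel"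
      by (simp_all add: \<mu>n_def \<gamma>n_def \<mu> \<gamma>)
    ultimately show ?thesis using transport_map_exists[of "\<mu>n n" _ "\<gamma>n n"] by metis
  qed
  then obtain \<tau> where \<tau>[measurable]: "\<And>n. \<tau> n \<in> borel_measurable borel"
    and d\<tau>: "\<And>n. distr (\<mu>n n) borel (\<tau> n) = \<gamma>n n" by metis
  define T where "T x = \<tau> (idx x) x" for x
  have T[measurable]: "T \<in> borel_measurable borel" unfolding T_def by measurable
  have sp\<mu>n: "space (\<mu>n n) = UNIV" "sets (\<mu>n n) = sets borel" for n by (auto simp: \<mu>n_def sp \<mu>)
  have part: "emeasure M S = (\<Sum>n. emeasure M (S \<inter> {x. f x = n}))"
    if [measurable]: "S \<in> sets M" "f \<in> measurable M (count_space UNIV)" and "space M = UNIV" for M :: "'b measure" and S and f :: "'b \<Rightarrow> nat"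
  proof -
    have "{x. f x = n} = f -` {n} \<inter> space M" for n using that(3) by auto
    then have m: "{x. f x = n} \<in> sets M" for n using that(2) by simp
    have "(\<Sum>n. emeasure M (S \<inter> {x. f x = n})) = emeasure M (\<Union>n. S \<inter> {x. f x = n})"
      using m that(1) by (intro suminf_emeasure) (auto simp: disjoint_family_on_def)
    also have "(\<Union>n. S \<inter> {x. f x = n}) = S" by auto
    finally show ?thesis by simp
  qed
  have dT: "distr \<mu> borel T = \<gamma>"
  proof (rule measure_eqI)
    fix S assume "S \<in> sets (distr \<mu> borel T)"
    then have S[measurable]: "S \<in> sets borel" by simp
    have TS: "T -` S \<in> sets borel" "\<tau> n -` S \<in> sets borel" for n
      using measurable_sets_borel[OF T S] measurable_sets_borel[OF \<tau> S] by auto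
    have "emeasure (distr \<mu> borel T) S = emeasure \<mu> (T -` S)" using TS by (subst emeasure_distr) (auto simp: sp)
    also have "\<dots> = (\<Sum>n. emeasure \<mu> (T -` S \<inter> {x. idx x = n}))"
      using TS sp by (intro part) (auto simp: \<mu>)
    also have "\<dots> = (\<Sum>n. emeasure (distr (\<mu>n n) borel (\<tau> n)) S)"
    proof (intro suminf_cong)
      fix n
      have "T -` S \<inter> {x. idx x = n} = \<tau> n -` S \<inter> {x. idx x = n}" by (auto simp: T_def)
      moreover have "emeasure (distr (\<mu>n n) borel (\<tau> n)) S = emeasure (\<mu>n n) (\<tau> n -` S)"
        using TS by (subst emeasure_distr) (auto simp: sp\<mu>n measurable_cong_sets[OF sp\<mu>n(2) refl])
      ultimately show "emeasure \<mu> (T -` S \<inter> {x. idx x = n}) = emeasure (distr (\<mu>n n) borel (\<tau> n)) S"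
        using TS by (simp add: em\<mu>)
    qed
    also have "\<dots> = (\<Sum>n. emeasure \<gamma> (S \<inter> {z. idx (fst z) = n}))"
      unfolding d\<tau> by (simp add: em\<gamma>)
    also have "\<dots> = emeasure \<gamma> S"
    proof (rule part[symmetric])
      have "(\<lambda>z. idx (fst z)) \<in> measurable borel (count_space UNIV)"
        by (rule measurable_compose[OF borel_measurable_fst_snd(1)]) simp
      then show "(\<lambda>z. idx (fst z)) \<in> measurable \<gamma> (count_space UNIV)" by (simp cong: measurable_cong_sets add: \<gamma>(1) measurable_cong_sets[OF \<gamma>(1) refl])
    qed (auto simp: sp \<gamma>)
    finally show "emeasure (distr \<mu> borel T) S = emeasure \<gamma> S" .
  qed (simp add: \<gamma>)
  have "AE x in \<mu>. \<forall>n. idx x = n \<longrightarrow> idx (fst (\<tau> n x)) = n"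
    unfolding AE_all_countable
  proof
    fix n
    have "AE z in \<gamma>n n. idx (fst z) = n"
      unfolding \<gamma>n_def by (subst AE_density) (auto simp: indicator_def measurable_cong_sets[OF \<gamma>(1) refl])
    then have "AE x in \<mu>n n. idx (fst (\<tau> n x)) = n"
      unfolding d\<tau>[symmetric]
      by (subst (asm) AE_distr_iff) (auto simp: measurable_cong_sets[OF sp\<mu>n(2) refl])
    then show "AE x in \<mu>. idx x = n \<longrightarrow> idx (fst (\<tau> n x)) = n"
      unfolding \<mu>n_def by (subst (asm) AE_density) (auto simp: indicator_def measurable_cong_sets[OF \<mu>(1) refl])
  qed
  then have "AE x in \<mu>. dist (fst (T x)) x < 2 * t"
  proof eventually_elim
    case (elim x)
    then have "idx (fst (T x)) = idx x" by (auto simp: T_def)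
    then have "dist (fst (T x)) (q (idx x)) < t" "dist x (q (idx x)) < t"
      using idx[of "fst (T x)"] idx[of x] by simp_all
    then show ?case using dist_triangle2[of "fst (T x)" x "q (idx x)"] by simp
  qed
  with T dT that show thesis by blast
qed

lemma norm_add_sq_le:
  fixes a b :: "'a::real_inner"
  assumes "0 < t"
  shows "(norm (a + b))\<^sup>2 \<le> (1 + t) * (norm a)\<^sup>2 + (1 + 1 / t) * (norm b)\<^sup>2"
proof -
  have "0 \<le> (sqrt t * norm a - norm b / sqrt t)\<^sup>2" by simp
  also have "\<dots> = t * (norm a)\<^sup>2 + (norm b)\<^sup>2 / t - 2 * (norm a * norm b)"
    using assms by (simp add: power2_diff power_mult_distrib power_divide field_simps)
  finally have "2 * (norm a * norm b) \<le> t * (norm a)\<^sup>2 + (norm b)\<^sup>2 / t" by simp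
  moreover have "(norm (a + b))\<^sup>2 \<le> (norm a + norm b)\<^sup>2"
    by (intro power_mono norm_triangle_ineq) auto
  ultimately show ?thesis by (simp add: power2_sum algebra_simps)
qed

text \<open>The second component of a map as in \<open>near_identity_transport\<close> is a
  transport map to \<open>\<nu>\<close>. Its cost differs from that of the plan only because the
  source point is displaced by less than \<open>2 * t\<close>, and this error vanishes with
  \<open>t\<close>.\<close>

lemma W2_sq_le_plan:
  fixes \<gamma> :: "('a::euclidean_space \<times> 'a) measure"
  assumes \<mu>: "sets \<mu> = sets borel" "absolutely_continuous lborel \<mu>" "emeasure \<mu> UNIV = ennreal A"
    and \<gamma>: "sets \<gamma> = sets borel" "distr \<gamma> borel fst = \<mu>" "distr \<gamma> borel snd = \<nu>"
  shows "W2_sq \<mu> \<nu> \<le> (\<integral>\<^sup>+ z. ennreal ((norm (snd z - fst z))\<^sup>2) \<partial>\<gamma>)" (is "_ \<le> ?C")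
proof (cases "?C = \<infinity>")
  case False
  then obtain c where c: "?C = ennreal c" "0 \<le> c" by (cases ?C) auto
  \<comment> \<open>\<open>A\<close> may be negative; \<open>B\<close> is the actual mass.\<close>
  define B where "B = max 0 A"
  have A: "emeasure \<mu> UNIV = ennreal B" "0 \<le> B" using \<mu>(3) by (simp_all add: B_def)
  have [measurable_cong]: "sets \<mu> = sets borel" "sets \<gamma> = sets borel" by fact+
  have sp: "space \<mu> = UNIV" "space \<gamma> = UNIV"
    using sets_eq_imp_space_eq[OF \<mu>(1)] sets_eq_imp_space_eq[OF \<gamma>(1)] by simp_all
  \<comment> \<open>The weight in \<open>norm_add_sq_le\<close> is tied to the displacement, so that
    the error per unit of mass is
    \<open>(1 + 1 / t) * (2 * t)\<^sup>2 = 4 * t\<^sup>2 + 4 * t\<close>.\<close>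
  have bound: "W2_sq \<mu> \<nu> \<le> ennreal ((1 + t) * c + (4 * t\<^sup>2 + 4 * t) * B)" if t: "0 < t" for t
  proof -
    obtain \<tau> where \<tau>[measurable]: "\<tau> \<in> borel_measurable borel" and d\<tau>: "distr \<mu> borel \<tau> = \<gamma>"
      and ae: "AE x in \<mu>. dist (fst (\<tau> x)) x < 2 * t"
      using near_identity_transport[OF \<mu> \<gamma>(1,2) t] by blast
    define T where "T x = snd (\<tau> x)" for x
    note fst_m = borel_measurable_fst_snd(1) and snd_m = borel_measurable_fst_snd(2)
    have Tm[measurable]: "T \<in> borel_measurable borel" and fm[measurable]: "(\<lambda>x. fst (\<tau> x)) \<in> borel_measurable borel"
      unfolding T_def using measurable_compose[OF \<tau> snd_m] measurable_compose[OF \<tau> fst_m] by auto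
    have cm: "(\<lambda>z::'a\<times>'a. ennreal ((norm (snd z - fst z))\<^sup>2)) \<in> borel_measurable borel"
      using snd_m fst_m by measurable
    have "distr \<mu> borel T = distr (distr \<mu> borel \<tau>) borel snd"
      by (subst distr_distr) (auto simp: T_def[abs_def] comp_def snd_m)
    then have "T \<in> transport_maps \<mu> \<nu>"
      by (simp add: transport_maps_def d\<tau> \<gamma>)
    then have "W2_sq \<mu> \<nu> \<le> (\<integral>\<^sup>+ x. ennreal ((norm (T x - x))\<^sup>2) \<partial>\<mu>)"
      unfolding W2_sq_def by (rule INF_lower)
    also have "\<dots> \<le> (\<integral>\<^sup>+ x. ennreal (1 + t) * ennreal ((norm (snd (\<tau> x) - fst (\<tau> x)))\<^sup>2) + ennreal (4 * t\<^sup>2 + 4 * t) \<partial>\<mu>)"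
    proof (rule nn_integral_mono_AE)
      show "AE x in \<mu>. ennreal ((norm (T x - x))\<^sup>2) \<le> ennreal (1 + t) * ennreal ((norm (snd (\<tau> x) - fst (\<tau> x)))\<^sup>2) + ennreal (4 * t\<^sup>2 + 4 * t)"
        using ae
      proof eventually_elim
        case (elim x)
        have "(norm (T x - x))\<^sup>2 = (norm ((snd (\<tau> x) - fst (\<tau> x)) + (fst (\<tau> x) - x)))\<^sup>2"
          by (simp add: T_def)
        also have "\<dots> \<le> (1 + t) * (norm (snd (\<tau> x) - fst (\<tau> x)))\<^sup>2 + (1 + 1 / t) * (norm (fst (\<tau> x) - x))\<^sup>2"
          by (rule norm_add_sq_le[OF t])
        also have "(1 + 1 / t) * (norm (fst (\<tau> x) - x))\<^sup>2 \<le> (1 + 1 / t) * (2 * t)\<^sup>2"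
          using elim t by (intro mult_left_mono power_mono) (auto simp: dist_norm)
        also have "(1 + 1 / t) * (2 * t)\<^sup>2 = 4 * t\<^sup>2 + 4 * t"
          using t by (simp add: field_simps power2_eq_square)
        finally show ?case using t by (simp add: ennreal_mult[symmetric] ennreal_plus[symmetric] del: ennreal_plus)
      qed
    qed
    also have "\<dots> = ennreal (1 + t) * (\<integral>\<^sup>+ x. ennreal ((norm (snd (\<tau> x) - fst (\<tau> x)))\<^sup>2) \<partial>\<mu>) + ennreal (4 * t\<^sup>2 + 4 * t) * emeasure \<mu> (space \<mu>)"
      by (subst nn_integral_add) (auto simp: nn_integral_cmult T_def[symmetric])
    also have "(\<integral>\<^sup>+ x. ennreal ((norm (snd (\<tau> x) - fst (\<tau> x)))\<^sup>2) \<partial>\<mu>) = ?C"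
      unfolding d\<tau>[symmetric] by (subst nn_integral_distr) (auto simp: cm)
    also have "ennreal (1 + t) * ?C + ennreal (4 * t\<^sup>2 + 4 * t) * emeasure \<mu> (space \<mu>) = ennreal ((1 + t) * c + (4 * t\<^sup>2 + 4 * t) * B)"
      unfolding sp A(1) using t c A(2) by (simp add: ennreal_mult[symmetric] ennreal_plus[symmetric] del: ennreal_plus)
    finally show ?thesis .
  qed
  have "((\<lambda>t. ennreal ((1 + t) * c + (4 * t\<^sup>2 + 4 * t) * B)) \<longlongrightarrow> ennreal ((1 + 0) * c + (4 * 0\<^sup>2 + 4 * 0) * B)) (at_right 0)"
    by (intro tendsto_ennrealI tendsto_intros)
  then have "W2_sq \<mu> \<nu> \<le> ennreal ((1 + 0) * c + (4 * 0\<^sup>2 + 4 * 0) * B)"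
    by (rule tendsto_lowerbound) (auto simp: eventually_at_right_field bound intro: exI[of _ 1])
  then show ?thesis using c by simp
qed simp

section \<open>Plans composed of finitely many weighted maps, and their cost in terms of
  correlations\<close>

lemma abs_inner_le: "\<bar>x \<bullet> y\<bar> \<le> (norm x)\<^sup>2 + (norm y)\<^sup>2" for x y :: "'a::real_inner"
proof -
  have "2 * (norm x * norm y) \<le> (norm x)\<^sup>2 + (norm y)\<^sup>2" using sum_squares_bound[of "norm x" "norm y"] by simp
  moreover have "0 \<le> norm x * norm y" by simp
  ultimately show ?thesis using Cauchy_Schwarz_ineq2[of x y] by linarith
qed

lemma norm_le_one_plus_sq: "norm x \<le> 1 + (norm x)\<^sup>2"
proof -
  have "0 \<le> (norm x - 1)\<^sup>2" by simp
  then have "2 * norm x \<le> 1 + (norm x)\<^sup>2" by (simp add: power2_diff)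
  then show ?thesis using norm_ge_zero[of x] by linarith
qed

text \<open>After an exchange a point may be sent to several targets, so the competitors are plans
  and not maps. Taking the label \<open>l\<close> as an extra coordinate with counting measure makes
  such a plan the push-forward of a single density under a single map.\<close>

lemma labelled_plan:
  fixes p :: "'l::finite \<Rightarrow> 'a::euclidean_space \<Rightarrow> real" and T :: "'l \<Rightarrow> 'a \<Rightarrow> 'b::euclidean_space"
  assumes p[measurable]: "\<And>l. p l \<in> borel_measurable borel"
    and T[measurable]: "\<And>l. T l \<in> borel_measurable borel"
  obtains \<gamma> :: "('a \<times> 'b) measure" where "sets \<gamma> = sets borel"
    "\<And>f. f \<in> borel_measurable borel \<Longrightarrow>
       (\<integral>\<^sup>+ z. f z \<partial>\<gamma>) = (\<Sum>l\<in>UNIV. \<integral>\<^sup>+ x. ennreal (p l x) * f (x, T l x) \<partial>lborel)"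
proof -
  let ?N = "lborel \<Otimes>\<^sub>M count_space (UNIV :: 'l set)"
  interpret C: sigma_finite_measure "count_space (UNIV :: 'l set)"
    by (rule sigma_finite_measure_count_space_finite) simp
  have m: "(\<lambda>z. F (snd z) (fst z)) \<in> measurable ?N K"
    if "\<And>l. F l \<in> measurable borel K" for F :: "'l \<Rightarrow> 'a \<Rightarrow> 'k" and K
    by (rule measurable_compose_countable'[where I = UNIV and g = snd])
       (auto intro!: measurable_compose[OF measurable_fst] that countable_finite)
  define \<gamma> where "\<gamma> = distr (density ?N (\<lambda>z. ennreal (p (snd z) (fst z)))) borel (\<lambda>z. (fst z, T (snd z) (fst z)))"
  have pm: "(\<lambda>z. ennreal (p (snd z) (fst z))) \<in> borel_measurable ?N"
    using m[of p] by measurable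
  have Tm: "(\<lambda>z. (fst z, T (snd z) (fst z))) \<in> measurable ?N borel"
    using m[of "\<lambda>l x. (x, T l x)" borel] by (simp add: borel_measurable_Pair)
  show thesis
  proof (rule that[of \<gamma>])
    show "sets \<gamma> = sets borel" by (simp add: \<gamma>_def)
    fix f :: "'a \<times> 'b \<Rightarrow> ennreal" assume f: "f \<in> borel_measurable borel"
    have fT: "(\<lambda>x. f (x, T l x)) \<in> borel_measurable borel" for l
      by (rule measurable_compose[OF _ f]) (simp add: borel_measurable_Pair)
    have fTm: "(\<lambda>z. f (fst z, T (snd z) (fst z))) \<in> borel_measurable ?N"
      by (rule measurable_compose[OF Tm f])
    have "(\<integral>\<^sup>+ z. f z \<partial>\<gamma>) = (\<integral>\<^sup>+ z. ennreal (p (snd z) (fst z)) * f (fst z, T (snd z) (fst z)) \<partial>?N)"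
      unfolding \<gamma>_def using Tm f pm fTm
      by (subst nn_integral_distr) (auto simp: nn_integral_density)
    also have "\<dots> = (\<integral>\<^sup>+ x. (\<Sum>l\<in>UNIV. ennreal (p l x) * f (x, T l x)) \<partial>lborel)"
      using pm fTm by (subst C.nn_integral_fst[symmetric]) (auto simp: nn_integral_count_space_finite)
    also have "\<dots> = (\<Sum>l\<in>UNIV. \<integral>\<^sup>+ x. ennreal (p l x) * f (x, T l x) \<partial>lborel)"
      using fT by (intro nn_integral_sum) auto
    finally show "(\<integral>\<^sup>+ z. f z \<partial>\<gamma>) = (\<Sum>l\<in>UNIV. \<integral>\<^sup>+ x. ennreal (p l x) * f (x, T l x) \<partial>lborel)" .
  qed
qed

text \<open>Expanding the square leaves the second moments of the marginals and twice the
  correlation of source and target. Only the correlation depends on the plan, and it is linear in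
  the pieces. The second claim is needed because \<open>ennreal\<close> would turn a negative bound
  into 0.\<close>

lemma W2_sq_le_labelled:
  fixes p :: "'l::finite \<Rightarrow> 'a::euclidean_space \<Rightarrow> real" and T :: "'l \<Rightarrow> 'a \<Rightarrow> 'a"
  assumes p[measurable]: "\<And>l. p l \<in> borel_measurable borel" and p0: "\<And>l x. 0 \<le> p l x"
    and T[measurable]: "\<And>l. T l \<in> borel_measurable borel"
    and r[measurable]: "r \<in> borel_measurable borel" and r_eq: "AE x in lborel. r x = (\<Sum>l\<in>UNIV. p l x)"
    and r_int: "integrable lborel r" and r_m2: "integrable lborel (\<lambda>x. (norm x)\<^sup>2 * r x)"
    and \<nu>: "sets \<nu> = sets borel" "integrable \<nu> (\<lambda>y. (norm y)\<^sup>2)"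
    and marg: "\<And>S. S \<in> sets borel \<Longrightarrow>
       emeasure \<nu> S = (\<Sum>l\<in>UNIV. \<integral>\<^sup>+ x. ennreal (p l x) * indicator S (T l x) \<partial>lborel)"
  shows "W2_sq (density lborel r) \<nu> \<le> ennreal ((LBINT x. (norm x)\<^sup>2 * r x) + (LINT y|\<nu>. (norm y)\<^sup>2)
      - 2 * (\<Sum>l\<in>UNIV. LBINT x. p l x * (x \<bullet> T l x)))"
    and "0 \<le> (LBINT x. (norm x)\<^sup>2 * r x) + (LINT y|\<nu>. (norm y)\<^sup>2)
      - 2 * (\<Sum>l\<in>UNIV. LBINT x. p l x * (x \<bullet> T l x))"
proof -
  let ?V = "(LBINT x. (norm x)\<^sup>2 * r x) + (LINT y|\<nu>. (norm y)\<^sup>2)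
      - 2 * (\<Sum>l\<in>UNIV. LBINT x. p l x * (x \<bullet> T l x))"
  obtain \<gamma> :: "('a \<times> 'a) measure" where \<gamma>: "sets \<gamma> = sets borel"
    and nn: "\<And>f. f \<in> borel_measurable borel \<Longrightarrow>
       (\<integral>\<^sup>+ z. f z \<partial>\<gamma>) = (\<Sum>l\<in>UNIV. \<integral>\<^sup>+ x. ennreal (p l x) * f (x, T l x) \<partial>lborel)"
    using labelled_plan[of p T, OF p T] by blast
  note fs[measurable] = borel_measurable_fst_snd
  have [measurable_cong]: "sets \<gamma> = sets borel" "sets \<nu> = sets borel" by fact+
  have sp: "space \<gamma> = UNIV" "space \<nu> = UNIV"
    using sets_eq_imp_space_eq[OF \<gamma>] sets_eq_imp_space_eq[OF \<nu>(1)] by simp_all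
  have fm: "fst \<in> borel_measurable \<gamma>" "snd \<in> borel_measurable \<gamma>"
    using fs by (simp_all add: measurable_cong_sets[OF \<gamma> refl])
  have r0: "AE x in lborel. 0 \<le> r x" using r_eq by eventually_elim (simp add: sum_nonneg p0)
  have fst_nn: "(\<integral>\<^sup>+ z. f (fst z) \<partial>\<gamma>) = (\<integral>\<^sup>+ x. ennreal (r x) * f x \<partial>lborel)"
    if [measurable]: "f \<in> borel_measurable borel" for f
  proof -
    have "(\<integral>\<^sup>+ z. f (fst z) \<partial>\<gamma>) = (\<Sum>l\<in>UNIV. \<integral>\<^sup>+ x. ennreal (p l x) * f x \<partial>lborel)"
      by (subst nn) (auto intro: measurable_compose[OF fs(1)])
    also have "\<dots> = (\<integral>\<^sup>+ x. (\<Sum>l\<in>UNIV. ennreal (p l x) * f x) \<partial>lborel)"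
      by (intro nn_integral_sum[symmetric]) auto
    also have "\<dots> = (\<integral>\<^sup>+ x. ennreal (r x) * f x \<partial>lborel)"
      using r_eq by (intro nn_integral_cong_AE)
        (auto elim!: eventually_mono simp: sum_distrib_right[symmetric] sum_ennreal p0)
    finally show ?thesis .
  qed
  have d_fst: "distr \<gamma> borel fst = density lborel r"
  proof (rule measure_eqI)
    fix S assume "S \<in> sets (distr \<gamma> borel fst)"
    then have S[measurable]: "S \<in> sets borel" by simp
    have "emeasure (distr \<gamma> borel fst) S = (\<integral>\<^sup>+ z. indicator S (fst z) \<partial>\<gamma>)"
      using fm by (subst nn_integral_indicator[symmetric], simp)
        (subst nn_integral_distr, auto)
    then show "emeasure (distr \<gamma> borel fst) S = emeasure (density lborel r) S"
      by (simp add: fst_nn emeasure_density)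
  qed simp
  have d_snd: "distr \<gamma> borel snd = \<nu>"
  proof (rule measure_eqI)
    fix S assume "S \<in> sets (distr \<gamma> borel snd)"
    then have S[measurable]: "S \<in> sets borel" by simp
    have "emeasure (distr \<gamma> borel snd) S = (\<integral>\<^sup>+ z. indicator S (snd z) \<partial>\<gamma>)"
      using fm by (subst nn_integral_indicator[symmetric], simp)
        (subst nn_integral_distr, auto)
    then show "emeasure (distr \<gamma> borel snd) S = emeasure \<nu> S"
      by (subst (asm) nn) (auto simp: marg intro: measurable_compose[OF fs(2)])
  qed (simp add: \<nu>)
  have fin: "emeasure (density lborel r) UNIV = ennreal (LBINT x. r x)"
    using r0 r_int by (simp add: emeasure_density nn_integral_eq_integral)
  have W: "W2_sq (density lborel r) \<nu> \<le> (\<integral>\<^sup>+ z. ennreal ((norm (snd z - fst z))\<^sup>2) \<partial>\<gamma>)"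
    by (rule W2_sq_le_plan[OF _ _ fin \<gamma> d_fst d_snd]) (auto intro: absolutely_continuousI_density)
  have i1: "integrable \<gamma> (\<lambda>z. (norm (fst z))\<^sup>2)"
    using r_m2 r0 unfolding integrable_distr_eq[OF fm(1), of "\<lambda>x. (norm x)\<^sup>2", simplified, symmetric] d_fst
    by (subst integrable_density) (auto simp: mult.commute)
  have v1: "(LINT z|\<gamma>. (norm (fst z))\<^sup>2) = (LBINT x. (norm x)\<^sup>2 * r x)"
    using r0 unfolding integral_distr[OF fm(1), of "\<lambda>x. (norm x)\<^sup>2", simplified, symmetric] d_fst
    by (subst integral_density) (auto simp: mult.commute)
  have i2: "integrable \<gamma> (\<lambda>z. (norm (snd z))\<^sup>2)"
    using \<nu>(2) unfolding integrable_distr_eq[OF fm(2), of "\<lambda>x. (norm x)\<^sup>2", simplified, symmetric] d_snd .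
  have v2: "(LINT z|\<gamma>. (norm (snd z))\<^sup>2) = (LINT y|\<nu>. (norm y)\<^sup>2)"
    unfolding integral_distr[OF fm(2), of "\<lambda>x. (norm x)\<^sup>2", simplified, symmetric] d_snd ..
  have inner_m: "(\<lambda>z::'a\<times>'a. fst z \<bullet> snd z) \<in> borel_measurable borel"
    by (intro borel_measurable_continuous_onI continuous_intros)
  have i3: "integrable \<gamma> (\<lambda>z. fst z \<bullet> snd z)"
    using inner_m abs_inner_le by (intro Bochner_Integration.integrable_bound[OF Bochner_Integration.integrable_add[OF i1 i2]])
       (auto simp: measurable_cong_sets[OF \<gamma> refl])
  have il: "integrable lborel (\<lambda>x. p l x * (x \<bullet> T l x))" for l
  proof (rule integrableI_bounded)
    have "(\<integral>\<^sup>+ x. ennreal (norm (p l x * (x \<bullet> T l x))) \<partial>lborel) = (\<integral>\<^sup>+ x. ennreal (p l x) * ennreal \<bar>x \<bullet> T l x\<bar> \<partial>lborel)"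
      by (intro nn_integral_cong) (simp add: abs_mult p0 ennreal_mult)
    also have "\<dots> \<le> (\<Sum>l\<in>UNIV. \<integral>\<^sup>+ x. ennreal (p l x) * ennreal \<bar>x \<bullet> T l x\<bar> \<partial>lborel)"
      by (rule member_le_sum) auto
    also have "\<dots> = (\<integral>\<^sup>+ z. ennreal \<bar>fst z \<bullet> snd z\<bar> \<partial>\<gamma>)"
      using inner_m by (subst nn) auto
    also have "\<dots> < \<infinity>" using i3 by (auto simp: integrable_iff_bounded)
    finally show "(\<integral>\<^sup>+ x. ennreal (norm (p l x * (x \<bullet> T l x))) \<partial>lborel) < \<infinity>" .
  qed measurable
  \<comment> \<open>Applied with \<open>c = 1\<close> and \<open>c = -1\<close>: as
    \<open>ennreal\<close> truncates, these are the positive and the negative part of the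
    correlation.\<close>
  have pos: "(\<integral>\<^sup>+ z. ennreal (c * (fst z \<bullet> snd z)) \<partial>\<gamma>) = (\<Sum>l\<in>UNIV. \<integral>\<^sup>+ x. ennreal (c * (p l x * (x \<bullet> T l x))) \<partial>lborel)" for c
    using inner_m by (subst nn) (auto simp: ennreal_mult'[OF p0, symmetric] mult_ac)
  have fin_l: "(\<integral>\<^sup>+ x. ennreal (c * (p l x * (x \<bullet> T l x))) \<partial>lborel) < \<infinity>" for c l
  proof -
    have "integrable lborel (\<lambda>x. c * (p l x * (x \<bullet> T l x)))" using il by simp
    then have "(\<integral>\<^sup>+ x. ennreal \<bar>c * (p l x * (x \<bullet> T l x))\<bar> \<partial>lborel) < \<infinity>"
      unfolding integrable_iff_bounded real_norm_def by blast
    then show ?thesis by (rule le_less_trans[rotated]) (intro nn_integral_mono ennreal_leI, simp)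
  qed
  have enn2real_sum: "enn2real (\<Sum>l\<in>UNIV. g l) = (\<Sum>l\<in>UNIV. enn2real (g l))" if "\<And>l::'l. g l < \<infinity>" for g
  proof -
    have "g l = ennreal (enn2real (g l))" for l using that[of l] by (simp add: ennreal_enn2real)
    then have "(\<Sum>l\<in>UNIV. g l) = ennreal (\<Sum>l\<in>UNIV. enn2real (g l))" by (metis (no_types, lifting) enn2real_nonneg sum.cong sum_ennreal)
    then show ?thesis by (simp add: sum_nonneg)
  qed
  have v3: "(LINT z|\<gamma>. fst z \<bullet> snd z) = (\<Sum>l\<in>UNIV. LBINT x. p l x * (x \<bullet> T l x))"
    using i3 il fin_l[of 1] fin_l[of "-1"] pos[of 1] pos[of "-1"]
    by (simp add: real_lebesgue_integral_def enn2real_sum sum_subtractf)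
  have nn0: "0 \<le> (norm (fst z))\<^sup>2 + (norm (snd z))\<^sup>2 - 2 * (fst z \<bullet> snd z)" for z :: "'a \<times> 'a"
  proof -
    have "0 \<le> (norm (fst z - snd z))\<^sup>2" by simp
    then show ?thesis by (simp add: power2_norm_eq_inner inner_diff inner_commute)
  qed
  have val: "(LINT z|\<gamma>. (norm (fst z))\<^sup>2 + (norm (snd z))\<^sup>2 - 2 * (fst z \<bullet> snd z))
    = ?V"
    using i1 i2 i3 by (simp add: v1 v2 v3)
  show "0 \<le> ?V"
    unfolding val[symmetric] by (intro integral_nonneg_AE AE_I2 nn0)
  note W
  also have "(\<integral>\<^sup>+ z. ennreal ((norm (snd z - fst z))\<^sup>2) \<partial>\<gamma>)
     = (\<integral>\<^sup>+ z. ennreal ((norm (fst z))\<^sup>2 + (norm (snd z))\<^sup>2 - 2 * (fst z \<bullet> snd z)) \<partial>\<gamma>)"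
    by (intro nn_integral_cong arg_cong[where f=ennreal])
       (simp add: power2_norm_eq_inner inner_diff inner_commute)
  also have "\<dots> = ennreal (LINT z|\<gamma>. (norm (fst z))\<^sup>2 + (norm (snd z))\<^sup>2 - 2 * (fst z \<bullet> snd z))"
    using i1 i2 i3 nn0 by (intro nn_integral_eq_integral) auto
  also note val
  finally show "W2_sq (density lborel r) \<nu> \<le> ennreal (?V)" .
qed

section \<open>Push-forward of densities and the exchanged pieces\<close>

text \<open>Push-forward phrased by test functions and real densities, so that pieces of a density
  can be split, compared and added without forming measures. Negative values of a density count as
  0.\<close>

definition pushes :: "('a::euclidean_space \<Rightarrow> 'a) \<Rightarrow> ('a \<Rightarrow> real) \<Rightarrow> ('a \<Rightarrow> real) \<Rightarrow> bool" where
  "pushes T r n \<longleftrightarrow> (\<forall>f \<in> borel_measurable borel.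
     (\<integral>\<^sup>+ x. ennreal (r x) * f (T x) \<partial>lborel) = (\<integral>\<^sup>+ y. ennreal (n y) * f y \<partial>lborel))"

lemma pushesD:
  "pushes T r n \<Longrightarrow> f \<in> borel_measurable borel \<Longrightarrow>
    (\<integral>\<^sup>+ x. ennreal (r x) * f (T x) \<partial>lborel) = (\<integral>\<^sup>+ y. ennreal (n y) * f y \<partial>lborel)"
  by (auto simp: pushes_def)

lemma pushes_distr:
  assumes [measurable]: "T \<in> borel_measurable borel" "r \<in> borel_measurable borel" "n \<in> borel_measurable borel"
    and "distr (density lborel r) borel T = density lborel n"
  shows "pushes T r n"
  unfolding pushes_def
proof
  fix f :: "'a \<Rightarrow> ennreal" assume [measurable]: "f \<in> borel_measurable borel"
  have "(\<integral>\<^sup>+ x. ennreal (r x) * f (T x) \<partial>lborel) = (\<integral>\<^sup>+ y. f y \<partial>distr (density lborel r) borel T)"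
    by (subst nn_integral_distr) (auto simp: nn_integral_density)
  also have "\<dots> = (\<integral>\<^sup>+ y. ennreal (n y) * f y \<partial>lborel)"
    unfolding assms(4) by (simp add: nn_integral_density)
  finally show "(\<integral>\<^sup>+ x. ennreal (r x) * f (T x) \<partial>lborel) = (\<integral>\<^sup>+ y. ennreal (n y) * f y \<partial>lborel)" .
qed

lemma pushes_cong_AE:
  assumes "pushes T r n" "AE x in lborel. r x = r' x" "AE x in lborel. n x = n' x"
  shows "pushes T r' n'"
  unfolding pushes_def
proof
  fix f :: "'a \<Rightarrow> ennreal" assume f: "f \<in> borel_measurable borel"
  have "(\<integral>\<^sup>+ x. ennreal (r' x) * f (T x) \<partial>lborel) = (\<integral>\<^sup>+ x. ennreal (r x) * f (T x) \<partial>lborel)"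
    using assms(2) by (intro nn_integral_cong_AE) auto
  also have "\<dots> = (\<integral>\<^sup>+ y. ennreal (n y) * f y \<partial>lborel)" by (rule pushesD[OF assms(1) f])
  also have "\<dots> = (\<integral>\<^sup>+ y. ennreal (n' y) * f y \<partial>lborel)"
    using assms(3) by (intro nn_integral_cong_AE) auto
  finally show "(\<integral>\<^sup>+ x. ennreal (r' x) * f (T x) \<partial>lborel) = (\<integral>\<^sup>+ y. ennreal (n' y) * f y \<partial>lborel)" .
qed

text \<open>Selects from a piece the subpiece with a prescribed target density: of the mass arriving
  at \<open>y\<close> the fraction \<open>k y\<close> is kept, whatever its source.\<close>

lemma pushes_pullback:
  assumes "pushes T r n" and [measurable]: "k \<in> borel_measurable borel" and k: "\<And>y. 0 \<le> k y"
  shows "pushes T (\<lambda>x. k (T x) * r x) (\<lambda>y. k y * n y)"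
  unfolding pushes_def
proof
  fix f :: "'a \<Rightarrow> ennreal" assume [measurable]: "f \<in> borel_measurable borel"
  show "(\<integral>\<^sup>+ x. ennreal (k (T x) * r x) * f (T x) \<partial>lborel) = (\<integral>\<^sup>+ y. ennreal (k y * n y) * f y \<partial>lborel)"
    using pushesD[OF assms(1), of "\<lambda>y. ennreal (k y) * f y"]
    unfolding ennreal_mult'[OF k] by (simp add: mult_ac)
qed

lemma pushes_AE:
  assumes p: "pushes T r n" and [measurable]: "T \<in> borel_measurable borel" "r \<in> borel_measurable borel"
    and "AE y in lborel. P y"
  shows "AE x in lborel. 0 < r x \<longrightarrow> P (T x)"
proof -
  obtain N where N: "{y. \<not> P y} \<subseteq> N" "N \<in> null_sets lborel"
    using assms(4) by (auto simp: eventually_ae_filter)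
  then have [measurable]: "N \<in> sets borel" by auto
  have "(\<integral>\<^sup>+ x. ennreal (r x) * indicator N (T x) \<partial>lborel) = (\<integral>\<^sup>+ y. ennreal (n y) * indicator N y \<partial>lborel)"
    by (rule pushesD[OF p]) simp
  also have "\<dots> = 0" using N(2) by (rule nn_integral_null_set)
  finally have "AE x in lborel. ennreal (r x) * indicator N (T x) = 0"
    by (subst (asm) nn_integral_0_iff_AE) auto
  then show ?thesis by eventually_elim (use N(1) in \<open>auto simp: indicator_def split: if_splits\<close>)
qed

lemma AE_le_of_nn_integral_le:
  fixes f g :: "'a::euclidean_space \<Rightarrow> real"
  assumes [measurable]: "f \<in> borel_measurable borel" and g: "integrable lborel g"
    and f0: "AE x in lborel. 0 \<le> f x" and g0: "AE x in lborel. 0 \<le> g x"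
    and le: "\<And>S. S \<in> sets borel \<Longrightarrow>
      (\<integral>\<^sup>+ x. ennreal (f x) * indicator S x \<partial>lborel) \<le> (\<integral>\<^sup>+ x. ennreal (g x) * indicator S x \<partial>lborel)"
  shows "AE x in lborel. f x \<le> g x"
proof -
  have [measurable]: "g \<in> borel_measurable borel" using g by auto
  have fi: "integrable lborel f"
  proof (rule integrableI_nonneg)
    have "(\<integral>\<^sup>+ x. ennreal (f x) \<partial>lborel) \<le> (\<integral>\<^sup>+ x. ennreal (g x) \<partial>lborel)" using le[of UNIV] by simp
    also have "\<dots> < \<infinity>" using g g0 by (simp add: nn_integral_eq_integral)
    finally show "(\<integral>\<^sup>+ x. ennreal (f x) \<partial>lborel) < \<infinity>" .
  qed (use f0 in auto)
  have "AE x in lborel. 0 \<le> g x - f x"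
  proof (rule sigma_finite_measure.density_nonneg[OF sigma_finite_lborel])
    show "integrable lborel (\<lambda>x. g x - f x)" using g fi by simp
    fix S :: "'a set" assume "S \<in> sets lborel"
    then have S[measurable]: "S \<in> sets borel" by simp
    have i: "integrable lborel (\<lambda>x. h x * indicator S x)" if "integrable lborel h" for h :: "'a \<Rightarrow> real"
      using integrable_mult_indicator[OF _ that, of S] by (simp add: mult.commute)
    have n: "(\<integral>\<^sup>+ x. ennreal (h x) * indicator S x \<partial>lborel) = ennreal (LBINT x. h x * indicator S x)"
      if "integrable lborel h" "AE x in lborel. 0 \<le> h x" for h :: "'a \<Rightarrow> real"
    proof -
      have "(\<integral>\<^sup>+ x. ennreal (h x) * indicator S x \<partial>lborel) = (\<integral>\<^sup>+ x. ennreal (h x * indicator S x) \<partial>lborel)"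
        by (intro nn_integral_cong) (auto simp: indicator_def)
      also have "\<dots> = ennreal (LBINT x. h x * indicator S x)"
        using that(2) by (intro nn_integral_eq_integral i that) (auto elim: eventually_mono)
      finally show ?thesis .
    qed
    have "0 \<le> (LBINT x. g x * indicator S x)"
      using g0 by (intro integral_nonneg_AE) (auto elim: eventually_mono)
    then have "(LBINT x. f x * indicator S x) \<le> (LBINT x. g x * indicator S x)"
      using le[OF S] by (simp add: n fi g f0 g0)
    then show "0 \<le> (LINT x:S|lborel. g x - f x)"
      using i[OF fi] i[OF g] by (simp add: set_lebesgue_integral_def right_diff_distrib mult.commute)
  qed
  then show ?thesis by simp
qed

lemma pushes_mono:
  assumes p: "pushes T o1 n1" "pushes T o2 n2" and T: "T \<in> borel_measurable borel"
    and le: "AE x in lborel. o1 x \<le> o2 x"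
    and n1: "n1 \<in> borel_measurable borel" "AE y in lborel. 0 \<le> n1 y"
    and n2: "integrable lborel n2" "AE y in lborel. 0 \<le> n2 y"
  shows "AE y in lborel. n1 y \<le> n2 y"
proof (rule AE_le_of_nn_integral_le)
  fix S :: "'a set" assume S[measurable]: "S \<in> sets borel"
  have "(\<integral>\<^sup>+ y. ennreal (n1 y) * indicator S y \<partial>lborel) = (\<integral>\<^sup>+ x. ennreal (o1 x) * indicator S (T x) \<partial>lborel)"
    by (rule pushesD[OF p(1), symmetric]) simp
  also have "\<dots> \<le> (\<integral>\<^sup>+ x. ennreal (o2 x) * indicator S (T x) \<partial>lborel)"
    using le by (intro nn_integral_mono_AE) (auto elim!: eventually_mono intro!: mult_right_mono ennreal_leI)
  also have "\<dots> = (\<integral>\<^sup>+ y. ennreal (n2 y) * indicator S y \<partial>lborel)"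
    by (rule pushesD[OF p(2)]) simp
  finally show "(\<integral>\<^sup>+ y. ennreal (n1 y) * indicator S y \<partial>lborel) \<le> (\<integral>\<^sup>+ y. ennreal (n2 y) * indicator S y \<partial>lborel)" .
qed (use assms in auto)

text \<open>The image of a smaller density is dominated by the image of \<open>r\<close>, hence
  absolutely continuous, and Radon-Nikodym gives its density. Taking the minimum with
  \<open>n\<close> turns the almost everywhere bound into one that holds everywhere.\<close>

lemma pushes_sub:
  assumes p: "pushes T r n" and T[measurable]: "T \<in> borel_measurable borel"
    and o[measurable]: "o1 \<in> borel_measurable borel" and le: "AE x in lborel. o1 x \<le> r x"
    and n: "integrable lborel n" "\<And>y. 0 \<le> n y"
  obtains k where "k \<in> borel_measurable borel" "\<And>y. 0 \<le> k y" "\<And>y. k y \<le> n y" "pushes T o1 k"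
proof -
  have [measurable]: "n \<in> borel_measurable borel" using n by auto
  define N where "N = distr (density lborel o1) borel T"
  have emN: "emeasure N S = (\<integral>\<^sup>+ x. ennreal (o1 x) * indicator S (T x) \<partial>lborel)" if [measurable]: "S \<in> sets borel" for S
  proof -
    have "emeasure N S = (\<integral>\<^sup>+ y. indicator S y \<partial>N)" by (simp add: N_def)
    also have "\<dots> = (\<integral>\<^sup>+ x. ennreal (o1 x) * indicator S (T x) \<partial>lborel)"
      unfolding N_def by (subst nn_integral_distr) (auto simp: nn_integral_density)
    finally show ?thesis .
  qed
  have leN: "emeasure N S \<le> (\<integral>\<^sup>+ y. ennreal (n y) * indicator S y \<partial>lborel)" if [measurable]: "S \<in> sets borel" for S
  proof -
    have "emeasure N S \<le> (\<integral>\<^sup>+ x. ennreal (r x) * indicator S (T x) \<partial>lborel)" unfolding emN[OF that]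
      using le by (intro nn_integral_mono_AE) (auto elim!: eventually_mono intro!: mult_right_mono ennreal_leI)
    also have "\<dots> = (\<integral>\<^sup>+ y. ennreal (n y) * indicator S y \<partial>lborel)" by (rule pushesD[OF p]) simp
    finally show ?thesis .
  qed
  have setsN: "sets N = sets lborel" by (simp add: N_def)
  have ac: "absolutely_continuous lborel N"
    unfolding absolutely_continuous_def
  proof
    fix S :: "'a set" assume S: "S \<in> null_sets lborel"
    then have "emeasure N S \<le> 0" using leN[of S] nn_integral_null_set[OF S] by auto
    then show "S \<in> null_sets N" using S by (auto simp: null_sets_def setsN)
  qed
  define D where "D = RN_deriv lborel N"
  have D[measurable]: "D \<in> borel_measurable borel" unfolding D_def by measurable
  have dD: "density lborel D = N" unfolding D_def by (rule sigma_finite_measure.density_RN_deriv[OF sigma_finite_lborel ac setsN])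
  have finN: "emeasure N UNIV < \<infinity>"
    using leN[of UNIV] n by (simp add: nn_integral_eq_integral) (metis ennreal_less_top le_less_trans)
  have "(\<integral>\<^sup>+ y. D y \<partial>lborel) < \<infinity>" using finN unfolding dD[symmetric] by (simp add: emeasure_density)
  then have Dfin: "AE y in lborel. D y \<noteq> \<infinity>" by (intro nn_integral_PInf_AE) auto
  define d where "d y = enn2real (D y)" for y
  have [measurable]: "d \<in> borel_measurable borel" unfolding d_def by measurable
  have Dd: "AE y in lborel. D y = ennreal (d y)" using Dfin by eventually_elim (simp add: d_def less_top)
  have pd: "pushes T o1 d"
  proof (rule pushes_distr)
    have "density lborel d = density lborel D" using Dd by (intro density_cong) auto
    then show "distr (density lborel o1) borel T = density lborel d" using dD N_def by simp
  qed measurable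
  have dle: "AE y in lborel. d y \<le> n y"
    by (rule pushes_mono[OF pd p T le _ _ n(1)]) (auto simp: n d_def)
  show thesis
  proof (rule that[of "\<lambda>y. min (d y) (n y)"])
    show "pushes T o1 (\<lambda>y. min (d y) (n y))"
      by (rule pushes_cong_AE[OF pd]) (use dle in \<open>auto elim: eventually_mono\<close>)
  qed (auto simp: d_def n)
qed

text \<open>The mass \<open>u\<close> is withdrawn from \<open>r1\<close> and replaced by the part \<open>g (T2 x) * r2 x\<close> of \<open>r2\<close> that has the
  same targets. With \<open>s = g (T2 x) * r2 x - u x\<close> the last equation says \<open>s = min (g (T2 x) * r2 x) (r2 x - r1 x)\<close>.
  Since \<open>u \<mapsto> g \<mapsto> u\<close> is monotone and preserves \<open>u \<le> r1\<close>, iteration from \<open>u = 0\<close> converges.\<close>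

lemma swap_fixed_point:
  assumes T[measurable]: "T1 \<in> borel_measurable borel" "T2 \<in> borel_measurable borel"
    and i: "integrable lborel r1" "integrable lborel r2" "integrable lborel r01" "integrable lborel r02"
    and nn: "\<And>x. 0 \<le> r1 x" "\<And>x. 0 \<le> r2 x" "\<And>y. 0 \<le> r01 y"
    and le: "\<And>y. r01 y \<le> r02 y"
    and p1: "pushes T1 r1 r01" and p2: "pushes T2 r2 r02"
  obtains u g where "u \<in> borel_measurable borel" "\<And>x. 0 \<le> u x" "\<And>x. u x \<le> r1 x"
    "g \<in> borel_measurable borel" "\<And>y. 0 \<le> g y" "\<And>y. g y \<le> 1"
    "pushes T1 u (\<lambda>y. g y * r02 y)"
    "AE x in lborel. u x = max 0 (g (T2 x) * r2 x + r1 x - r2 x)"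
proof -
  have m[measurable]: "r1 \<in> borel_measurable borel" "r2 \<in> borel_measurable borel"
    "r01 \<in> borel_measurable borel" "r02 \<in> borel_measurable borel"
    using i by auto
  have nn02: "0 \<le> r02 y" for y using nn(3)[of y] le[of y] by simp
  \<comment> \<open>\<open>g\<close> is the density of the image of \<open>u\<close> relative to
    \<open>r02\<close>. It is undetermined where \<open>r02\<close> vanishes, so monotonicity in
    \<open>u\<close> is available only where \<open>r02\<close> is positive.\<close>
  define good where "good u g \<longleftrightarrow> g \<in> borel_measurable borel \<and> (\<forall>y. 0 \<le> g y \<and> g y \<le> 1) \<and>
     pushes T1 u (\<lambda>y. g y * r02 y)" for u g
  have ex: "\<exists>g. good u g" if u: "u \<in> borel_measurable borel" "\<And>x. u x \<le> r1 x" for u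
  proof -
    obtain k where k: "k \<in> borel_measurable borel" "\<And>y. 0 \<le> k y" "\<And>y. k y \<le> r01 y" "pushes T1 u k"
      using pushes_sub[OF p1 T(1) u(1) _ i(3) nn(3)] u(2) by auto
    have kle: "k y \<le> r02 y" for y using k(3)[of y] le[of y] by simp
    \<comment> \<open>Where \<open>r02 y = 0\<close> also \<open>k y = 0\<close>, so the default
      value 0 of the quotient is the right one.\<close>
    have "k y / r02 y * r02 y = k y" for y
      using k(2)[of y] kle[of y] by (cases "r02 y = 0") auto
    then have "good u (\<lambda>y. k y / r02 y)"
      unfolding good_def using k kle nn02 by (auto simp: divide_le_eq_1 less_le)
    then show ?thesis by blast
  qed
  define G where "G u = (SOME g. good u g)" for u
  define F where "F g x = max 0 (g (T2 x) * r2 x + r1 x - r2 x)" for g x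
  define U where "U = rec_nat (\<lambda>_. 0) (\<lambda>_ u. F (G u))"
  have U0: "U 0 = (\<lambda>_. 0)" and US: "U (Suc n) = F (G (U n))" for n by (simp_all add: U_def)
  \<comment> \<open>This is where \<open>g \<le> 1\<close> matters, that is, where the order of the
    initial densities is used: the iteration never withdraws more than \<open>r1\<close>
    has.\<close>
  have Fle: "F g x \<le> r1 x" if "\<And>y. g y \<le> 1" for g x
    using mult_right_mono[OF that[of "T2 x"] nn(2)[of x]] nn(1)[of x] by (simp add: F_def)
  have UG: "U n \<in> borel_measurable borel \<and> (\<forall>x. 0 \<le> U n x \<and> U n x \<le> r1 x) \<and> good (U n) (G (U n))" for n
  proof (induction n)
    case 0
    have "good (U 0) (G (U 0))" unfolding G_def using someI_ex[OF ex[of "U 0"]] by (simp add: U0 nn)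
    then show ?case by (auto simp: U0 nn)
  next
    case (Suc n)
    then have g: "G (U n) \<in> borel_measurable borel" "\<And>y. G (U n) y \<le> 1" by (auto simp: good_def)
    then have [measurable]: "G (U n) \<in> borel_measurable borel" by simp
    have a: "U (Suc n) \<in> borel_measurable borel" unfolding US F_def by measurable
    have b: "0 \<le> U (Suc n) x" "U (Suc n) x \<le> r1 x" for x
      unfolding US by (simp add: F_def, rule Fle[OF g(2)])
    have "good (U (Suc n)) (G (U (Suc n)))" unfolding G_def using someI_ex[OF ex[of "U (Suc n)"]] a b by simp
    with a b show ?case by auto
  qed
  define g where "g n = G (U n)" for n
  have Um[measurable]: "U n \<in> borel_measurable borel" and U: "0 \<le> U n x" "U n x \<le> r1 x"
    and gm[measurable]: "g n \<in> borel_measurable borel" and g: "0 \<le> g n y" "g n y \<le> 1"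
    and pg: "pushes T1 (U n) (\<lambda>y. g n y * r02 y)" for n x y
    using UG[of n] by (auto simp: g_def good_def)
  have US': "U (Suc n) x = max 0 (g n (T2 x) * r2 x + r1 x - r2 x)" for n x
    by (simp add: US F_def g_def)
  have gr: "integrable lborel (\<lambda>y. g n y * r02 y)" for n
    by (rule Bochner_Integration.integrable_bound[OF i(4)])
       (use g nn02 in \<open>auto simp: abs_mult intro!: mult_left_le_one_le\<close>)
  have gmono: "AE y in lborel. 0 < r02 y \<longrightarrow> g n y \<le> g (Suc n) y" if "AE x in lborel. U n x \<le> U (Suc n) x" for n
  proof -
    have "AE y in lborel. g n y * r02 y \<le> g (Suc n) y * r02 y"
      by (rule pushes_mono[OF pg pg T(1) that _ _ gr]) (auto simp: g nn02)
    then show ?thesis by eventually_elim auto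
  qed
  \<comment> \<open>The map \<open>T2\<close> sends almost no mass of \<open>r2\<close> to the zero
    set of \<open>r02\<close>, so statements restricted to positive \<open>r02\<close> lose nothing
    when composed with \<open>T2\<close>.\<close>
  have gT: "AE x in lborel. 0 < r2 x \<longrightarrow> P (T2 x)" if "AE y in lborel. 0 < r02 y \<longrightarrow> P y" for P
  proof -
    have "AE x in lborel. 0 < r2 x \<longrightarrow> (0 < r02 (T2 x) \<longrightarrow> P (T2 x))"
      by (rule pushes_AE[OF p2 T(2) m(2)]) (use that in simp)
    moreover have "AE x in lborel. ennreal (r2 x) * indicator {y. r02 y = 0} (T2 x) = 0"
    proof (subst nn_integral_0_iff_AE[symmetric])
      have "(\<integral>\<^sup>+ x. ennreal (r2 x) * indicator {y. r02 y = 0} (T2 x) \<partial>lborel)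
          = (\<integral>\<^sup>+ y. ennreal (r02 y) * indicator {y. r02 y = 0} y \<partial>lborel)"
        by (rule pushesD[OF p2]) measurable
      also have "\<dots> = (\<integral>\<^sup>+ y. 0 \<partial>(lborel :: 'a measure))"
        by (intro nn_integral_cong) (auto simp: indicator_def)
      finally show "(\<integral>\<^sup>+ x. ennreal (r2 x) * indicator {y. r02 y = 0} (T2 x) \<partial>lborel) = 0" by simp
    qed measurable
    ultimately show ?thesis
    proof eventually_elim
      case (elim x)
      then show ?case using nn02[of "T2 x"] by (auto simp: indicator_def less_le split: if_splits)
    qed
  qed
  have Umono: "AE x in lborel. U n x \<le> U (Suc n) x" for n
  proof (induction n)
    case 0 then show ?case by (simp add: U0 U)
  next
    case (Suc n)
    show ?case using gT[OF gmono[OF Suc]]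
    proof eventually_elim
      case (elim x)
      have "g n (T2 x) * r2 x \<le> g (Suc n) (T2 x) * r2 x"
        using elim nn(2)[of x] by (cases "r2 x = 0") (auto intro!: mult_right_mono)
      then show ?case unfolding US' by linarith
    qed
  qed
  have Uall: "AE x in lborel. incseq (\<lambda>n. U n x)"
    using Umono by (simp add: AE_all_countable incseq_Suc_iff)
  have gall: "AE y in lborel. 0 < r02 y \<longrightarrow> incseq (\<lambda>n. g n y)"
  proof -
    have "AE y in lborel. \<forall>n. 0 < r02 y \<longrightarrow> g n y \<le> g (Suc n) y"
      unfolding AE_all_countable using gmono[OF Umono] by blast
    then show ?thesis by eventually_elim (auto simp: incseq_Suc_iff)
  qed
  define u where "u x = (SUP n. U n x)" for x
  define h where "h y = (SUP n. g n y)" for y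
  have bU: "bdd_above (range (\<lambda>n. U n x))" for x using U(2) by (auto intro!: bdd_aboveI)
  have bg: "bdd_above (range (\<lambda>n. g n y))" for y using g(2) by (auto intro!: bdd_aboveI)
  have um[measurable]: "u \<in> borel_measurable borel" unfolding u_def by (intro borel_measurable_cSUP) (use bU in auto)
  have hm[measurable]: "h \<in> borel_measurable borel" unfolding h_def by (intro borel_measurable_cSUP) (use bg in auto)
  have u0: "0 \<le> u x" for x unfolding u_def using U(1)[of 0 x] bU[of x] by (intro cSUP_upper2) auto
  have ur: "u x \<le> r1 x" for x unfolding u_def using U(2) by (intro cSUP_least) auto
  have h0: "0 \<le> h x" for x unfolding h_def using g(1)[of 0 x] bg[of x] by (intro cSUP_upper2) auto
  have h1: "h x \<le> 1" for x unfolding h_def using g(2) by (intro cSUP_least) auto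
  have ulim: "AE x in lborel. (\<lambda>n. U n x) \<longlonglongrightarrow> u x"
    using Uall by eventually_elim (auto simp: u_def intro!: LIMSEQ_incseq_SUP bU)
  have hlim: "AE y in lborel. 0 < r02 y \<longrightarrow> (\<lambda>n. g n y) \<longlonglongrightarrow> h y"
    using gall by eventually_elim (auto simp: h_def intro!: LIMSEQ_incseq_SUP bg)
  have pu: "pushes T1 u (\<lambda>y. h y * r02 y)"
  proof (rule pushes_distr)
    show "distr (density lborel u) borel T1 = density lborel (\<lambda>y. h y * r02 y)"
    proof (rule measure_eqI)
      fix S assume "S \<in> sets (distr (density lborel u) borel T1)"
      then have [measurable]: "S \<in> sets borel" by simp
      have fin: "(\<integral>\<^sup>+ x. ennreal (r1 x) \<partial>lborel) < \<infinity>" "(\<integral>\<^sup>+ x. ennreal (r02 x) \<partial>lborel) < \<infinity>"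
        using i nn nn02 by (simp_all add: nn_integral_eq_integral)
      have "(\<lambda>n. \<integral>\<^sup>+ x. ennreal (U n x) * indicator S (T1 x) \<partial>lborel) \<longlonglongrightarrow> (\<integral>\<^sup>+ x. ennreal (u x) * indicator S (T1 x) \<partial>lborel)"
      proof (rule nn_integral_dominated_convergence[where w = "\<lambda>x. ennreal (r1 x)"])
        show "AE x in lborel. (\<lambda>n. ennreal (U n x) * indicator S (T1 x)) \<longlonglongrightarrow> ennreal (u x) * indicator S (T1 x)"
          using ulim by eventually_elim (auto simp: indicator_def intro!: tendsto_ennrealI)
      qed (use fin U in \<open>auto simp: indicator_def intro!: ennreal_leI\<close>)
      moreover have "(\<lambda>n. \<integral>\<^sup>+ y. ennreal (g n y * r02 y) * indicator S y \<partial>lborel) \<longlonglongrightarrow> (\<integral>\<^sup>+ y. ennreal (h y * r02 y) * indicator S y \<partial>lborel)"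
      proof (rule nn_integral_dominated_convergence[where w = "\<lambda>x. ennreal (r02 x)"])
        show "AE x in lborel. (\<lambda>n. ennreal (g n x * r02 x) * indicator S x) \<longlonglongrightarrow> ennreal (h x * r02 x) * indicator S x"
          using hlim
        proof eventually_elim
          case (elim y)
          then show ?case using nn02[of y] by (cases "r02 y = 0") (auto simp: indicator_def intro!: tendsto_ennrealI tendsto_mult)
        qed
      qed (use fin g nn02 in \<open>auto simp: indicator_def intro!: ennreal_leI mult_left_le_one_le\<close>)
      moreover have "(\<integral>\<^sup>+ x. ennreal (U n x) * indicator S (T1 x) \<partial>lborel) = (\<integral>\<^sup>+ y. ennreal (g n y * r02 y) * indicator S y \<partial>lborel)" for n
        by (rule pushesD[OF pg]) simp
      ultimately have "(\<integral>\<^sup>+ x. ennreal (u x) * indicator S (T1 x) \<partial>lborel) = (\<integral>\<^sup>+ y. ennreal (h y * r02 y) * indicator S y \<partial>lborel)"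
        using LIMSEQ_unique by simp
      moreover have "emeasure (distr (density lborel u) borel T1) S = (\<integral>\<^sup>+ x. ennreal (u x) * indicator S (T1 x) \<partial>lborel)"
        by (subst nn_integral_indicator[symmetric], simp, subst nn_integral_distr) (auto simp: nn_integral_density)
      ultimately show "emeasure (distr (density lborel u) borel T1) S = emeasure (density lborel (\<lambda>y. h y * r02 y)) S"
        by (simp add: emeasure_density)
    qed simp
  qed measurable
  have eq: "AE x in lborel. u x = max 0 (h (T2 x) * r2 x + r1 x - r2 x)"
    using ulim gT[OF hlim]
  proof eventually_elim
    case (elim x)
    have "(\<lambda>n. g n (T2 x) * r2 x) \<longlonglongrightarrow> h (T2 x) * r2 x"
      using elim nn(2)[of x] by (cases "r2 x = 0") (auto intro!: tendsto_mult)
    then have "(\<lambda>n. max 0 (g n (T2 x) * r2 x + r1 x - r2 x)) \<longlonglongrightarrow> max 0 (h (T2 x) * r2 x + r1 x - r2 x)"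
      by (intro tendsto_max tendsto_const tendsto_diff tendsto_add)
    then have "(\<lambda>n. U (Suc n) x) \<longlonglongrightarrow> max 0 (h (T2 x) * r2 x + r1 x - r2 x)" by (simp add: US')
    then show ?case using elim(1) LIMSEQ_Suc LIMSEQ_unique by blast
  qed
  show thesis by (rule that[of u h]) (use um u0 ur hm h0 h1 pu eq in auto)
qed

section \<open>Separating boxes and overlaps of translates\<close>

text \<open>By outer regularity a bounded part of \<open>S\<close> lies in an open \<open>U\<close>
  whose \<open>N\<close>-mass is smaller than the \<open>M\<close>-mass of that part. The part is
  covered by countably many nonoverlapping closed boxes inside \<open>U\<close>. If no open box had
  an excess, summing over their interiors would give a contradiction; the boundaries are
  \<open>M\<close>-null by absolute continuity.\<close>

lemma exists_box_excess:
  fixes M N :: "'a::euclidean_space measure"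
  assumes M: "sets M = sets borel" "absolutely_continuous lborel M" "emeasure M UNIV < \<infinity>"
    and N: "sets N = sets borel" "emeasure N UNIV < \<infinity>"
    and S: "S \<in> sets borel" "emeasure N S < emeasure M S"
  obtains a b where "emeasure N (box a b) < emeasure M (box a b)"
proof -
  have sp: "space M = UNIV" "space N = UNIV"
    using sets_eq_imp_space_eq[OF M(1)] sets_eq_imp_space_eq[OF N(1)] by simp_all
  define B where "B n = cbox (- real n *\<^sub>R One) (real n *\<^sub>R One :: 'a)" for n
  have [measurable_cong]: "sets M = sets borel" "sets N = sets borel" by fact+
  have sm: "X \<in> sets M \<longleftrightarrow> X \<in> sets borel" "X \<in> sets N \<longleftrightarrow> X \<in> sets borel" for X using M N by auto
  have "(SUP n. emeasure M (S \<inter> B n)) = emeasure M (\<Union>n. S \<inter> B n)"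
  proof (rule SUP_emeasure_incseq)
    have "B m \<subseteq> B n" if "m \<le> n" for m n unfolding B_def using that by (intro subset_box_imp) auto
    then show "incseq (\<lambda>n. S \<inter> B n)" unfolding incseq_def by blast
  qed (use S in \<open>auto simp: sm B_def\<close>)
  also have "(\<Union>n. S \<inter> B n) = S"
  proof -
    have "\<exists>n. x \<in> B n" for x
    proof -
      obtain n where "norm x \<le> real n" using real_arch_simple by blast
      then have "- real n \<le> x \<bullet> i \<and> x \<bullet> i \<le> real n" if "i \<in> Basis" for i
        using Basis_le_norm[OF that, of x] by linarith
      then have "x \<in> B n" by (auto simp: B_def mem_box)
      then show ?thesis by blast
    qed
    then show ?thesis by auto
  qed
  finally have "emeasure N S < (SUP n. emeasure M (S \<inter> B n))" using S(2) by simp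
  then obtain n where n: "emeasure N S < emeasure M (S \<inter> B n)" unfolding less_SUP_iff by blast
  have "emeasure N S = (INF U\<in>{U. S \<subseteq> U \<and> open U}. emeasure N U)"
    using N S by (intro outer_regular) (auto simp: sp)
  with n obtain U where U: "S \<subseteq> U" "open U" "emeasure N U < emeasure M (S \<inter> B n)"
    unfolding INF_less_iff by (auto simp: INF_less_iff)
  \<comment> \<open>The successor keeps the enclosing open box nonempty when
    \<open>n = 0\<close>.\<close>
  define m where "m = Suc n"
  have "S \<inter> B n \<subseteq> cbox (- real m *\<^sub>R One) (real m *\<^sub>R One)"
  proof -
    have "B n \<subseteq> cbox (- real m *\<^sub>R One) (real m *\<^sub>R One)"
      unfolding B_def m_def by (intro subset_box_imp) auto
    then show ?thesis by blast
  qed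
  moreover have "box (- real m *\<^sub>R One) (real m *\<^sub>R One :: 'a) \<noteq> {}"
    by (auto simp: box_ne_empty m_def)
  \<comment> \<open>This gauge forces every covering box tagged in \<open>S\<close> to lie inside
    \<open>U\<close>; the value off \<open>U\<close> is only there to make it a gauge on the whole
    space.\<close>
  moreover have "gauge (\<lambda>x. if x \<in> U then U else UNIV)"
    using U by (auto simp: gauge_def)
  ultimately obtain \<D> where D: "countable \<D>"
    "\<And>K. K \<in> \<D> \<Longrightarrow> interior K \<noteq> {} \<and> (\<exists>c d. K = cbox c d)"
    "pairwise (\<lambda>A B. interior A \<inter> interior B = {}) \<D>"
    "\<And>K. K \<in> \<D> \<Longrightarrow> \<exists>x \<in> S \<inter> B n \<inter> K. K \<subseteq> (if x \<in> U then U else UNIV)"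
    "S \<inter> B n \<subseteq> \<Union>\<D>"
    using covering_lemma[of "S \<inter> B n" "- real m *\<^sub>R One" "real m *\<^sub>R One" "\<lambda>x. if x \<in> U then U else UNIV"] by metis
  have KU: "K \<subseteq> U" if K: "K \<in> \<D>" for K
  proof -
    obtain x where "x \<in> S" "K \<subseteq> (if x \<in> U then U else UNIV)" using D(4)[OF K] by blast
    moreover have "x \<in> U" using U(1) \<open>x \<in> S\<close> by blast
    ultimately show ?thesis by simp
  qed
  have Kb: "K \<in> sets borel" if "K \<in> \<D>" for K using D(2)[OF that] by auto
  have disj: "disjoint_family_on interior \<D>"
    using D(3) by (auto simp: disjoint_family_on_def pairwise_def)
  have nullM: "X \<in> null_sets M" if "X \<in> null_sets lborel" for X
    using M(2) that by (auto simp: absolutely_continuous_def)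
  have null: "K - interior K \<in> null_sets M" if K: "K \<in> \<D>" for K
  proof -
    obtain c d where cd: "K = cbox c d" using D(2)[OF K] by blast
    have "cbox c d - box c d \<in> null_sets lebesgue"
      using negligible_frontier_interval[of c d] by (simp add: negligible_iff_null_sets)
    then have "cbox c d - box c d \<in> null_sets lborel"
      by (subst (asm) null_sets_completion_iff) auto
    then show ?thesis unfolding cd interior_cbox by (rule nullM)
  qed
  show thesis
  proof (rule ccontr)
    assume no: "\<not> thesis"
    then have le: "emeasure M (box a b) \<le> emeasure N (box a b)" for a b using that not_less by blast
    have op: "(\<Union>K\<in>\<D>. interior K) \<in> sets borel" by (intro borel_open open_UN) auto
    have nu: "(\<Union>K\<in>\<D>. K - interior K) \<in> null_sets M" using D(1) null by (intro null_sets_UN') auto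
    have "emeasure M (S \<inter> B n) \<le> emeasure M ((\<Union>K\<in>\<D>. interior K) \<union> (\<Union>K\<in>\<D>. K - interior K))"
    proof (rule emeasure_mono)
      show "S \<inter> B n \<subseteq> (\<Union>K\<in>\<D>. interior K) \<union> (\<Union>K\<in>\<D>. K - interior K)" using D(5) by auto
      show "(\<Union>K\<in>\<D>. interior K) \<union> (\<Union>K\<in>\<D>. K - interior K) \<in> sets M" using nu op by (intro sets.Un) (auto simp: sm)
    qed
    also have "\<dots> = emeasure M (\<Union>K\<in>\<D>. interior K)"
      using nu op by (intro emeasure_Un_null_set) (auto simp: sm)
    also have "\<dots> = (\<integral>\<^sup>+ K. emeasure M (interior K) \<partial>count_space \<D>)"
      using D(1) disj by (intro emeasure_UN_countable) (auto simp: sm)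
    also have "\<dots> \<le> (\<integral>\<^sup>+ K. emeasure N (interior K) \<partial>count_space \<D>)"
      using D(2) le by (intro nn_integral_mono) (metis interior_cbox space_count_space)
    also have "\<dots> = emeasure N (\<Union>K\<in>\<D>. interior K)"
      using D(1) disj by (intro emeasure_UN_countable[symmetric]) (auto simp: sm)
    also have "\<dots> \<le> emeasure N U"
      using KU U(2) interior_subset by (intro emeasure_mono) (blast, auto simp: sm)
    finally show False using U(3) by simp
  qed
qed

text \<open>Closed boxes exhaust the open one, so the strict excess survives a small shrinking for
  \<open>r1\<close>. The margin \<open>\<eta>\<close> separates sources in the smaller box from
  sources outside the larger one, and becomes a factor of the gain in cost.\<close>

lemma exists_shrunk_box_excess:
  fixes r1 r2 :: "'a::euclidean_space \<Rightarrow> real"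
  assumes i: "integrable lborel r1" "integrable lborel r2" and nn: "\<And>x. 0 \<le> r1 x" "\<And>x. 0 \<le> r2 x"
    and "\<not> (AE x in lborel. r1 x \<le> r2 x)"
  obtains a b \<eta> where "0 < \<eta>"
    "(LBINT x. indicator (box a b) x * r2 x) < (LBINT x. indicator (cbox (a + \<eta> *\<^sub>R One) (b - \<eta> *\<^sub>R One)) x * r1 x)"
proof -
  have [measurable]: "r1 \<in> borel_measurable borel" "r2 \<in> borel_measurable borel" using i by auto
  define M where "M = density lborel r1"
  define N where "N = density lborel r2"
  have em: "emeasure (density lborel r) S = ennreal (LBINT x. indicator S x * r x)"
    if "integrable lborel r" "\<And>x. 0 \<le> r x" and [measurable]: "S \<in> sets borel" for S and r :: "'a \<Rightarrow> real"
  proof -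
    have [measurable]: "r \<in> borel_measurable borel" using that by auto
    have "emeasure (density lborel r) S = (\<integral>\<^sup>+ x. ennreal (indicator S x * r x) \<partial>lborel)"
      by (subst emeasure_density) (auto intro!: nn_integral_cong simp: indicator_def)
    also have "\<dots> = ennreal (LBINT x. indicator S x * r x)"
      using integrable_mult_indicator[OF _ that(1), of S] that(2) by (intro nn_integral_eq_integral) auto
    finally show ?thesis .
  qed
  have "\<exists>S\<in>sets borel. emeasure N S < emeasure M S"
  proof (rule ccontr)
    assume "\<not> ?thesis"
    then have le: "emeasure M S \<le> emeasure N S" if "S \<in> sets borel" for S using that not_less by blast
    have "AE x in lborel. r1 x \<le> r2 x"
    proof (rule AE_le_of_nn_integral_le)
      fix S :: "'a set" assume "S \<in> sets borel"
      then show "(\<integral>\<^sup>+ x. ennreal (r1 x) * indicator S x \<partial>lborel) \<le> (\<integral>\<^sup>+ x. ennreal (r2 x) * indicator S x \<partial>lborel)"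
        using le[of S] by (simp add: M_def N_def emeasure_density)
    qed (use i nn in auto)
    then show False using assms by simp
  qed
  then obtain S where S: "S \<in> sets borel" "emeasure N S < emeasure M S" by blast
  obtain a b where ab: "emeasure N (box a b) < emeasure M (box a b)"
    by (rule exists_box_excess[of M N S])
       (use S em[OF i(1) nn(1), of UNIV] em[OF i(2) nn(2), of UNIV] in \<open>auto simp: M_def N_def absolutely_continuousI_density\<close>)
  define C where "C n = cbox (a + (1 / real (Suc n)) *\<^sub>R One) (b - (1 / real (Suc n)) *\<^sub>R One)" for n
  have "(SUP n. emeasure M (C n)) = emeasure M (\<Union>n. C n)"
  proof (rule SUP_emeasure_incseq)
    show "incseq C"
    proof (rule incseq_SucI)
      fix n
      have "1 / real (Suc (Suc n)) \<le> 1 / real (Suc n)" by (simp add: field_simps)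
      then show "C n \<subseteq> C (Suc n)" unfolding C_def
        by (intro subset_box_imp) (auto simp: inner_simps simp del: of_nat_Suc)
    qed
  qed (auto simp: M_def C_def)
  also have "emeasure M (box a b) \<le> emeasure M (\<Union>n. C n)"
  proof (rule emeasure_mono)
    show "box a b \<subseteq> (\<Union>n. C n)"
    proof
      fix x assume x: "x \<in> box a b"
      define d where "d = Min ((\<lambda>i. min (x \<bullet> i - a \<bullet> i) (b \<bullet> i - x \<bullet> i)) ` Basis)"
      have "0 < d" using x unfolding d_def by (subst Min_gr_iff) (auto simp: mem_box)
      then obtain n where n: "1 / real (Suc n) < d" by (rule nat_approx_posE)
      have "d \<le> min (x \<bullet> i - a \<bullet> i) (b \<bullet> i - x \<bullet> i)" if "i \<in> Basis" for i
        unfolding d_def using that by (intro Min_le) auto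
      then have "1 / real (Suc n) \<le> x \<bullet> i - a \<bullet> i" "1 / real (Suc n) \<le> b \<bullet> i - x \<bullet> i" if "i \<in> Basis" for i
        using n that by fastforce+
      then have "x \<in> C n" unfolding C_def mem_box
        by (auto simp: inner_simps simp del: of_nat_Suc) (smt (verit))+
      then show "x \<in> (\<Union>n. C n)" by blast
    qed
  qed (auto simp: M_def C_def)
  finally have "emeasure N (box a b) < (SUP n. emeasure M (C n))" using ab by (metis order_less_le_trans)
  then obtain n where "emeasure N (box a b) < emeasure M (C n)" unfolding less_SUP_iff by blast
  then have "(LBINT x. indicator (box a b) x * r2 x) < (LBINT x. indicator (C n) x * r1 x)"
    unfolding M_def N_def using em[OF i(1) nn(1), of "C n"] em[OF i(2) nn(2), of "box a b"]
    by (simp add: C_def ennreal_less_iff integral_nonneg nn)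
  then show thesis using that[of "1 / real (Suc n)" a b] by (simp add: C_def)
qed

text \<open>A Bonferroni inequality for functions with values in the unit interval. With
  \<open>S\<close> the sum so far, \<open>S + b \<le> 1 + S * b\<close> follows from
  \<open>0 \<le> (1 - S) * (1 - b)\<close> if \<open>S < 1\<close>; otherwise
  \<open>b \<le> S * b\<close> and the induction hypothesis suffice.\<close>

lemma sum_le_one_plus_pairs:
  fixes b :: "nat \<Rightarrow> real"
  assumes "\<And>k. 0 \<le> b k" "\<And>k. b k \<le> 1"
  shows "(\<Sum>k<N. b k) \<le> 1 + (\<Sum>l<N. \<Sum>k<l. b k * b l)"
proof (induction N)
  case (Suc N)
  have "(\<Sum>k<N. b k) + b N \<le> 1 + (\<Sum>l<N. \<Sum>k<l. b k * b l) + (\<Sum>k<N. b k) * b N"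
  proof (cases "(\<Sum>k<N. b k) < 1")
    case True
    then have "0 \<le> (1 - (\<Sum>k<N. b k)) * (1 - b N)" using assms by (intro mult_nonneg_nonneg) auto
    moreover have "0 \<le> (\<Sum>l<N. \<Sum>k<l. b k * b l)" using assms by (intro sum_nonneg mult_nonneg_nonneg) auto
    ultimately show ?thesis by (simp add: algebra_simps)
  next
    case False
    then have "1 * b N \<le> (\<Sum>k<N. b k) * b N" using assms by (intro mult_right_mono) auto
    then show ?thesis using Suc by simp
  qed
  then show ?case by (simp add: sum_distrib_right)
qed simp

lemma lborel_integral_shift:
  fixes f :: "'a::euclidean_space \<Rightarrow> real"
  assumes [measurable]: "f \<in> borel_measurable borel"
  shows "(LBINT y. f (y + c)) = (LBINT y. f y)"
    and "integrable lborel (\<lambda>y. f (y + c)) \<longleftrightarrow> integrable lborel f"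
proof -
  have d: "distr lborel borel (\<lambda>y. y + c) = (lborel :: 'a measure)"
  proof -
    have "(\<lambda>y. y + c) = (+) c" by (simp add: fun_eq_iff add.commute)
    then show ?thesis using lborel_distr_plus[of c] by simp
  qed
  show "(LBINT y. f (y + c)) = (LBINT y. f y)"
    using integral_distr[of "\<lambda>y. y + c" lborel borel f] unfolding d by simp
  show "integrable lborel (\<lambda>y. f (y + c)) \<longleftrightarrow> integrable lborel f"
    using integrable_distr_eq[of "\<lambda>y. y + c" lborel borel f] unfolding d by simp
qed


text \<open>The \<open>N\<close> translates of \<open>b\<close> by multiples of \<open>1 / N\<close>
  along \<open>e\<close>, all shorter than 1, live in a box enlarged by 1 on each side. By
  \<open>big\<close> their total mass exceeds its volume by at least 1, so the pairwise overlaps add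
  up to at least 1. There are fewer than \<open>N\<^sup>2\<close> pairs, and if all overlaps were at
  most \<open>1 / (2 * N\<^sup>2)\<close> their sum would be at most 1/2. The relative shift of two
  different translates is at least \<open>1 / N\<close>.\<close>

lemma exists_translate_overlap:
  fixes b :: "'a::euclidean_space \<Rightarrow> real"
  assumes [measurable]: "b \<in> borel_measurable borel" and b: "\<And>y. 0 \<le> b y" "\<And>y. b y \<le> 1"
    and supp: "\<And>y. y \<notin> cbox (- n *\<^sub>R One) (n *\<^sub>R One) \<Longrightarrow> b y = 0" and bi: "integrable lborel b"
    and e: "norm e = 1" and N: "0 < N"
    and big: "measure lborel (cbox (- (n + 1) *\<^sub>R One) ((n + 1) *\<^sub>R One :: 'a)) + 1 \<le> real N * (LBINT y. b y)"
  obtains t where "1 / real N \<le> t" "1 / (2 * (real N)\<^sup>2) < (LBINT y. min (b y) (b (y + t *\<^sub>R e)))"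
proof -
  define B where "B = cbox (- (n + 1) *\<^sub>R One) ((n + 1) *\<^sub>R One :: 'a)"
  define c where "c k y = b (y + (real k / real N) *\<^sub>R e)" for k y
  have cm[measurable]: "c k \<in> borel_measurable borel" for k unfolding c_def by measurable
  have ci: "integrable lborel (c k)" "(LBINT y. c k y) = (LBINT y. b y)" for k
    unfolding c_def using bi by (simp_all add: lborel_integral_shift)
  have c01: "0 \<le> c k y" "c k y \<le> 1" for k y by (simp_all add: c_def b)
  have csupp: "c k y = 0" if "k < N" "y \<notin> B" for k y
  proof -
    have "y + (real k / real N) *\<^sub>R e \<notin> cbox (- n *\<^sub>R One) (n *\<^sub>R One)"
    proof
      assume a: "y + (real k / real N) *\<^sub>R e \<in> cbox (- n *\<^sub>R One) (n *\<^sub>R One)"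
      have "y \<in> B" unfolding B_def mem_box
      proof
        fix i :: 'a assume i: "i \<in> Basis"
        define z where "z = (real k / real N) * (e \<bullet> i)"
        have z1: "\<bar>z\<bar> \<le> 1 * 1"
          unfolding z_def abs_mult using that(1) Basis_le_norm[OF i, of e] e by (intro mult_mono) auto
        have z2: "- n \<le> y \<bullet> i + z" "y \<bullet> i + z \<le> n"
          using a i by (auto simp: mem_box inner_simps z_def)
        have "- (n + 1) \<le> y \<bullet> i" "y \<bullet> i \<le> n + 1" using z1 z2 by linarith+
        then show "(- (n + 1) *\<^sub>R One) \<bullet> i \<le> y \<bullet> i \<and> y \<bullet> i \<le> ((n + 1) *\<^sub>R One) \<bullet> i"
          using i by (simp add: inner_simps)
      qed
      with that show False by simp
    qed
    then show ?thesis by (simp add: c_def supp)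
  qed
  have mi: "integrable lborel (\<lambda>y. min (c k y) (c l y))" for k l
    using ci(1) by (intro integrable_min) auto
  have "integrable lborel (indicator B :: 'a \<Rightarrow> real)"
    unfolding B_def by (rule integrable_real_indicator[OF _ emeasure_lborel_cbox_finite]) simp
  have "real N * (LBINT y. b y) = (LBINT y. (\<Sum>k<N. c k y))"
    using ci by (simp add: Bochner_Integration.integral_sum)
  also have "\<dots> \<le> (LBINT y. indicator B y + (\<Sum>l<N. \<Sum>k<l. min (c k y) (c l y)))"
  proof (rule integral_mono)
    fix y
    show "(\<Sum>k<N. c k y) \<le> indicator B y + (\<Sum>l<N. \<Sum>k<l. min (c k y) (c l y))"
    proof (cases "y \<in> B")
      case True
      have "(\<Sum>k<N. c k y) \<le> 1 + (\<Sum>l<N. \<Sum>k<l. c k y * c l y)"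
        by (rule sum_le_one_plus_pairs) (rule c01)+
      also have "(\<Sum>l<N. \<Sum>k<l. c k y * c l y) \<le> (\<Sum>l<N. \<Sum>k<l. min (c k y) (c l y))"
        using c01 by (intro sum_mono) (simp add: mult_left_le mult_left_le_one_le)
      finally show ?thesis using True by simp
    next
      case False
      then have "(\<Sum>k<N. c k y) = 0" using csupp by (intro sum.neutral) auto
      moreover have "0 \<le> (\<Sum>l<N. \<Sum>k<l. min (c k y) (c l y))" using c01 by (intro sum_nonneg) auto
      ultimately show ?thesis using False by simp
    qed
  qed (use ci mi \<open>integrable lborel (indicator B)\<close> in \<open>auto intro!: Bochner_Integration.integrable_add Bochner_Integration.integrable_sum\<close>)
  also have "\<dots> = measure lborel B + (\<Sum>l<N. \<Sum>k<l. LBINT y. min (c k y) (c l y))"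
    using mi \<open>integrable lborel (indicator B)\<close>
    by (simp add: Bochner_Integration.integral_sum Bochner_Integration.integrable_sum)
  finally have "1 \<le> (\<Sum>l<N. \<Sum>k<l. LBINT y. min (c k y) (c l y))"
    using big by (simp add: B_def)
  have "\<exists>l<N. \<exists>k<l. 1 / (2 * (real N)\<^sup>2) < (LBINT y. min (c k y) (c l y))"
  proof (rule ccontr)
    assume "\<not> ?thesis"
    then have le: "(LBINT y. min (c k y) (c l y)) \<le> 1 / (2 * (real N)\<^sup>2)" if "l < N" "k < l" for k l
      using that not_less by blast
    have "(\<Sum>l<N. \<Sum>k<l. LBINT y. min (c k y) (c l y)) \<le> (\<Sum>l<N. \<Sum>k<l. 1 / (2 * (real N)\<^sup>2))"
      using le by (intro sum_mono) simp
    also have "\<dots> \<le> (\<Sum>l<N. real N * (1 / (2 * (real N)\<^sup>2)))"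
      by (intro sum_mono) (auto simp: divide_right_mono)
    also have "\<dots> < 1" using N by (simp add: power2_eq_square field_simps)
    finally show False using \<open>1 \<le> _\<close> by simp
  qed
  then obtain k l where kl: "l < N" "k < l" "1 / (2 * (real N)\<^sup>2) < (LBINT y. min (c k y) (c l y))" by blast
  define t where "t = real (l - k) / real N"
  have "(LBINT y. min (c k y) (c l y)) = (LBINT y. (\<lambda>y. min (b y) (b (y + t *\<^sub>R e))) (y + (real k / real N) *\<^sub>R e))"
  proof -
    have "(real k / real N) *\<^sub>R e + t *\<^sub>R e = (real l / real N) *\<^sub>R e"
      using kl by (simp add: t_def scaleR_add_left[symmetric] add_divide_distrib[symmetric] of_nat_diff)
    then show ?thesis by (simp add: c_def add.assoc)
  qed
  also have "\<dots> = (LBINT y. min (b y) (b (y + t *\<^sub>R e)))"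
    by (rule lborel_integral_shift(1)) measurable
  finally have "1 / (2 * (real N)\<^sup>2) < (LBINT y. min (b y) (b (y + t *\<^sub>R e)))" using kl by simp
  moreover have "1 / real N \<le> t" using kl N by (auto simp: t_def divide_right_mono)
  ultimately show thesis using that by blast
qed

text \<open>The constant depends on \<open>fa\<close>, \<open>fb\<close> only through \<open>f\<close>: more small translates of a cut-off of \<open>min fa fb\<close> than
  fit side by side into a box cannot be nearly disjoint.\<close>

lemma uniform_translate_overlap:
  fixes f :: "'a::euclidean_space \<Rightarrow> real"
  assumes fi: "integrable lborel f" and f0: "\<And>y. 0 \<le> f y" and \<kappa>: "0 < \<kappa>"
  obtains c where "0 < c"
    "\<And>fa fb e. fa \<in> borel_measurable borel \<Longrightarrow> fb \<in> borel_measurable borel \<Longrightarrow>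
       (\<And>y. 0 \<le> fa y \<and> fa y \<le> f y) \<Longrightarrow> (\<And>y. 0 \<le> fb y \<and> fb y \<le> f y) \<Longrightarrow> norm e = 1 \<Longrightarrow>
       \<kappa> \<le> (LBINT y. min (fa y) (fb y)) \<Longrightarrow>
       \<exists>t>0. c \<le> t * (LBINT y. min (fa y) (fb (y + t *\<^sub>R e)))"
proof -
  have [measurable]: "f \<in> borel_measurable borel" using fi by auto
  define B where "B n = cbox (- real n *\<^sub>R One) (real n *\<^sub>R One :: 'a)" for n
  have [measurable]: "B n \<in> sets borel" for n by (simp add: B_def)
  \<comment> \<open>Cutting off in height and in space makes the function, after division by
    \<open>n\<close>, bounded by 1 and supported in a box, as
    \<open>exists_translate_overlap\<close> requires.\<close>
  define cut where "cut n x y = min x (real n) * indicator (B n) y" for n x and y :: 'a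
  have "(\<lambda>n. LBINT y. cut n (f y) y) \<longlonglongrightarrow> (LBINT y. f y)"
  proof (rule integral_dominated_convergence[where w = f])
    show "AE y in lborel. (\<lambda>n. cut n (f y) y) \<longlonglongrightarrow> f y"
    proof (rule AE_I2)
      fix y
      obtain m where m: "max (f y) (norm y) \<le> real m" using real_arch_simple by blast
      have "eventually (\<lambda>n. cut n (f y) y = f y) sequentially"
        using eventually_ge_at_top[of m]
      proof eventually_elim
        case (elim n)
        have "y \<in> B n" unfolding B_def mem_box
        proof
          fix i :: 'a assume i: "i \<in> Basis"
          have "\<bar>y \<bullet> i\<bar> \<le> real n" using Basis_le_norm[OF i, of y] m elim by simp
          then show "(- real n *\<^sub>R One) \<bullet> i \<le> y \<bullet> i \<and> y \<bullet> i \<le> (real n *\<^sub>R One) \<bullet> i" using i by (simp add: abs_le_iff)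
        qed
        then show ?case using m elim by (simp add: cut_def)
      qed
      then show "(\<lambda>n. cut n (f y) y) \<longlonglongrightarrow> f y" by (rule tendsto_eventually)
    qed
  qed (auto simp: cut_def fi f0 indicator_def abs_le_iff intro!: order_trans[OF _ f0])
  then have "eventually (\<lambda>n. (LBINT y. f y) - \<kappa> / 2 < (LBINT y. cut n (f y) y)) sequentially"
    using \<kappa> by (intro order_tendstoD(1)) auto
  then have "eventually (\<lambda>n. (LBINT y. f y) - \<kappa> / 2 < (LBINT y. cut n (f y) y) \<and> 0 < n) sequentially"
    using eventually_gt_at_top by eventually_elim simp
  then obtain n where n: "(LBINT y. f y) - \<kappa> / 2 < (LBINT y. cut n (f y) y)" "0 < n"
    using eventually_happens'[OF sequentially_bot] by blast
  define V where "V = measure lborel (cbox (- (real n + 1) *\<^sub>R One) ((real n + 1) *\<^sub>R One :: 'a))"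
  \<comment> \<open>\<open>N\<close> is chosen so that \<open>N\<close> copies of a function of
    integral at least \<open>\<kappa> / (2 * n)\<close> outweigh the volume \<open>V\<close> by 1.
    The final constant is the least shift \<open>1 / N\<close> times the overlap
    \<open>1 / (2 * N\<^sup>2)\<close>.\<close>
  obtain N where N: "(V + 1) / (\<kappa> / (2 * real n)) \<le> real N" using real_arch_simple by blast
  have "0 \<le> V" unfolding V_def by (rule measure_nonneg)
  then have "0 < (V + 1) / (\<kappa> / (2 * real n))" using \<kappa> n by simp
  then have N0: "0 < N" using N by (cases "N = 0") auto
  show thesis
  proof (rule that[of "1 / real N * (1 / (2 * (real N)\<^sup>2))"])
    show "0 < 1 / real N * (1 / (2 * (real N)\<^sup>2))" using N0 by simp
    fix fa fb :: "'a \<Rightarrow> real" and e :: 'a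
    assume m[measurable]: "fa \<in> borel_measurable borel" "fb \<in> borel_measurable borel"
      and fa: "\<And>y. 0 \<le> fa y \<and> fa y \<le> f y" and fb: "\<And>y. 0 \<le> fb y \<and> fb y \<le> f y"
      and e: "norm e = 1" and ov: "\<kappa> \<le> (LBINT y. min (fa y) (fb y))"
    define b where "b y = cut n (min (fa y) (fb y)) y / real n" for y
    have [measurable]: "b \<in> borel_measurable borel" unfolding b_def cut_def by measurable
    have b0: "0 \<le> b y" for y using fa[of y] fb[of y] by (simp add: b_def cut_def)
    have b1: "b y \<le> 1" for y using n by (simp add: b_def cut_def indicator_def field_simps)
    have ble: "b y \<le> fa y" "b y \<le> fb y" for y
    proof -
      have "b y \<le> min (fa y) (fb y) / 1" unfolding b_def cut_def
        using n fa[of y] fb[of y] by (intro frac_le) (auto simp: indicator_def)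
      then show "b y \<le> fa y" "b y \<le> fb y" by auto
    qed
    have int: "integrable lborel g" if [measurable]: "g \<in> borel_measurable borel" and "\<And>y. 0 \<le> g y \<and> g y \<le> f y" for g
    proof (rule Bochner_Integration.integrable_bound[OF fi])
      show "AE y in lborel. norm (g y) \<le> norm (f y)"
        using that(2) f0 by (intro AE_I2) (simp add: abs_of_nonneg)
    qed simp
    have fai: "integrable lborel fa" "integrable lborel fb" by (rule int[OF m(1) fa], rule int[OF m(2) fb])
    have bi: "integrable lborel b"
    proof (rule int)
      show "0 \<le> b y \<and> b y \<le> f y" for y using b0[of y] ble(1)[of y] fa[of y] by linarith
    qed simp
    have ci: "integrable lborel (\<lambda>y. cut n (g y) y)" if "g \<in> borel_measurable borel" "\<And>y. 0 \<le> g y \<and> g y \<le> f y" for g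
    proof (rule int)
      have [measurable]: "g \<in> borel_measurable borel" by fact
      show "(\<lambda>y. cut n (g y) y) \<in> borel_measurable borel" unfolding cut_def by measurable
      fix y show "0 \<le> cut n (g y) y \<and> cut n (g y) y \<le> f y"
        using that(2)[of y] f0[of y] by (auto simp: cut_def indicator_def)
    qed
    have mm: "(\<lambda>y. min (fa y) (fb y)) \<in> borel_measurable borel" "\<And>y. 0 \<le> min (fa y) (fb y) \<and> min (fa y) (fb y) \<le> f y"
      using fa fb by (measurable, simp add: min.coboundedI1)
    note ints = fi int[OF mm] ci[OF mm] ci[of f, OF _ conjI[OF f0 order_refl], simplified]
    \<comment> \<open>The loss caused by \<open>cut\<close> is monotone in the cut value, so
      \<open>min fa fb\<close> loses no more than \<open>f\<close> does, and that is less than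
      \<open>\<kappa> / 2\<close> by the choice of \<open>n\<close>. This makes \<open>n\<close>
      independent of \<open>fa\<close> and \<open>fb\<close>.\<close>
    have "(LBINT y. min (fa y) (fb y) - cut n (min (fa y) (fb y)) y) \<le> (LBINT y. f y - cut n (f y) y)"
    proof (rule integral_mono)
      show "min (fa y) (fb y) - cut n (min (fa y) (fb y)) y \<le> f y - cut n (f y) y" for y
        using mm(2)[of y] by (auto simp: cut_def indicator_def)
    qed (intro Bochner_Integration.integrable_diff ints)+
    then have "\<kappa> / 2 \<le> (LBINT y. cut n (min (fa y) (fb y)) y)"
      using n ov ints by simp
    then have "\<kappa> / (2 * real n) \<le> (LBINT y. b y)"
      using n unfolding b_def by (simp add: field_simps)
    moreover have "V + 1 \<le> real N * (\<kappa> / (2 * real n))"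
      using N \<kappa> n by (simp add: field_simps)
    ultimately have big: "V + 1 \<le> real N * (LBINT y. b y)"
      by (meson mult_left_mono of_nat_0_le_iff order_trans)
    obtain t where t: "1 / real N \<le> t" "1 / (2 * (real N)\<^sup>2) < (LBINT y. min (b y) (b (y + t *\<^sub>R e)))"
      by (rule exists_translate_overlap[of b "real n" e N])
         (use b0 b1 bi e N0 big in \<open>auto simp: b_def cut_def B_def V_def\<close>)
    have "(LBINT y. min (b y) (b (y + t *\<^sub>R e))) \<le> (LBINT y. min (fa y) (fb (y + t *\<^sub>R e)))"
    proof (rule integral_mono)
      show "min (b y) (b (y + t *\<^sub>R e)) \<le> min (fa y) (fb (y + t *\<^sub>R e))" for y
        using ble by (intro min.mono) auto
    qed (use bi fai in \<open>auto intro!: integrable_min simp: lborel_integral_shift\<close>)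
    moreover have t0: "0 < t" using t N0 by (meson divide_pos_pos less_le_trans of_nat_0_less_iff zero_less_one)
    ultimately have "1 / real N * (1 / (2 * (real N)\<^sup>2)) \<le> t * (LBINT y. min (fa y) (fb (y + t *\<^sub>R e)))"
      using t N0 by (intro mult_mono) auto
    with t0 show "\<exists>t>0. 1 / real N * (1 / (2 * (real N)\<^sup>2)) \<le> t * (LBINT y. min (fa y) (fb (y + t *\<^sub>R e)))"
      by blast
  qed
qed

section \<open>The gain in transport cost\<close>

lemma pushes_real:
  assumes p: "pushes T r n" and m[measurable]: "T \<in> borel_measurable borel" "r \<in> borel_measurable borel"
    "n \<in> borel_measurable borel" "f \<in> borel_measurable borel"
    and nn: "\<And>x. 0 \<le> r x" "\<And>y. 0 \<le> n y" "\<And>y. 0 \<le> f y" and i: "integrable lborel (\<lambda>y. n y * f y)"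
  shows "integrable lborel (\<lambda>x. r x * f (T x))"
    and "(LBINT x. r x * f (T x)) = (LBINT y. n y * f y)"
proof -
  have eq: "(\<integral>\<^sup>+ x. ennreal (r x * f (T x)) \<partial>lborel) = (\<integral>\<^sup>+ y. ennreal (n y * f y) \<partial>lborel)"
    using pushesD[OF p, of "\<lambda>y. ennreal (f y)"] by (simp add: ennreal_mult nn)
  show "integrable lborel (\<lambda>x. r x * f (T x))"
  proof (rule integrableI_nonneg)
    show "(\<integral>\<^sup>+ x. ennreal (r x * f (T x)) \<partial>lborel) < \<infinity>"
      unfolding eq using i nn by (simp add: nn_integral_eq_integral)
  qed (auto simp: nn)
  show "(LBINT x. r x * f (T x)) = (LBINT y. n y * f y)"
    by (subst (1 2) integral_eq_nn_integral) (auto simp: nn eq)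
qed

lemma pushes_add:
  assumes p: "pushes T r1 n1" "pushes T r2 n2" and [measurable]: "T \<in> borel_measurable borel"
    "r1 \<in> borel_measurable borel" "n1 \<in> borel_measurable borel" "r2 \<in> borel_measurable borel" "n2 \<in> borel_measurable borel"
    and nn: "\<And>x. 0 \<le> r1 x" "\<And>x. 0 \<le> r2 x" "\<And>y. 0 \<le> n1 y" "\<And>y. 0 \<le> n2 y"
  shows "pushes T (\<lambda>x. r1 x + r2 x) (\<lambda>y. n1 y + n2 y)"
  unfolding pushes_def
proof
  fix f :: "'a \<Rightarrow> ennreal" assume f[measurable]: "f \<in> borel_measurable borel"
  show "(\<integral>\<^sup>+ x. ennreal (r1 x + r2 x) * f (T x) \<partial>lborel) = (\<integral>\<^sup>+ y. ennreal (n1 y + n2 y) * f y \<partial>lborel)"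
    by (simp add: nn distrib_right nn_integral_add pushesD[OF p(1) f] pushesD[OF p(2) f])
qed

lemma pushes_sum:
  fixes T :: "'a::euclidean_space \<Rightarrow> 'a" and r n :: "'d \<Rightarrow> 'a \<Rightarrow> real"
  assumes p: "\<And>d. d \<in> D \<Longrightarrow> pushes T (r d) (n d)" and [measurable]: "T \<in> borel_measurable borel"
    and m: "\<And>d. d \<in> D \<Longrightarrow> r d \<in> borel_measurable borel" "\<And>d. d \<in> D \<Longrightarrow> n d \<in> borel_measurable borel"
    and nn: "\<And>d x. d \<in> D \<Longrightarrow> 0 \<le> r d x" "\<And>d y. d \<in> D \<Longrightarrow> 0 \<le> n d y"
  shows "pushes T (\<lambda>x. \<Sum>d\<in>D. r d x) (\<lambda>y. \<Sum>d\<in>D. n d y)"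
  unfolding pushes_def
proof
  fix f :: "'a \<Rightarrow> ennreal" assume f[measurable]: "f \<in> borel_measurable borel"
  have "(\<integral>\<^sup>+ x. ennreal (\<Sum>d\<in>D. r d x) * f (T x) \<partial>lborel) = (\<integral>\<^sup>+ x. (\<Sum>d\<in>D. ennreal (r d x) * f (T x)) \<partial>lborel)"
    by (intro nn_integral_cong) (simp add: sum_distrib_right[symmetric] sum_ennreal nn)
  also have "\<dots> = (\<Sum>d\<in>D. \<integral>\<^sup>+ x. ennreal (r d x) * f (T x) \<partial>lborel)"
    using m by (intro nn_integral_sum) auto
  also have "\<dots> = (\<Sum>d\<in>D. \<integral>\<^sup>+ y. ennreal (n d y) * f y \<partial>lborel)"
    by (intro sum.cong refl pushesD p f)
  also have "\<dots> = (\<integral>\<^sup>+ x. (\<Sum>d\<in>D. ennreal (n d x) * f x) \<partial>lborel)"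
    using m by (intro nn_integral_sum[symmetric]) auto
  also have "\<dots> = (\<integral>\<^sup>+ y. ennreal (\<Sum>d\<in>D. n d y) * f y \<partial>lborel)"
    by (intro nn_integral_cong) (simp add: sum_distrib_right[symmetric] sum_ennreal nn)
  finally show "(\<integral>\<^sup>+ x. ennreal (\<Sum>d\<in>D. r d x) * f (T x) \<partial>lborel) = (\<integral>\<^sup>+ y. ennreal (\<Sum>d\<in>D. n d y) * f y \<partial>lborel)" .
qed

lemma min_sum_le:
  fixes fb :: "'d \<Rightarrow> real"
  assumes "finite D" "0 \<le> fa" "\<And>d. d \<in> D \<Longrightarrow> 0 \<le> fb d"
  shows "min fa (\<Sum>d\<in>D. fb d) \<le> (\<Sum>d\<in>D. min fa (fb d))"
proof (cases "\<exists>d\<in>D. fa \<le> fb d")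
  case True
  then obtain d where d: "d \<in> D" "fa \<le> fb d" by blast
  have "min fa (fb d) \<le> (\<Sum>d\<in>D. min fa (fb d))" using assms d by (intro member_le_sum) auto
  then show ?thesis using d by simp
next
  case False
  then have "(\<Sum>d\<in>D. min fa (fb d)) = (\<Sum>d\<in>D. fb d)" by (intro sum.cong) auto
  then show ?thesis by simp
qed

lemma integrable_le:
  fixes f g :: "'a::euclidean_space \<Rightarrow> real"
  assumes "integrable lborel f" "g \<in> borel_measurable borel" "\<And>x. 0 \<le> g x" "\<And>x. g x \<le> f x"
  shows "integrable lborel g"
proof (rule Bochner_Integration.integrable_bound[OF assms(1)])
  show "AE x in lborel. norm (g x) \<le> norm (f x)"
    using assms(3,4) by (intro AE_I2) (simp, meson abs_ge_self order_trans)
qed (use assms(2) in simp)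

lemma integrable_inner_of_second_moment:
  fixes r w :: "'a::euclidean_space \<Rightarrow> real"
  assumes "integrable lborel r" "integrable lborel (\<lambda>x. (norm x)\<^sup>2 * r x)"
    and [measurable]: "w \<in> borel_measurable borel" and w: "\<And>x. 0 \<le> w x" "\<And>x. w x \<le> r x"
  shows "integrable lborel (\<lambda>x. w x * (x \<bullet> v))"
proof (rule Bochner_Integration.integrable_bound)
  show "integrable lborel (\<lambda>x. norm v * (r x + (norm x)\<^sup>2 * r x))" using assms by auto
  have "norm (w x * (x \<bullet> v)) \<le> norm v * (r x + (norm x)\<^sup>2 * r x)" for x
  proof -
    have "norm x \<le> 1 + (norm x)\<^sup>2" by (rule norm_le_one_plus_sq)
    then have "\<bar>x \<bullet> v\<bar> \<le> (1 + (norm x)\<^sup>2) * norm v"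
      using Cauchy_Schwarz_ineq2[of x v] by (meson mult_right_mono norm_ge_zero order_trans)
    then have "w x * \<bar>x \<bullet> v\<bar> \<le> r x * ((1 + (norm x)\<^sup>2) * norm v)"
      using w[of x] by (intro mult_mono) auto
    then show ?thesis using w(1)[of x] by (simp add: abs_mult algebra_simps)
  qed
  then show "AE x in lborel. norm (w x * (x \<bullet> v)) \<le> norm (norm v * (r x + (norm x)\<^sup>2 * r x))"
    by (intro AE_I2) (simp, meson abs_ge_self order_trans)
qed measurable

text \<open>The pieces \<open>a\<close> of \<open>u\<close> and \<open>b\<close> of \<open>w\<close> trade targets: a point of \<open>a\<close> sent to \<open>y\<close> is sent to \<open>y + v\<close>
  instead, and a point of \<open>b\<close> sent to \<open>y + v\<close> is sent to \<open>y\<close>. This raises \<open>\<integral> x \<bullet> y\<close> by the difference below.\<close>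

definition exchange_gain :: "real \<Rightarrow> ('a::euclidean_space \<Rightarrow> 'a) \<Rightarrow> ('a \<Rightarrow> 'a) \<Rightarrow> ('a \<Rightarrow> real) \<Rightarrow> ('a \<Rightarrow> real) \<Rightarrow>
    ('a \<Rightarrow> real) \<Rightarrow> bool" where
  "exchange_gain c T1 T2 u w n \<longleftrightarrow>
     (\<exists>v a b k. a \<in> borel_measurable borel \<and> b \<in> borel_measurable borel \<and> k \<in> borel_measurable borel \<and>
       (\<forall>x. 0 \<le> a x \<and> a x \<le> u x) \<and> (\<forall>x. 0 \<le> b x \<and> b x \<le> w x) \<and> (\<forall>y. 0 \<le> k y \<and> k y \<le> n y) \<and>
       pushes T1 a k \<and> pushes T2 b (\<lambda>y. k (y - v)) \<and>
       c \<le> (LBINT x. a x * (x \<bullet> v)) - (LBINT x. b x * (x \<bullet> v)))"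

text \<open>The mass of \<open>u\<close> in the small box exceeds that of \<open>w\<close> in the
  large box by at least \<open>\<kappa>0\<close>. Both have target density \<open>n\<close>, so
  targets of mass at least \<open>\<kappa>0\<close> are reached by \<open>u\<close> from
  \<open>Q'\<close> and by \<open>w\<close> from outside \<open>Q\<close>. The outside is covered by
  the \<open>2 * DIM('a)\<close> half spaces beyond the faces, and one of them takes a share
  \<open>\<kappa>\<close>. Translating targets along the normal of that face by length
  \<open>t\<close> gains at least \<open>\<eta> * t\<close> per unit of mass.\<close>

lemma uniform_swap_gain:
  fixes r1 r2 r02 :: "'a::euclidean_space \<Rightarrow> real"
  assumes i: "integrable lborel r1" "integrable lborel r2" "integrable lborel r02"
    and m2: "integrable lborel (\<lambda>x. (norm x)\<^sup>2 * r1 x)" "integrable lborel (\<lambda>x. (norm x)\<^sup>2 * r2 x)"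
    and nn: "\<And>x. 0 \<le> r1 x" "\<And>x. 0 \<le> r2 x" "\<And>x. 0 \<le> r02 x"
    and notle: "\<not> (AE x in lborel. r1 x \<le> r2 x)"
  obtains c where "0 < c"
    "\<And>T1 T2 u w n. T1 \<in> borel_measurable borel \<Longrightarrow> T2 \<in> borel_measurable borel \<Longrightarrow>
       u \<in> borel_measurable borel \<Longrightarrow> w \<in> borel_measurable borel \<Longrightarrow> n \<in> borel_measurable borel \<Longrightarrow>
       (\<And>x. 0 \<le> u x \<and> u x \<le> r1 x) \<Longrightarrow> (\<And>x. 0 \<le> w x \<and> w x \<le> r2 x) \<Longrightarrow> (\<And>y. 0 \<le> n y \<and> n y \<le> r02 y) \<Longrightarrow>
       pushes T1 u n \<Longrightarrow> pushes T2 w n \<Longrightarrow> (AE x in lborel. w x + r1 x - r2 x \<le> u x) \<Longrightarrow>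
       exchange_gain c T1 T2 u w n"
proof -
  have [measurable]: "r1 \<in> borel_measurable borel" "r2 \<in> borel_measurable borel" "r02 \<in> borel_measurable borel"
    using i by auto
  obtain p q \<eta> where \<eta>: "0 < \<eta>" and ex:
    "(LBINT x. indicator (box p q) x * r2 x) < (LBINT x. indicator (cbox (p + \<eta> *\<^sub>R One) (q - \<eta> *\<^sub>R One)) x * r1 x)"
    using exists_shrunk_box_excess[OF i(1,2) nn(1,2) notle] by blast
  define Q where "Q = box p q"
  define Q' where "Q' = cbox (p + \<eta> *\<^sub>R One) (q - \<eta> *\<^sub>R One)"
  have [measurable]: "Q \<in> sets borel" "Q' \<in> sets borel" by (simp_all add: Q_def Q'_def)
  have Q'Q: "Q' \<subseteq> Q"
  proof
    fix x assume "x \<in> Q'"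
    then have "p \<bullet> i + \<eta> \<le> x \<bullet> i" "x \<bullet> i \<le> q \<bullet> i - \<eta>" if "i \<in> Basis" for i
      using that by (auto simp: Q'_def mem_box inner_simps)
    then show "x \<in> Q" using \<eta> unfolding Q_def mem_box by fastforce
  qed
  \<comment> \<open>A pair \<open>(i, s)\<close> names a face of the box: \<open>dir\<close> is its
    inner unit normal and \<open>side\<close> the closed half space beyond it.\<close>
  define dir where "dir = (\<lambda>(i::'a, s::bool). if s then i else - i)"
  define \<xi> where "\<xi> = (\<lambda>(i::'a, s::bool). if s then p \<bullet> i else - (q \<bullet> i))"
  define D where "D = (Basis :: 'a set) \<times> (UNIV :: bool set)"
  define side where "side d = {x. x \<bullet> dir d \<le> \<xi> d}" for d
  have [measurable]: "side d \<in> sets borel" for d unfolding side_def by measurable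
  have D: "finite D" "D \<noteq> {}" "card D = 2 * DIM('a)" by (auto simp: D_def card_UNIV_bool)
  have dir1: "norm (dir d) = 1" if "d \<in> D" for d using that by (auto simp: D_def dir_def)
  have cover: "\<exists>d\<in>D. x \<in> side d" if xQ: "x \<notin> Q" for x
  proof -
    obtain i where i: "i \<in> Basis" "x \<bullet> i \<le> p \<bullet> i \<or> q \<bullet> i \<le> x \<bullet> i"
      using xQ unfolding Q_def mem_box by force
    then have "x \<in> side (i, True) \<or> x \<in> side (i, False)" by (auto simp: side_def dir_def \<xi>_def)
    then show ?thesis using i by (auto simp: D_def)
  qed
  have sep: "\<xi> d + \<eta> \<le> x \<bullet> dir d" if "x \<in> Q'" "d \<in> D" for x d
    using that by (auto simp: Q'_def mem_box inner_simps D_def dir_def \<xi>_def algebra_simps split: prod.splits)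
  define \<kappa>0 where "\<kappa>0 = (LBINT x. indicator Q' x * r1 x) - (LBINT x. indicator Q x * r2 x)"
  have \<kappa>0: "0 < \<kappa>0" using ex by (simp add: \<kappa>0_def Q_def Q'_def)
  define \<kappa> where "\<kappa> = \<kappa>0 / (2 * DIM('a))"
  have \<kappa>: "0 < \<kappa>" using \<kappa>0 by (simp add: \<kappa>_def)
  obtain c where c: "0 < c"
    "\<And>fa fb e. fa \<in> borel_measurable borel \<Longrightarrow> fb \<in> borel_measurable borel \<Longrightarrow>
       (\<And>y. 0 \<le> fa y \<and> fa y \<le> r02 y) \<Longrightarrow> (\<And>y. 0 \<le> fb y \<and> fb y \<le> r02 y) \<Longrightarrow> norm e = 1 \<Longrightarrow>
       \<kappa> \<le> (LBINT y. min (fa y) (fb y)) \<Longrightarrow>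
       \<exists>t>0. c \<le> t * (LBINT y. min (fa y) (fb (y + t *\<^sub>R e)))"
    using uniform_translate_overlap[OF i(3) nn(3) \<kappa>] by blast
  show thesis
  proof (rule that[of "\<eta> * c"])
    show "0 < \<eta> * c" using \<eta> c by simp
    fix T1 T2 :: "'a \<Rightarrow> 'a" and u w n :: "'a \<Rightarrow> real"
    assume T[measurable]: "T1 \<in> borel_measurable borel" "T2 \<in> borel_measurable borel"
      and m[measurable]: "u \<in> borel_measurable borel" "w \<in> borel_measurable borel" "n \<in> borel_measurable borel"
      and u: "\<And>x. 0 \<le> u x \<and> u x \<le> r1 x" and w: "\<And>x. 0 \<le> w x \<and> w x \<le> r2 x" and n: "\<And>y. 0 \<le> n y \<and> n y \<le> r02 y"
      and pu: "pushes T1 u n" and pw: "pushes T2 w n" and uw: "AE x in lborel. w x + r1 x - r2 x \<le> u x"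
    have ni: "integrable lborel n" using integrable_le[OF i(3) m(3)] n by auto
    have ui: "integrable lborel u" using integrable_le[OF i(1) m(1)] u by auto
    have wi: "integrable lborel w" using integrable_le[OF i(2) m(2)] w by auto
    have n0: "0 \<le> n y" for y using n by blast
    have sub: "\<exists>k. k \<in> borel_measurable borel \<and> (\<forall>y. 0 \<le> k y \<and> k y \<le> n y) \<and> pushes T (\<lambda>x. indicator S x * f x) k"
      if "pushes T f n" "T \<in> borel_measurable borel" and fm: "f \<in> borel_measurable borel" and "\<And>x. 0 \<le> f x" and [measurable]: "S \<in> sets borel" for T f S
    proof -
      note fm[measurable]
      have le: "AE x in lborel. indicator S x * f x \<le> f x" using that(4) by (intro AE_I2) (simp add: indicator_def)
      show ?thesis
        by (rule pushes_sub[OF that(1,2) _ le ni n0]) (measurable, blast)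
    qed
    obtain fa where fam[measurable]: "fa \<in> borel_measurable borel" and fa: "\<And>y. 0 \<le> fa y \<and> fa y \<le> n y"
      and pfa: "pushes T1 (\<lambda>x. indicator Q' x * u x) fa"
      using sub[OF pu T(1) m(1), of Q'] u by auto
    obtain fbQ where fbQm[measurable]: "fbQ \<in> borel_measurable borel" and fbQ: "\<And>y. 0 \<le> fbQ y \<and> fbQ y \<le> n y"
      and pfbQ: "pushes T2 (\<lambda>x. indicator Q x * w x) fbQ"
      using sub[OF pw T(2) m(2), of Q] w by auto
    have "\<exists>k. k \<in> borel_measurable borel \<and> (\<forall>y. 0 \<le> k y \<and> k y \<le> n y) \<and> pushes T2 (\<lambda>x. indicator (side d) x * w x) k" for d
      using sub[OF pw T(2) m(2), of "side d"] w by auto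
    then obtain fb where fbm[measurable]: "\<And>d. fb d \<in> borel_measurable borel" and fb: "\<And>d y. 0 \<le> fb d y \<and> fb d y \<le> n y"
      and pfb: "\<And>d. pushes T2 (\<lambda>x. indicator (side d) x * w x) (fb d)" by metis
    have le_n: "integrable lborel k" if "k \<in> borel_measurable borel" "\<And>y. 0 \<le> k y \<and> k y \<le> n y" for k
      using integrable_le[OF ni that(1)] that(2) by auto
    have fai: "integrable lborel fa" and fbQi: "integrable lborel fbQ" and fbi: "integrable lborel (fb d)" for d
      by (rule le_n[OF fam fa], rule le_n[OF fbQm fbQ], rule le_n[OF fbm fb])
    \<comment> \<open>Half spaces may overlap, so mass can be counted several times; only the
      resulting inequality \<open>cov\<close> is used, which bounds \<open>n\<close> by the targets
      from outside and from \<open>Q\<close>.\<close>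
    have "pushes T2 (\<lambda>x. (\<Sum>d\<in>D. indicator (side d) x * w x) + indicator Q x * w x) (\<lambda>y. (\<Sum>d\<in>D. fb d y) + fbQ y)"
      using fb fbQ w by (intro pushes_add pushes_sum pfb pfbQ) (auto intro!: sum_nonneg)
    then have cov: "AE y in lborel. n y \<le> (\<Sum>d\<in>D. fb d y) + fbQ y"
    proof (rule pushes_mono[OF pw _ T(2)])
      show "AE x in lborel. w x \<le> (\<Sum>d\<in>D. indicator (side d) x * w x) + indicator Q x * w x"
      proof (rule AE_I2)
        fix x
        show "w x \<le> (\<Sum>d\<in>D. indicator (side d) x * w x) + indicator Q x * w x"
        proof (cases "x \<in> Q")
          case True
          then show ?thesis using w by (simp add: sum_nonneg)
        next
          case False
          then obtain d where "d \<in> D" "x \<in> side d" using cover by blast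
          then have "indicator (side d) x * w x \<le> (\<Sum>d\<in>D. indicator (side d) x * w x)"
            using w D by (intro member_le_sum) auto
          then show ?thesis using \<open>x \<in> side d\<close> False by simp
        qed
      qed
      show "integrable lborel (\<lambda>y. (\<Sum>d\<in>D. fb d y) + fbQ y)" using fbi fbQi by auto
    qed (use n fb fbQ in \<open>auto intro!: add_nonneg_nonneg sum_nonneg\<close>)
    have ind: "integrable lborel (\<lambda>x. indicator S x * f x)" if "integrable lborel f" "S \<in> sets borel" for S and f :: "'a \<Rightarrow> real"
      using integrable_mult_indicator[OF _ that(1), of S] that(2) by simp
    have Ifa: "(LBINT y. fa y) = (LBINT x. indicator Q' x * u x)"
      using pushes_real(2)[OF pfa T(1) _ fam, of "\<lambda>_. 1"] fa u fai by simp
    have Ifb: "(LBINT y. fbQ y) = (LBINT x. indicator Q x * w x)"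
      using pushes_real(2)[OF pfbQ T(2) _ fbQm, of "\<lambda>_. 1"] fbQ w fbQi by simp
    have "\<kappa>0 \<le> (LBINT x. indicator Q' x * u x - indicator Q x * w x)"
    proof -
      have "\<kappa>0 = (LBINT x. indicator Q' x * r1 x - indicator Q x * r2 x)"
        unfolding \<kappa>0_def using i by (simp add: ind)
      also have "\<dots> \<le> (LBINT x. indicator Q' x * u x - indicator Q x * w x)"
      proof (rule integral_mono_AE)
        \<comment> \<open>On \<open>Q'\<close> this is the hypothesis \<open>uw\<close> rearranged;
          on the rest of \<open>Q\<close> it is \<open>w \<le> r2\<close>.\<close>
        show "AE x in lborel. indicator Q' x * r1 x - indicator Q x * r2 x \<le> indicator Q' x * u x - indicator Q x * w x"
          using uw
        proof eventually_elim
          case (elim x)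
          then show ?case using Q'Q w[of x] by (auto simp: indicator_def)
        qed
      qed (use i ui wi in \<open>auto intro!: ind Bochner_Integration.integrable_diff\<close>)
      finally show ?thesis .
    qed
    also have "\<dots> = (LBINT y. fa y - fbQ y)" using ui wi fai fbQi by (simp add: ind Ifa Ifb)
    also have "\<dots> \<le> (LBINT y. (\<Sum>d\<in>D. min (fa y) (fb d y)))"
    proof (rule integral_mono_AE)
      show "AE y in lborel. fa y - fbQ y \<le> (\<Sum>d\<in>D. min (fa y) (fb d y))"
        using cov
      proof eventually_elim
        case (elim y)
        have "min (fa y) (\<Sum>d\<in>D. fb d y) \<le> (\<Sum>d\<in>D. min (fa y) (fb d y))"
          using fa fb D by (intro min_sum_le) auto
        then show ?case using elim fa[of y] fbQ[of y] by linarith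
      qed
    qed (use fai fbQi fbi in auto)
    also have "\<dots> = (\<Sum>d\<in>D. LBINT y. min (fa y) (fb d y))"
      using fai fbi by (intro Bochner_Integration.integral_sum) auto
    finally have tot: "\<kappa>0 \<le> (\<Sum>d\<in>D. LBINT y. min (fa y) (fb d y))" .
    have "\<exists>d\<in>D. \<kappa> \<le> (LBINT y. min (fa y) (fb d y))"
    proof (rule ccontr)
      assume "\<not> ?thesis"
      then have "(\<Sum>d\<in>D. LBINT y. min (fa y) (fb d y)) < (\<Sum>d\<in>D. \<kappa>)"
        using D by (intro sum_strict_mono) auto
      then show False using tot D by (simp add: \<kappa>_def)
    qed
    then obtain d where d: "d \<in> D" "\<kappa> \<le> (LBINT y. min (fa y) (fb d y))" by blast
    have le02: "0 \<le> fa y \<and> fa y \<le> r02 y" "0 \<le> fb d y \<and> fb d y \<le> r02 y" for y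
      using fa[of y] fb[of d y] n[of y] by auto
    obtain t where t: "0 < t" "c \<le> t * (LBINT y. min (fa y) (fb d (y + t *\<^sub>R dir d)))"
      using c(2)[OF fam fbm le02 dir1[OF d(1)] d(2)] by blast
    define v where "v = t *\<^sub>R dir d"
    \<comment> \<open>The density of targets \<open>y\<close> reached by \<open>u\<close> from the
      box for which \<open>y + v\<close> is reached by \<open>w\<close> from beyond the face; these
      are the targets to be traded.\<close>
    define k where "k y = min (fa y) (fb d (y + v))" for y
    have km[measurable]: "k \<in> borel_measurable borel" unfolding k_def by measurable
    have k: "0 \<le> k y" "k y \<le> fa y" "k (y - v) \<le> fb d y" for y using fa fb by (auto simp: k_def)
    have kfa: "k y / fa y * fa y = k y" for y using k(1,2)[of y] by (cases "fa y = 0") auto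
    have kfb: "k (y - v) / fb d y * fb d y = k (y - v)" for y using k(1)[of "y - v"] k(3)[of y] by (cases "fb d y = 0") auto
    have kfa1: "0 \<le> k y / fa y" "k y / fa y \<le> 1" for y using k(1,2)[of y] fa[of y] by (auto simp: divide_le_eq_1 less_le)
    have kfb1: "0 \<le> k (y - v) / fb d y" "k (y - v) / fb d y \<le> 1" for y using k(1)[of "y - v"] k(3)[of y] fb[of d y] by (auto simp: divide_le_eq_1 less_le)
    \<comment> \<open>\<open>a\<close> and \<open>b\<close> are cut out of the two pieces by the
      fractions that leave the target densities \<open>k\<close> and its translate. The quotients
      are 0 where the denominators vanish, consistently with \<open>k\<close>.\<close>
    define a where "a x = k (T1 x) / fa (T1 x) * (indicator Q' x * u x)" for x
    define b where "b x = k (T2 x - v) / fb d (T2 x) * (indicator (side d) x * w x)" for x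
    have am[measurable]: "a \<in> borel_measurable borel" and bm[measurable]: "b \<in> borel_measurable borel"
      unfolding a_def b_def by measurable
    have pa: "pushes T1 a k"
      using pushes_pullback[OF pfa, of "\<lambda>y. k y / fa y", OF _ kfa1(1)] unfolding kfa a_def[abs_def, symmetric] by simp
    have pb: "pushes T2 b (\<lambda>y. k (y - v))"
      using pushes_pullback[OF pfb, of "\<lambda>y. k (y - v) / fb d y" d, OF _ kfb1(1)] unfolding kfb b_def[abs_def, symmetric] by simp
    have a: "0 \<le> a x" "a x \<le> u x" for x
    proof -
      show "0 \<le> a x" unfolding a_def using kfa1 u by (intro mult_nonneg_nonneg) auto
      have "a x \<le> 1 * u x" unfolding a_def using kfa1 u by (intro mult_mono) (auto simp: indicator_def)
      then show "a x \<le> u x" by simp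
    qed
    have b: "0 \<le> b x" "b x \<le> w x" for x
    proof -
      show "0 \<le> b x" unfolding b_def using kfb1 w by (intro mult_nonneg_nonneg) auto
      have "b x \<le> 1 * w x" unfolding b_def using kfb1 w by (intro mult_mono) (auto simp: indicator_def)
      then show "b x \<le> w x" by simp
    qed
    have aQ: "a x = 0" if "x \<notin> Q'" for x using that by (simp add: a_def)
    have bS: "b x = 0" if "x \<notin> side d" for x using that by (simp add: b_def)
    have ki: "integrable lborel k"
    proof (rule le_n[OF km])
      show "0 \<le> k y \<and> k y \<le> n y" for y using k(1,2)[of y] fa[of y] by linarith
    qed
    have k2i: "integrable lborel (\<lambda>y. k (y - v))" "(LBINT y. k (y - v)) = (LBINT y. k y)"
      using lborel_integral_shift[OF km, of "- v"] ki by simp_all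
    have Ia: "integrable lborel a" "(LBINT x. a x) = (LBINT y. k y)"
      using pushes_real[OF pa T(1) am km, of "\<lambda>_. 1"] a k ki by simp_all
    have Ib: "integrable lborel b" "(LBINT x. b x) = (LBINT y. k y)"
      using pushes_real[OF pb T(2) bm, of "\<lambda>_. 1"] b k k2i by simp_all
    have aur: "a x \<le> r1 x" "b x \<le> r2 x" for x using a[of x] b[of x] u[of x] w[of x] by auto
    have iav: "integrable lborel (\<lambda>x. a x * (x \<bullet> v))" by (rule integrable_inner_of_second_moment[OF i(1) m2(1) am a(1) aur(1)])
    have ibv: "integrable lborel (\<lambda>x. b x * (x \<bullet> v))" by (rule integrable_inner_of_second_moment[OF i(2) m2(2) bm b(1) aur(2)])
    \<comment> \<open>On \<open>a\<close> the product \<open>x \<bullet> v\<close> is at least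
      \<open>t * (\<xi> d + \<eta>)\<close>, on \<open>b\<close> at most \<open>t * \<xi> d\<close>.
      Both have the mass of \<open>k\<close>, so \<open>\<xi> d\<close> cancels and the margin
      remains.\<close>
    have "(LBINT x. a x * (t * (\<xi> d + \<eta>))) \<le> (LBINT x. a x * (x \<bullet> v))"
    proof (rule integral_mono)
      fix x
      show "a x * (t * (\<xi> d + \<eta>)) \<le> a x * (x \<bullet> v)"
        using a(1)[of x] sep[of x d] d(1) t(1) aQ[of x] by (cases "x \<in> Q'") (auto simp: v_def intro!: mult_left_mono)
    qed (use Ia iav in auto)
    moreover have "(LBINT x. b x * (x \<bullet> v)) \<le> (LBINT x. b x * (t * \<xi> d))"
    proof (rule integral_mono)
      fix x
      show "b x * (x \<bullet> v) \<le> b x * (t * \<xi> d)"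
        using b(1)[of x] t(1) bS[of x] by (cases "x \<in> side d") (auto simp: v_def side_def intro!: mult_left_mono)
    qed (use Ib ibv in auto)
    ultimately have "t * \<eta> * (LBINT y. k y) \<le> (LBINT x. a x * (x \<bullet> v)) - (LBINT x. b x * (x \<bullet> v))"
      using Ia Ib by (simp add: algebra_simps)
    moreover have "\<eta> * c \<le> \<eta> * (t * (LBINT y. k y))"
      using t \<eta> by (intro mult_left_mono) (auto simp: k_def v_def)
    ultimately have gain: "\<eta> * c \<le> (LBINT x. a x * (x \<bullet> v)) - (LBINT x. b x * (x \<bullet> v))"
      by (simp add: mult_ac)
    have kn: "k y \<le> n y" for y using k(2)[of y] fa[of y] by linarith
    show "exchange_gain (\<eta> * c) T1 T2 u w n"
      unfolding exchange_gain_def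
      by (rule exI[of _ v], rule exI[of _ a], rule exI[of _ b], rule exI[of _ k])
         (intro conjI allI am bm km a b k(1) kn pa pb gain)
  qed
qed

section \<open>The exchange of halves between the two transport problems\<close>

lemma sum_UNIV_bool_prod: "(\<Sum>l\<in>UNIV. f l) = f (False, False) + f (False, True) + f (True, False) + f (True, True)"
  for f :: "bool \<times> bool \<Rightarrow> real"
  by (simp add: UNIV_Times_UNIV[symmetric] sum.cartesian_product[symmetric] UNIV_bool del: UNIV_Times_UNIV)

text \<open>The marginal condition in real integrals allows the pieces to be added and subtracted
  freely when it is checked for the exchanged plans.\<close>

lemma W2_sq_le_labelled_density:
  fixes p :: "'l::finite \<Rightarrow> 'a::euclidean_space \<Rightarrow> real" and T :: "'l \<Rightarrow> 'a \<Rightarrow> 'a"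
  assumes p: "\<And>l. p l \<in> borel_measurable borel" "\<And>l x. 0 \<le> p l x" "\<And>l. integrable lborel (p l)"
    and T: "\<And>l. T l \<in> borel_measurable borel"
    and r: "r \<in> borel_measurable borel" "AE x in lborel. r x = (\<Sum>l\<in>UNIV. p l x)"
      "integrable lborel r" "integrable lborel (\<lambda>x. (norm x)\<^sup>2 * r x)"
    and n: "integrable lborel n" "\<And>y. 0 \<le> n y" "integrable lborel (\<lambda>y. (norm y)\<^sup>2 * n y)"
    and marg: "\<And>S. S \<in> sets borel \<Longrightarrow>
       (\<Sum>l\<in>UNIV. LBINT x. p l x * indicator S (T l x)) = (LBINT y. n y * indicator S y)"
    and V: "V = (LBINT x. (norm x)\<^sup>2 * r x) + (LBINT y. (norm y)\<^sup>2 * n y)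
      - 2 * (\<Sum>l\<in>UNIV. LBINT x. p l x * (x \<bullet> T l x))"
  shows "W2_sq (density lborel r) (density lborel n) \<le> ennreal V \<and> 0 \<le> V"
proof -
  have [measurable]: "n \<in> borel_measurable borel" using n by auto
  note T[measurable] p(1)[measurable]
  have \<nu>: "sets (density lborel n) = sets borel" "integrable (density lborel n) (\<lambda>y. (norm y)\<^sup>2)"
    using n by (simp_all add: integrable_density mult.commute)
  have i2: "(LINT y|density lborel n. (norm y)\<^sup>2) = (LBINT y. (norm y)\<^sup>2 * n y)"
    using n(2) by (subst integral_density) (simp_all add: mult.commute)
  have ind: "(\<integral>\<^sup>+ x. ennreal (f x) * indicator S (g x) \<partial>lborel) = ennreal (LBINT x. f x * indicator S (g x))"
    if [measurable]: "S \<in> sets borel" "g \<in> borel_measurable borel" and f: "integrable lborel f" "\<And>x. 0 \<le> f x" for S and g :: "'a \<Rightarrow> 'a" and f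
  proof -
    have [measurable]: "f \<in> borel_measurable borel" using f by auto
    have "(\<integral>\<^sup>+ x. ennreal (f x) * indicator S (g x) \<partial>lborel) = (\<integral>\<^sup>+ x. ennreal (f x * indicator S (g x)) \<partial>lborel)"
      by (intro nn_integral_cong) (simp add: indicator_def)
    also have "\<dots> = ennreal (LBINT x. f x * indicator S (g x))"
    proof (rule nn_integral_eq_integral)
      show "integrable lborel (\<lambda>x. f x * indicator S (g x))"
        by (rule integrable_le[OF f(1)]) (auto simp: f(2) indicator_def)
    qed (simp add: f(2))
    finally show ?thesis .
  qed
  have marg': "emeasure (density lborel n) S = (\<Sum>l\<in>UNIV. \<integral>\<^sup>+ x. ennreal (p l x) * indicator S (T l x) \<partial>lborel)"
    if S[measurable]: "S \<in> sets borel" for S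
  proof -
    have "emeasure (density lborel n) S = ennreal (LBINT y. n y * indicator S y)"
      using ind[OF S, of "\<lambda>x. x" n] n by (simp add: emeasure_density)
    also have "\<dots> = (\<Sum>l\<in>UNIV. ennreal (LBINT x. p l x * indicator S (T l x)))"
      unfolding marg[OF S, symmetric] using p(2) by (intro sum_ennreal[symmetric] integral_nonneg_AE AE_I2) auto
    also have "\<dots> = (\<Sum>l\<in>UNIV. \<integral>\<^sup>+ x. ennreal (p l x) * indicator S (T l x) \<partial>lborel)"
      by (intro sum.cong refl ind[symmetric] S T p)
    finally show ?thesis .
  qed
  note L = W2_sq_le_labelled[of p T r "density lborel n", OF p(1,2) T r \<nu> marg', unfolded i2]
  show ?thesis unfolding V using L by simp
qed

text \<open>Puts the cost of a map into the form used for labelled plans, so that costs before and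
  after the exchange are compared through correlations. All correlations are dominated by the two
  second moments.\<close>

lemma pushes_inner:
  fixes T :: "'a::euclidean_space \<Rightarrow> 'a"
  assumes p: "pushes T r n" and T[measurable]: "T \<in> borel_measurable borel"
    and r: "integrable lborel r" "\<And>x. 0 \<le> r x" "integrable lborel (\<lambda>x. (norm x)\<^sup>2 * r x)"
    and n: "integrable lborel n" "\<And>x. 0 \<le> n x" "integrable lborel (\<lambda>x. (norm x)\<^sup>2 * n x)"
  shows "\<And>q. q \<in> borel_measurable borel \<Longrightarrow> (\<And>x. 0 \<le> q x) \<Longrightarrow> (\<And>x. q x \<le> r x) \<Longrightarrow> integrable lborel (\<lambda>x. q x * (x \<bullet> T x))"
    and "(LBINT x. r x * (norm (T x - x))\<^sup>2) = (LBINT x. (norm x)\<^sup>2 * r x) + (LBINT x. (norm x)\<^sup>2 * n x)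
      - 2 * (LBINT x. r x * (x \<bullet> T x))"
    and "integrable lborel (\<lambda>x. r x * (norm (T x - x))\<^sup>2)"
proof -
  have [measurable]: "r \<in> borel_measurable borel" "n \<in> borel_measurable borel" using r n by auto
  have T2: "integrable lborel (\<lambda>x. r x * (norm (T x))\<^sup>2)" "(LBINT x. r x * (norm (T x))\<^sup>2) = (LBINT x. (norm x)\<^sup>2 * n x)"
    using pushes_real[OF p T, of "\<lambda>y. (norm y)\<^sup>2"] r(2) n(2,3) by (simp_all add: mult.commute)
  have bound: "integrable lborel (\<lambda>x. (norm x)\<^sup>2 * r x + r x * (norm (T x))\<^sup>2)" using r T2 by auto
  show q: "integrable lborel (\<lambda>x. q x * (x \<bullet> T x))" if [measurable]: "q \<in> borel_measurable borel" and q: "\<And>x. 0 \<le> q x" "\<And>x. q x \<le> r x" for q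
  proof (rule Bochner_Integration.integrable_bound[OF bound])
    have "norm (q x * (x \<bullet> T x)) \<le> norm ((norm x)\<^sup>2 * r x + r x * (norm (T x))\<^sup>2)" for x
    proof -
      have "q x * \<bar>x \<bullet> T x\<bar> \<le> r x * ((norm x)\<^sup>2 + (norm (T x))\<^sup>2)"
        using q r(2) abs_inner_le by (intro mult_mono) auto
      then show ?thesis using q(1)[of x] r(2)[of x] by (simp add: abs_mult algebra_simps)
    qed
    then show "AE x in lborel. norm (q x * (x \<bullet> T x)) \<le> norm ((norm x)\<^sup>2 * r x + r x * (norm (T x))\<^sup>2)" by simp
  qed measurable
  have ri: "integrable lborel (\<lambda>x. r x * (x \<bullet> T x))" using r by (intro q) auto
  have eq: "r x * (norm (T x - x))\<^sup>2 = (norm x)\<^sup>2 * r x + r x * (norm (T x))\<^sup>2 - 2 * (r x * (x \<bullet> T x))" for x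
    by (simp add: power2_norm_eq_inner inner_diff inner_commute algebra_simps)
  show "(LBINT x. r x * (norm (T x - x))\<^sup>2) = (LBINT x. (norm x)\<^sup>2 * r x) + (LBINT x. (norm x)\<^sup>2 * n x)
      - 2 * (LBINT x. r x * (x \<bullet> T x))"
    unfolding eq using r T2 ri by simp
  show "integrable lborel (\<lambda>x. r x * (norm (T x - x))\<^sup>2)"
    unfolding eq using r T2 ri by simp
qed

text \<open>\<open>V1\<close> and \<open>V2\<close> stand for costs of explicit plans, which bound
  the squared distances from above, and \<open>c\<close> is what is saved against the given maps.
  The bounds on \<open>s\<close> are almost everywhere because the fixed point equation is solved
  only almost everywhere.\<close>

definition exchange :: "real \<Rightarrow> ('a::euclidean_space \<Rightarrow> real) \<Rightarrow> ('a \<Rightarrow> real) \<Rightarrow> ('a \<Rightarrow> real) \<Rightarrow> ('a \<Rightarrow> real) \<Rightarrow>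
    ('a \<Rightarrow> 'a) \<Rightarrow> ('a \<Rightarrow> 'a) \<Rightarrow> bool" where
  "exchange c r1 r2 r01 r02 T1 T2 \<longleftrightarrow>
     (\<exists>s V1 V2. integrable lborel s \<and> (LBINT x. s x) = 0 \<and>
       (AE x in lborel. min 0 (r2 x - r1 x) \<le> s x \<and> s x \<le> max 0 (r2 x - r1 x)) \<and>
       0 \<le> V1 \<and> 0 \<le> V2 \<and>
       W2_sq (density lborel (\<lambda>x. r1 x + s x / 2)) (density lborel r01) \<le> ennreal V1 \<and>
       W2_sq (density lborel (\<lambda>x. r2 x - s x / 2)) (density lborel r02) \<le> ennreal V2 \<and>
       V1 + V2 + c \<le> (LBINT x. r1 x * (norm (T1 x - x))\<^sup>2) + (LBINT x. r2 x * (norm (T2 x - x))\<^sup>2))"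

text \<open>Half of \<open>u\<close> in the first problem and half of \<open>w\<close> in the second
  change places, and then \<open>a / 2\<close> and \<open>b / 2\<close> trade targets within the
  first plan. There is room for this, as the remaining half of \<open>u\<close> contains
  \<open>a / 2\<close> and the imported half of \<open>w\<close> contains \<open>b / 2\<close>. In
  the sum over both problems everything cancels except the correlation gained by the trade; its
  factor 1/2 is compensated by the factor 2 of the correlation in the cost.\<close>

lemma uniform_swap:
  fixes r1 r2 r01 r02 :: "'a::euclidean_space \<Rightarrow> real"
  assumes i: "integrable lborel r1" "integrable lborel r2" "integrable lborel r01" "integrable lborel r02"
    and m2: "integrable lborel (\<lambda>x. (norm x)\<^sup>2 * r1 x)" "integrable lborel (\<lambda>x. (norm x)\<^sup>2 * r2 x)"
      "integrable lborel (\<lambda>x. (norm x)\<^sup>2 * r01 x)" "integrable lborel (\<lambda>x. (norm x)\<^sup>2 * r02 x)"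
    and nn: "\<And>x. 0 \<le> r1 x" "\<And>x. 0 \<le> r2 x" "\<And>x. 0 \<le> r01 x"
    and le: "\<And>x. r01 x \<le> r02 x"
    and notle: "\<not> (AE x in lborel. r1 x \<le> r2 x)"
  obtains c where "0 < c"
    "\<And>T1 T2. T1 \<in> borel_measurable borel \<Longrightarrow> T2 \<in> borel_measurable borel \<Longrightarrow>
       pushes T1 r1 r01 \<Longrightarrow> pushes T2 r2 r02 \<Longrightarrow>
       exchange c r1 r2 r01 r02 T1 T2"
proof -
  have nn02: "0 \<le> r02 x" for x using nn(3)[of x] le[of x] by simp
  have [measurable]: "r1 \<in> borel_measurable borel" "r2 \<in> borel_measurable borel"
    "r01 \<in> borel_measurable borel" "r02 \<in> borel_measurable borel" using i by auto
  obtain c where c: "0 < c" and gain: "\<And>T1 T2 u w n. T1 \<in> borel_measurable borel \<Longrightarrow> T2 \<in> borel_measurable borel \<Longrightarrow>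
       u \<in> borel_measurable borel \<Longrightarrow> w \<in> borel_measurable borel \<Longrightarrow> n \<in> borel_measurable borel \<Longrightarrow>
       (\<And>x. 0 \<le> u x \<and> u x \<le> r1 x) \<Longrightarrow> (\<And>x. 0 \<le> w x \<and> w x \<le> r2 x) \<Longrightarrow> (\<And>y. 0 \<le> n y \<and> n y \<le> r02 y) \<Longrightarrow>
       pushes T1 u n \<Longrightarrow> pushes T2 w n \<Longrightarrow> (AE x in lborel. w x + r1 x - r2 x \<le> u x) \<Longrightarrow>
       exchange_gain c T1 T2 u w n"
    by (rule uniform_swap_gain[OF i(1,2,4) m2(1,2) nn(1,2) nn02 notle]) blast
  show thesis
  proof (rule that[OF c])
    fix T1 T2 :: "'a \<Rightarrow> 'a"
    assume T[measurable]: "T1 \<in> borel_measurable borel" "T2 \<in> borel_measurable borel"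
      and p1: "pushes T1 r1 r01" and p2: "pushes T2 r2 r02"
    obtain u g where um[measurable]: "u \<in> borel_measurable borel" and u: "\<And>x. 0 \<le> u x" "\<And>x. u x \<le> r1 x"
      and gm[measurable]: "g \<in> borel_measurable borel" and g: "\<And>y. 0 \<le> g y" "\<And>y. g y \<le> 1"
      and pu: "pushes T1 u (\<lambda>y. g y * r02 y)"
      and u_eq: "AE x in lborel. u x = max 0 (g (T2 x) * r2 x + r1 x - r2 x)"
      using swap_fixed_point[OF T i nn le p1 p2] by blast
    define n where "n y = g y * r02 y" for y
    define w where "w x = g (T2 x) * r2 x" for x
    have nm[measurable]: "n \<in> borel_measurable borel" and wm[measurable]: "w \<in> borel_measurable borel"
      unfolding n_def w_def by measurable
    have w: "0 \<le> w x" "w x \<le> r2 x" for x using g nn(2) by (auto simp: w_def mult_left_le_one_le)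
    have n: "0 \<le> n x" "n x \<le> r02 x" for x using g nn02 by (auto simp: n_def mult_left_le_one_le)
    have pu': "pushes T1 u n" using pu by (simp add: n_def[abs_def])
    have pw: "pushes T2 w n" using pushes_pullback[OF p2 gm g(1)] by (simp add: n_def[abs_def] w_def[abs_def])
    have "AE x in lborel. w x + r1 x - r2 x \<le> u x" using u_eq by eventually_elim (simp add: w_def)
    then have "exchange_gain c T1 T2 u w n"
      by (intro gain[OF T um wm nm _ _ _ pu' pw]) (auto simp: u w n)
    then obtain v a b k where am[measurable]: "a \<in> borel_measurable borel" and bm[measurable]: "b \<in> borel_measurable borel"
      and km[measurable]: "k \<in> borel_measurable borel"
      and a: "\<And>x. 0 \<le> a x" "\<And>x. a x \<le> u x" and b: "\<And>x. 0 \<le> b x" "\<And>x. b x \<le> w x"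
      and k: "\<And>x. 0 \<le> k x" "\<And>x. k x \<le> n x"
      and pa: "pushes T1 a k" and pb: "pushes T2 b (\<lambda>y. k (y - v))"
      and gn: "c \<le> (LBINT x. a x * (x \<bullet> v)) - (LBINT x. b x * (x \<bullet> v))"
      unfolding exchange_gain_def by blast
    have ni: "integrable lborel n" by (rule integrable_le[OF i(4) nm n])
    have ui: "integrable lborel u" by (rule integrable_le[OF i(1) um u])
    have wi: "integrable lborel w" by (rule integrable_le[OF i(2) wm w])
    have ai: "integrable lborel a" by (rule integrable_le[OF ui am a])
    have bi: "integrable lborel b" by (rule integrable_le[OF wi bm b])
    have ki: "integrable lborel k" by (rule integrable_le[OF ni km k])
    have kvi: "integrable lborel (\<lambda>y. k (y - v))" using lborel_integral_shift(2)[OF km, of "- v"] ki by simp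
    define s where "s x = w x - u x" for x
    have si: "integrable lborel s" unfolding s_def using ui wi by simp
    have s0: "(LBINT x. s x) = 0"
      using pushes_real(2)[OF pu' T(1) um nm, of "\<lambda>_. 1"] pushes_real(2)[OF pw T(2) wm nm, of "\<lambda>_. 1"] ui wi u w n ni
      by (simp add: s_def)
    have s_between: "AE x in lborel. min 0 (r2 x - r1 x) \<le> s x \<and> s x \<le> max 0 (r2 x - r1 x)"
      using u_eq
    proof eventually_elim
      case (elim x)
      then show ?case using w[of x] unfolding s_def w_def[symmetric] by (auto simp: min_def max_def split: if_splits)
    qed
    have le1: "a x \<le> r1 x" "b x \<le> r2 x" for x using a[of x] u[of x] b[of x] w[of x] by linarith+
    have um2: "integrable lborel (\<lambda>x. (norm x)\<^sup>2 * u x)" by (rule integrable_le[OF m2(1)]) (auto simp: u mult_left_mono)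
    have wm2: "integrable lborel (\<lambda>x. (norm x)\<^sup>2 * w x)" by (rule integrable_le[OF m2(2)]) (auto simp: w mult_left_mono)
    note in1 = pushes_inner[OF p1 T(1) i(1) nn(1) m2(1) i(3) nn(3) m2(3)]
    note in2 = pushes_inner[OF p2 T(2) i(2) nn(2) m2(2) i(4) nn02 m2(4)]
    have c1: "integrable lborel (\<lambda>x. r1 x * (x \<bullet> T1 x))" "integrable lborel (\<lambda>x. u x * (x \<bullet> T1 x))" "integrable lborel (\<lambda>x. a x * (x \<bullet> T1 x))"
      by (rule in1(1), simp_all add: nn u a le1)+
    have c2: "integrable lborel (\<lambda>x. r2 x * (x \<bullet> T2 x))" "integrable lborel (\<lambda>x. w x * (x \<bullet> T2 x))" "integrable lborel (\<lambda>x. b x * (x \<bullet> T2 x))"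
      by (rule in2(1), simp_all add: nn w b le1)+
    have av: "integrable lborel (\<lambda>x. a x * (x \<bullet> v))" by (rule integrable_inner_of_second_moment[OF i(1) m2(1) am a(1) le1(1)])
    have bv: "integrable lborel (\<lambda>x. b x * (x \<bullet> v))" by (rule integrable_inner_of_second_moment[OF i(2) m2(2) bm b(1) le1(2)])
    have ind: "integrable lborel (\<lambda>x. f x * indicator S (h x))"
      if f: "integrable lborel f" "\<And>x. 0 \<le> f x" and [measurable]: "S \<in> sets borel" "h \<in> borel_measurable borel" for f :: "'a \<Rightarrow> real" and h :: "'a \<Rightarrow> 'a" and S :: "'a set"
    proof -
      have [measurable]: "f \<in> borel_measurable borel" using f by auto
      show ?thesis by (rule integrable_le[OF f(1)]) (auto simp: f(2) indicator_def)
    qed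
    \<comment> \<open>The offset \<open>z\<close> covers the traded targets together with the
      unchanged ones, for which \<open>z = 0\<close>; this is also why \<open>S1\<close> below is
      written with \<open>+ 0\<close>.\<close>
    have push_ind: "(LBINT x. f x * indicator S (h x + z)) = (LBINT y. j y * indicator S (y + z))"
      if "pushes h f j" "h \<in> borel_measurable borel" "integrable lborel f" "integrable lborel j"
        "\<And>x. 0 \<le> f x" "\<And>x. 0 \<le> j x" and [measurable]: "S \<in> sets borel" for f h j and S :: "'a set" and z
    proof -
      have "(\<lambda>y. indicator S (y + z) :: real) \<in> borel_measurable borel" by measurable
      moreover have "integrable lborel (\<lambda>y. j y * indicator S (y + z))" by (rule ind) (use that in auto)
      ultimately show ?thesis using pushes_real(2)[OF that(1,2), of "\<lambda>y. indicator S (y + z)"] that by auto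
    qed
    \<comment> \<open>The first component selects the piece coming from the second problem, the second component
      the part whose target is shifted.\<close>
    define q1 where "q1 = (\<lambda>(\<sigma>::bool, \<tau>::bool) x.
      if \<sigma> then (if \<tau> then b x / 2 else w x / 2 - b x / 2) else (if \<tau> then a x / 2 else r1 x - u x / 2 - a x / 2))"
    define S1 where "S1 = (\<lambda>(\<sigma>::bool, \<tau>::bool) x.
      if \<sigma> then (if \<tau> then T2 x + (- v) else T2 x + 0) else (if \<tau> then T1 x + v else T1 x + 0))"
    define V1 where "V1 = (LBINT x. (norm x)\<^sup>2 * (r1 x + s x / 2)) + (LBINT y. (norm y)\<^sup>2 * r01 y)
       - 2 * (\<Sum>l\<in>UNIV. LBINT x. q1 l x * (x \<bullet> S1 l x))"
    have W1: "W2_sq (density lborel (\<lambda>x. r1 x + s x / 2)) (density lborel r01) \<le> ennreal V1 \<and> 0 \<le> V1"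
    proof (rule W2_sq_le_labelled_density[of q1 S1])
      show "q1 l \<in> borel_measurable borel" for l unfolding q1_def by (cases l) auto
      show "0 \<le> q1 l x" for l x
        using a[of x] b[of x] u[of x] w[of x] unfolding q1_def by (cases l) auto
      show "integrable lborel (q1 l)" for l
        using ai bi ui wi i(1) unfolding q1_def by (cases l; cases "fst l"; cases "snd l") auto
      show "S1 l \<in> borel_measurable borel" for l unfolding S1_def by (cases l) auto
      show "(\<lambda>x. r1 x + s x / 2) \<in> borel_measurable borel" unfolding s_def by measurable
      show "AE x in lborel. r1 x + s x / 2 = (\<Sum>l\<in>UNIV. q1 l x)"
        by (intro AE_I2) (simp add: sum_UNIV_bool_prod q1_def s_def field_simps)
      show "integrable lborel (\<lambda>x. r1 x + s x / 2)" using i si by simp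
      show "integrable lborel (\<lambda>x. (norm x)\<^sup>2 * (r1 x + s x / 2))"
        using m2 um2 wm2 by (simp add: s_def distrib_left right_diff_distrib diff_divide_distrib)
      fix S :: "'a set" assume S[measurable]: "S \<in> sets borel"
      have I: "integrable lborel (\<lambda>x. r1 x * indicator S (T1 x + 0))" "integrable lborel (\<lambda>x. u x * indicator S (T1 x + 0))"
        "integrable lborel (\<lambda>x. a x * indicator S (T1 x + 0))" "integrable lborel (\<lambda>x. w x * indicator S (T2 x + 0))"
        "integrable lborel (\<lambda>x. b x * indicator S (T2 x + 0))"
        by (rule ind; use i ui ai wi bi nn u a w b in simp)+
      have E: "(LBINT x. r1 x * indicator S (T1 x + 0)) = (LBINT y. r01 y * indicator S (y + 0))"
        "(LBINT x. u x * indicator S (T1 x + 0)) = (LBINT y. n y * indicator S (y + 0))"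
        "(LBINT x. a x * indicator S (T1 x + 0)) = (LBINT y. k y * indicator S (y + 0))"
        "(LBINT x. a x * indicator S (T1 x + v)) = (LBINT y. k y * indicator S (y + v))"
        "(LBINT x. w x * indicator S (T2 x + 0)) = (LBINT y. n y * indicator S (y + 0))"
        "(LBINT x. b x * indicator S (T2 x + 0)) = (LBINT y. k (y - v) * indicator S (y + 0))"
        "(LBINT x. b x * indicator S (T2 x + - v)) = (LBINT y. k (y - v) * indicator S (y + - v))"
        using push_ind[OF p1 T(1) i(1,3) nn(1,3) S] push_ind[OF pu' T(1) ui ni u(1) n(1) S]
          push_ind[OF pa T(1) ai ki a(1) k(1) S] push_ind[OF pw T(2) wi ni w(1) n(1) S]
          push_ind[OF pb T(2) bi kvi b(1) k(1) S] by blast+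
      \<comment> \<open>After the trade the part of \<open>a\<close> reaches the translate of
        \<open>k\<close> and the part of \<open>b\<close> reaches \<open>k\<close> itself, so the
        second marginal is unchanged.\<close>
      have Kv: "(LBINT y. k (y - v) * indicator S (y + 0)) = (LBINT y. k y * indicator S (y + v))"
        using lborel_integral_shift(1)[of "\<lambda>y. k y * indicator S (y + v)" "- v"] by simp
      have K0: "(LBINT y. k (y - v) * indicator S (y + - v)) = (LBINT y. k y * indicator S (y + 0))"
        using lborel_integral_shift(1)[of "\<lambda>y. k y * indicator S y" "- v"] by simp
      have "(\<Sum>l\<in>UNIV. LBINT x. q1 l x * indicator S (S1 l x))
         = (LBINT x. r1 x * indicator S (T1 x + 0) - u x * indicator S (T1 x + 0) / 2 - a x * indicator S (T1 x + 0) / 2)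
         + (LBINT x. a x * indicator S (T1 x + v) / 2)
         + (LBINT x. w x * indicator S (T2 x + 0) / 2 - b x * indicator S (T2 x + 0) / 2)
         + (LBINT x. b x * indicator S (T2 x + - v) / 2)"
        unfolding sum_UNIV_bool_prod by (simp add: q1_def S1_def left_diff_distrib)
      also have "\<dots> = (LBINT y. r01 y * indicator S (y + 0))"
        using I by (simp add: E[simplified] Kv[simplified] K0[simplified])
      finally show "(\<Sum>l\<in>UNIV. LBINT x. q1 l x * indicator S (S1 l x)) = (LBINT y. r01 y * indicator S y)" by simp
    qed (use i nn m2 V1_def in auto)
    \<comment> \<open>The second problem only receives the half of \<open>u\<close> in return for
      the half of \<open>w\<close>; no targets are traded in it.\<close>
    define q2 where "q2 = (\<lambda>\<sigma> x. if \<sigma> then u x / 2 else r2 x - w x / 2)"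
    define S2 where "S2 = (\<lambda>\<sigma> x. if \<sigma> then T1 x else T2 x)"
    define V2 where "V2 = (LBINT x. (norm x)\<^sup>2 * (r2 x - s x / 2)) + (LBINT y. (norm y)\<^sup>2 * r02 y)
       - 2 * (\<Sum>l\<in>UNIV. LBINT x. q2 l x * (x \<bullet> S2 l x))"
    have W2: "W2_sq (density lborel (\<lambda>x. r2 x - s x / 2)) (density lborel r02) \<le> ennreal V2 \<and> 0 \<le> V2"
    proof (rule W2_sq_le_labelled_density[of q2 S2])
      show "q2 l \<in> borel_measurable borel" for l unfolding q2_def by (cases l) auto
      show "0 \<le> q2 l x" for l x
        using u[of x] w[of x] unfolding q2_def by (cases l) auto
      show "integrable lborel (q2 l)" for l
        using ui wi i(2) unfolding q2_def by (cases l) auto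
      show "S2 l \<in> borel_measurable borel" for l unfolding S2_def by (cases l) auto
      show "(\<lambda>x. r2 x - s x / 2) \<in> borel_measurable borel" unfolding s_def by measurable
      show "AE x in lborel. r2 x - s x / 2 = (\<Sum>l\<in>UNIV. q2 l x)"
        by (intro AE_I2) (simp add: UNIV_bool q2_def s_def field_simps)
      show "integrable lborel (\<lambda>x. r2 x - s x / 2)" using i si by simp
      show "integrable lborel (\<lambda>x. (norm x)\<^sup>2 * (r2 x - s x / 2))"
        using m2 um2 wm2 by (simp add: s_def right_diff_distrib diff_divide_distrib)
      fix S :: "'a set" assume S[measurable]: "S \<in> sets borel"
      have I: "integrable lborel (\<lambda>x. r2 x * indicator S (T2 x + 0))" "integrable lborel (\<lambda>x. w x * indicator S (T2 x + 0))"
        by (rule ind; use i ui wi nn u w in simp)+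
      have E: "(LBINT x. r2 x * indicator S (T2 x + 0)) = (LBINT y. r02 y * indicator S (y + 0))"
        "(LBINT x. u x * indicator S (T1 x + 0)) = (LBINT y. n y * indicator S (y + 0))"
        "(LBINT x. w x * indicator S (T2 x + 0)) = (LBINT y. n y * indicator S (y + 0))"
        using push_ind[OF p2 T(2) i(2,4) nn(2) nn02 S] push_ind[OF pu' T(1) ui ni u(1) n(1) S]
          push_ind[OF pw T(2) wi ni w(1) n(1) S] by blast+
      have "(\<Sum>l\<in>UNIV. LBINT x. q2 l x * indicator S (S2 l x))
         = (LBINT x. r2 x * indicator S (T2 x + 0) - w x * indicator S (T2 x + 0) / 2)
         + (LBINT x. u x * indicator S (T1 x + 0) / 2)"
        by (simp add: UNIV_bool q2_def S2_def left_diff_distrib)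
      also have "\<dots> = (LBINT y. r02 y * indicator S (y + 0))"
        using I by (simp add: E[simplified])
      finally show "(\<Sum>l\<in>UNIV. LBINT x. q2 l x * indicator S (S2 l x)) = (LBINT y. r02 y * indicator S y)" by simp
    qed (use i nn02 m2 V2_def in auto)
    have C1: "(\<Sum>l\<in>UNIV. LBINT x. q1 l x * (x \<bullet> S1 l x))
       = (LBINT x. r1 x * (x \<bullet> T1 x) - u x * (x \<bullet> T1 x) / 2 - a x * (x \<bullet> T1 x) / 2)
       + (LBINT x. a x * (x \<bullet> T1 x) / 2 + a x * (x \<bullet> v) / 2)
       + (LBINT x. w x * (x \<bullet> T2 x) / 2 - b x * (x \<bullet> T2 x) / 2)
       + (LBINT x. b x * (x \<bullet> T2 x) / 2 - b x * (x \<bullet> v) / 2)"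
      unfolding sum_UNIV_bool_prod
      by (simp add: q1_def S1_def left_diff_distrib inner_add_right inner_diff_right distrib_left right_diff_distrib add_divide_distrib diff_divide_distrib)
    have C2: "(\<Sum>l\<in>UNIV. LBINT x. q2 l x * (x \<bullet> S2 l x))
       = (LBINT x. r2 x * (x \<bullet> T2 x) - w x * (x \<bullet> T2 x) / 2) + (LBINT x. u x * (x \<bullet> T1 x) / 2)"
      by (simp add: UNIV_bool q2_def S2_def left_diff_distrib)
    have M1: "(LBINT x. (norm x)\<^sup>2 * (r1 x + s x / 2))
       = (LBINT x. (norm x)\<^sup>2 * r1 x) + (LBINT x. (norm x)\<^sup>2 * w x) / 2 - (LBINT x. (norm x)\<^sup>2 * u x) / 2"
      using m2 um2 wm2 by (simp add: s_def distrib_left right_diff_distrib diff_divide_distrib)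
    have M2: "(LBINT x. (norm x)\<^sup>2 * (r2 x - s x / 2))
       = (LBINT x. (norm x)\<^sup>2 * r2 x) - (LBINT x. (norm x)\<^sup>2 * w x) / 2 + (LBINT x. (norm x)\<^sup>2 * u x) / 2"
      using m2 um2 wm2 by (simp add: s_def right_diff_distrib diff_divide_distrib)
    have "V1 + V2 + c \<le> (LBINT x. r1 x * (norm (T1 x - x))\<^sup>2) + (LBINT x. r2 x * (norm (T2 x - x))\<^sup>2)"
      unfolding in1(2) in2(2) V1_def V2_def C1 C2 M1 M2 using c1 c2 av bv gn by simp
    then show "exchange c r1 r2 r01 r02 T1 T2"
      unfolding exchange_def
      by (intro exI[of _ s] exI[of _ V1] exI[of _ V2] conjI si s0 s_between
            W1[THEN conjunct1] W1[THEN conjunct2] W2[THEN conjunct1] W2[THEN conjunct2])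
  qed
qed

section \<open>Energies\<close>

lemma powr_convex_nonneg:
  fixes a b p t :: real
  assumes "0 \<le> a" "0 \<le> b" "1 \<le> p" "0 \<le> t" "t \<le> 1"
  shows "((1 - t) * a + t * b) powr p \<le> (1 - t) * a powr p + t * b powr p"
proof -
  \<comment> \<open>The boundary case, in which one of the two points is 0; it rests on
    \<open>u powr p \<le> u\<close> for \<open>u\<close> in the unit interval.\<close>
  have zero: "(u * x) powr p \<le> u * x powr p" if "0 \<le> u" "u \<le> 1" "0 \<le> x" for u x :: real
  proof (cases "u = 0")
    case False
    then have "u powr p \<le> u powr 1" using that assms(3) by (intro powr_mono') auto
    then show ?thesis using that False by (simp add: powr_mult mult_right_mono)
  qed simp
  consider "a = 0" | "b = 0" | "0 < a" "0 < b" using assms by linarith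
  then show ?thesis
  proof cases
    case 1 then show ?thesis using zero[of t b] assms by simp
  next
    case 2 then show ?thesis using zero[of "1 - t" a] assms by simp
  next
    case 3
    then show ?thesis using convex_onD[OF powr_convex[OF assms(3)], of t a b] assms by simp
  qed
qed

text \<open>The new values are convex combinations of \<open>a\<close> and \<open>b\<close> with
  complementary weights \<open>t\<close> and \<open>1 - t\<close>, so the two convexity inequalities
  add up to the claim.\<close>

lemma powr_sum_transfer_le:
  fixes a b p s :: real
  assumes "0 \<le> a" "0 \<le> b" "1 \<le> p" "min 0 (b - a) \<le> s" "s \<le> max 0 (b - a)"
  shows "(a + s / 2) powr p + (b - s / 2) powr p \<le> a powr p + b powr p"
proof (cases "a = b")
  case True then show ?thesis using assms by simp
next
  case False
  define t where "t = s / 2 / (b - a)"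
  have t: "0 \<le> t" "t \<le> 1"
    using assms(4,5) False by (auto simp: t_def min_def max_def field_simps split: if_splits)
  have "b - a \<noteq> 0" using False by simp
  then have s: "s / 2 = t * (b - a)" by (metis nonzero_divide_eq_eq t_def)
  have e: "a + s / 2 = (1 - t) * a + t * b" "b - s / 2 = (1 - (1 - t)) * a + (1 - t) * b"
    unfolding s by (simp_all add: algebra_simps)
  have "(a + s / 2) powr p + (b - s / 2) powr p
      \<le> ((1 - t) * a powr p + t * b powr p) + ((1 - (1 - t)) * a powr p + (1 - t) * b powr p)"
    unfolding e using t by (intro add_mono powr_convex_nonneg assms(1,2,3)) auto
  also have "\<dots> = a powr p + b powr p" by (simp add: algebra_simps)
  finally show ?thesis .
qed

lemma C2_continuous: "C2 f \<Longrightarrow> continuous_on UNIV f"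
  unfolding C2_def by (intro continuous_at_imp_continuous_on ballI differentiable_imp_continuous_within) auto

text \<open>Taylor's formula along the segment from 0 to \<open>x\<close>, by the mean value theorem
  for \<open>\<Phi>\<close> and then for its directional derivative. It makes the negative part of
  \<open>\<Phi>\<close> integrable against every measure in \<open>P2\<close>.\<close>

lemma hessian_lower_bound:
  fixes \<Phi> :: "'a::euclidean_space \<Rightarrow> real"
  assumes C2: "C2 \<Phi>" and H: "hessian_bounded_below \<Phi> lam"
  obtains K where "0 \<le> K" "\<And>x. - \<Phi> x \<le> K * (1 + (norm x)\<^sup>2)"
proof -
  define D where "D x v = frechet_derivative \<Phi> (at x) v" for x v
  have d1: "(\<Phi> has_derivative D x) (at x)" for x
    using C2 unfolding C2_def D_def by (subst frechet_derivative_works[symmetric]) (auto simp: eta_contract_eq)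
  have d2: "((\<lambda>y. D y v) has_derivative D2 \<Phi> x v) (at x)" for x v
    using C2 frechet_derivative_works[of "\<lambda>y. frechet_derivative \<Phi> (at y) v" "at x"]
    unfolding C2_def D_def D2_def[abs_def] by auto
  obtain B where B: "\<And>x. norm (D 0 x) \<le> norm x * B" "0 < B"
    using bounded_linear.pos_bounded[OF has_derivative_bounded_linear[OF d1[of 0]]] by blast
  have main: "\<Phi> 0 - norm x * B - \<bar>lam\<bar> * (norm x)\<^sup>2 \<le> \<Phi> x" for x
  proof -
    have g1: "((\<lambda>t. \<Phi> (t *\<^sub>R x)) has_field_derivative D (t *\<^sub>R x) x) (at t)" for t
    proof -
      have "((\<lambda>t. \<Phi> (t *\<^sub>R x)) has_derivative (\<lambda>h. D (t *\<^sub>R x) (h *\<^sub>R x))) (at t)"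
        by (rule has_derivative_compose[OF _ d1]) (auto intro!: derivative_eq_intros)
      moreover have "D (t *\<^sub>R x) (h *\<^sub>R x) = h * D (t *\<^sub>R x) x" for h
        using linear_scale[OF bounded_linear.linear[OF has_derivative_bounded_linear[OF d1[of "t *\<^sub>R x"]]]] by simp
      ultimately show ?thesis by (simp add: has_field_derivative_def mult.commute[of _ "D (t *\<^sub>R x) x"] mult_commute_abs)
    qed
    have g2: "((\<lambda>t. D (t *\<^sub>R x) x) has_field_derivative D2 \<Phi> (t *\<^sub>R x) x x) (at t)" for t
    proof -
      have "((\<lambda>t. D (t *\<^sub>R x) x) has_derivative (\<lambda>h. D2 \<Phi> (t *\<^sub>R x) x (h *\<^sub>R x))) (at t)"
        by (rule has_derivative_compose[OF _ d2]) (auto intro!: derivative_eq_intros)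
      moreover have "D2 \<Phi> (t *\<^sub>R x) x (h *\<^sub>R x) = h * D2 \<Phi> (t *\<^sub>R x) x x" for h
        using linear_scale[OF bounded_linear.linear[OF has_derivative_bounded_linear[OF d2[of x "t *\<^sub>R x"]]]] by simp
      ultimately show ?thesis by (simp add: has_field_derivative_def mult.commute[of _ "D2 \<Phi> (t *\<^sub>R x) x x"] mult_commute_abs)
    qed
    obtain z where z: "0 < z" "z < 1" "\<Phi> (1 *\<^sub>R x) - \<Phi> (0 *\<^sub>R x) = (1 - 0) * D (z *\<^sub>R x) x"
      using MVT2[of 0 1 "\<lambda>t. \<Phi> (t *\<^sub>R x)" "\<lambda>t. D (t *\<^sub>R x) x"] g1 by auto
    obtain y where y: "0 < y" "y < z" "D (z *\<^sub>R x) x - D (0 *\<^sub>R x) x = (z - 0) * D2 \<Phi> (y *\<^sub>R x) x x"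
      using MVT2[of 0 z "\<lambda>t. D (t *\<^sub>R x) x" "\<lambda>t. D2 \<Phi> (t *\<^sub>R x) x x"] g2 z by auto
    have "lam * (x \<bullet> x) \<le> D2 \<Phi> (y *\<^sub>R x) x x" using H by (auto simp: hessian_bounded_below_def)
    then have "z * (lam * (x \<bullet> x)) \<le> z * D2 \<Phi> (y *\<^sub>R x) x x" using z by (intro mult_left_mono) auto
    moreover have "- (1 * (\<bar>lam\<bar> * (x \<bullet> x))) \<le> z * (lam * (x \<bullet> x))"
    proof -
      have "\<bar>z * (lam * (x \<bullet> x))\<bar> \<le> 1 * (\<bar>lam\<bar> * (x \<bullet> x))"
        unfolding abs_mult using z by (intro mult_mono) auto
      then show ?thesis by linarith
    qed
    moreover have "D (z *\<^sub>R x) x - D 0 x = z * D2 \<Phi> (y *\<^sub>R x) x x" using y(3) by simp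
    ultimately have "- (\<bar>lam\<bar> * (x \<bullet> x)) \<le> D (z *\<^sub>R x) x - D 0 x" by linarith
    moreover have "- (norm x * B) \<le> D 0 x" using B(1)[of x] by simp
    ultimately show ?thesis using z by (simp add: power2_norm_eq_inner)
  qed
  show thesis
  proof (rule that[of "\<bar>\<Phi> 0\<bar> + B + \<bar>lam\<bar>"])
    show "0 \<le> \<bar>\<Phi> 0\<bar> + B + \<bar>lam\<bar>" using B by simp
    fix x :: 'a
    have "norm x \<le> 1 + (norm x)\<^sup>2" by (rule norm_le_one_plus_sq)
    then have "norm x * B \<le> B * (1 + (norm x)\<^sup>2)" using B by (subst mult.commute) (intro mult_left_mono, auto)
    moreover have "\<bar>\<Phi> 0\<bar> * 1 \<le> \<bar>\<Phi> 0\<bar> * (1 + (norm x)\<^sup>2)" by (intro mult_left_mono) auto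
    moreover have "\<bar>lam\<bar> * (norm x)\<^sup>2 \<le> \<bar>lam\<bar> * (1 + (norm x)\<^sup>2)" by (intro mult_left_mono) auto
    ultimately show "- \<Phi> x \<le> (\<bar>\<Phi> 0\<bar> + B + \<bar>lam\<bar>) * (1 + (norm x)\<^sup>2)"
      using main[of x] abs_ge_minus_self[of "\<Phi> 0"] unfolding distrib_right by linarith
  qed
qed

section \<open>Regular measures, their real densities and the internal energy\<close>

lemma P2_regular_density:
  fixes \<mu> :: "'a::euclidean_space measure"
  assumes \<mu>: "\<mu> \<in> P2 A" "regular \<mu>" and A: "0 \<le> A"
  obtains r where "r \<in> borel_measurable borel" "\<And>x. 0 \<le> r x" "\<mu> = density lborel r"
    "AE x in lborel. dens \<mu> x = ennreal (r x)"
    "integrable lborel r" "(LBINT x. r x) = A" "integrable lborel (\<lambda>x. (norm x)\<^sup>2 * r x)"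
proof -
  have s: "sets \<mu> = sets lborel" and mass: "emeasure \<mu> UNIV = ennreal A"
    and mom: "(\<integral>\<^sup>+ x. ennreal ((norm x)\<^sup>2) \<partial>\<mu>) < \<infinity>" using \<mu> by (auto simp: P2_def)
  have d: "density lborel (dens \<mu>) = \<mu>" by (rule sigma_finite_measure.density_RN_deriv[OF sigma_finite_lborel \<mu>(2) s])
  have Dm[measurable]: "dens \<mu> \<in> borel_measurable borel" using borel_measurable_RN_deriv[of lborel \<mu>] by simp
  have "(\<integral>\<^sup>+ x. dens \<mu> x \<partial>lborel) = emeasure (density lborel (dens \<mu>)) UNIV" by (simp add: emeasure_density)
  also have "\<dots> = ennreal A" unfolding d by (rule mass)
  finally have tot: "(\<integral>\<^sup>+ x. dens \<mu> x \<partial>lborel) = ennreal A" .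
  then have "AE x in lborel. dens \<mu> x \<noteq> \<infinity>" by (intro nn_integral_PInf_AE) auto
  then have ae: "AE x in lborel. dens \<mu> x = ennreal (enn2real (dens \<mu> x))" by eventually_elim (simp add: less_top)
  define r where "r x = enn2real (dens \<mu> x)" for x
  have rm[measurable]: "r \<in> borel_measurable borel" unfolding r_def by measurable
  have r0: "0 \<le> r x" for x by (simp add: r_def)
  have ae': "AE x in lborel. dens \<mu> x = ennreal (r x)" using ae by (simp add: r_def)
  have "density lborel r = density lborel (dens \<mu>)"
    using ae' by (intro density_cong) (auto elim: eventually_mono)
  then have dr: "density lborel r = \<mu>" using d by (rule trans)
  have t: "(\<integral>\<^sup>+ x. ennreal (r x) \<partial>lborel) = ennreal A" unfolding tot[symmetric]
    using ae' by (intro nn_integral_cong_AE) auto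
  have ri: "integrable lborel r" by (rule integrableI_nonneg) (auto simp: t r0)
  have "(LBINT x. r x) = A" using A by (subst integral_eq_nn_integral) (auto simp: r0 t)
  moreover have "integrable lborel (\<lambda>x. (norm x)\<^sup>2 * r x)"
  proof (rule integrableI_nonneg)
    have "(\<integral>\<^sup>+ x. ennreal ((norm x)\<^sup>2 * r x) \<partial>lborel) = (\<integral>\<^sup>+ x. ennreal ((norm x)\<^sup>2) \<partial>density lborel r)"
      by (subst nn_integral_density) (auto simp: ennreal_mult' r0 mult.commute)
    then show "(\<integral>\<^sup>+ x. ennreal ((norm x)\<^sup>2 * r x) \<partial>lborel) < \<infinity>" unfolding dr using mom by simp
  qed (auto simp: r0)
  ultimately show thesis using that[of r] rm r0 dr ae' ri by auto
qed

lemma density_in_P2: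
  fixes r :: "'a::euclidean_space \<Rightarrow> real"
  assumes r: "integrable lborel r" "AE x in lborel. 0 \<le> r x" "integrable lborel (\<lambda>x. (norm x)\<^sup>2 * r x)"
  shows "density lborel r \<in> P2 (LBINT x. r x)" "regular (density lborel r)"
    "AE x in lborel. dens (density lborel r) x = ennreal (r x)"
proof -
  have [measurable]: "r \<in> borel_measurable borel" using r by auto
  have "(\<integral>\<^sup>+ x. ennreal ((norm x)\<^sup>2) \<partial>density lborel r) = (\<integral>\<^sup>+ x. ennreal ((norm x)\<^sup>2 * r x) \<partial>lborel)"
    using r(2) by (subst nn_integral_density) (auto intro!: nn_integral_cong_AE elim!: eventually_mono simp: ennreal_mult' mult.commute)
  also have "\<dots> = ennreal (LBINT x. (norm x)\<^sup>2 * r x)"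
    using r by (intro nn_integral_eq_integral) (auto elim: eventually_mono)
  finally show "density lborel r \<in> P2 (LBINT x. r x)"
    using r by (simp add: P2_def emeasure_density nn_integral_eq_integral)
  show "regular (density lborel r)" by (rule absolutely_continuousI_density) simp
  show "AE x in lborel. dens (density lborel r) x = ennreal (r x)"
    using sigma_finite_measure.RN_deriv_unique[OF sigma_finite_lborel, of "\<lambda>x. ennreal (r x)" "density lborel r"]
    by (auto elim: eventually_mono)
qed

lemma internal_energy_infinity:
  assumes "regular \<mu>" "AE x in lborel. dens \<mu> x = ennreal (r x)"
  shows "internal_energy \<infinity> \<mu> = (if AE x in lborel. r x \<le> 1 then 0 else \<infinity>)"
proof -
  have [measurable]: "dens \<mu> \<in> borel_measurable lborel" by simp
  have "esssup lborel (dens \<mu>) \<le> 1 \<longleftrightarrow> (AE x in lborel. dens \<mu> x \<le> 1)"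
    using esssup_AE[of "dens \<mu>" lborel] by (auto intro!: esssup_I elim: eventually_mono order_trans)
  also have "\<dots> \<longleftrightarrow> (AE x in lborel. r x \<le> 1)"
    using assms(2) by (intro eventually_subst) (auto elim!: eventually_mono)
  finally show ?thesis using assms by (simp add: internal_energy_def)
qed

lemma internal_energy_finite:
  assumes "regular \<mu>" "AE x in lborel. dens \<mu> x = ennreal (r x)" "\<And>x. 0 \<le> r x"
  shows "internal_energy (ereal p) \<mu> = enn2ereal (\<integral>\<^sup>+ x. ennreal (1 / p * r x powr p) \<partial>lborel)"
  using assms by (auto simp: internal_energy_def intro!: arg_cong[where f=enn2ereal] nn_integral_cong_AE elim!: eventually_mono)

lemma internal_energy_nonneg: "0 \<le> internal_energy m \<mu>"
  by (simp add: internal_energy_def)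

text \<open>For finite \<open>m\<close> this is \<open>powr_sum_transfer_le\<close> integrated; for
  \<open>m = \<infinity>\<close> the bound by 1 is inherited because the new densities lie pointwise
  between the old ones. The hypothesis \<open>\<mu>\<close> identifies \<open>dens\<close> for all
  four measures at once.\<close>

lemma internal_energy_transfer_le:
  fixes r1 r2 s :: "'a::euclidean_space \<Rightarrow> real"
  assumes m: "1 \<le> m"
    and i: "integrable lborel r1" "integrable lborel r2" "integrable lborel s"
    and r: "\<And>x. 0 \<le> r1 x" "\<And>x. 0 \<le> r2 x"
    and s: "\<And>x. min 0 (r2 x - r1 x) \<le> s x \<and> s x \<le> max 0 (r2 x - r1 x)"
    and \<mu>: "\<And>\<mu> f. \<mu> = density lborel f \<Longrightarrow> f \<in> {r1, r2, \<lambda>x. r1 x + s x / 2, \<lambda>x. r2 x - s x / 2} \<Longrightarrow>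
       AE x in lborel. dens \<mu> x = ennreal (f x)"
  shows "internal_energy m (density lborel (\<lambda>x. r1 x + s x / 2)) + internal_energy m (density lborel (\<lambda>x. r2 x - s x / 2))
    \<le> internal_energy m (density lborel r1) + internal_energy m (density lborel r2)"
proof -
  have [measurable]: "r1 \<in> borel_measurable borel" "r2 \<in> borel_measurable borel" "s \<in> borel_measurable borel"
    using i by auto
  have reg: "regular (density lborel f)" if [measurable]: "f \<in> borel_measurable borel" for f :: "'a \<Rightarrow> real"
    by (rule absolutely_continuousI_density) simp
  have bd: "0 \<le> r1 x + s x / 2" "0 \<le> r2 x - s x / 2" "r1 x + s x / 2 \<le> max (r1 x) (r2 x)" "r2 x - s x / 2 \<le> max (r1 x) (r2 x)" for x
    using s[of x] r(1)[of x] r(2)[of x] by (auto simp: min_def max_def split: if_splits)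
  show ?thesis
  proof (cases m)
    case (real p)
    then have p: "1 \<le> p" using m by simp
    have F: "internal_energy m (density lborel f) = enn2ereal (\<integral>\<^sup>+ x. ennreal (1 / p * f x powr p) \<partial>lborel)"
      if "f \<in> {r1, r2, \<lambda>x. r1 x + s x / 2, \<lambda>x. r2 x - s x / 2}" for f
      unfolding real using that r bd
      by (intro internal_energy_finite reg \<mu>[OF refl that]) auto
    have "(\<integral>\<^sup>+ x. ennreal (1 / p * (r1 x + s x / 2) powr p) \<partial>lborel) + (\<integral>\<^sup>+ x. ennreal (1 / p * (r2 x - s x / 2) powr p) \<partial>lborel)
      = (\<integral>\<^sup>+ x. ennreal (1 / p * (r1 x + s x / 2) powr p) + ennreal (1 / p * (r2 x - s x / 2) powr p) \<partial>lborel)"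
      by (subst nn_integral_add) auto
    also have "\<dots> \<le> (\<integral>\<^sup>+ x. ennreal (1 / p * r1 x powr p) + ennreal (1 / p * r2 x powr p) \<partial>lborel)"
    proof (rule nn_integral_mono)
      fix x
      have "1 / p * ((r1 x + s x / 2) powr p + (r2 x - s x / 2) powr p) \<le> 1 / p * (r1 x powr p + r2 x powr p)"
        using p powr_sum_transfer_le[OF r(1)[of x] r(2)[of x] p, of "s x"] s[of x] by (intro mult_left_mono) auto
      then show "ennreal (1 / p * (r1 x + s x / 2) powr p) + ennreal (1 / p * (r2 x - s x / 2) powr p)
         \<le> ennreal (1 / p * r1 x powr p) + ennreal (1 / p * r2 x powr p)"
        using p by (simp add: ennreal_plus[symmetric] distrib_left del: ennreal_plus)
    qed
    also have "\<dots> = (\<integral>\<^sup>+ x. ennreal (1 / p * r1 x powr p) \<partial>lborel) + (\<integral>\<^sup>+ x. ennreal (1 / p * r2 x powr p) \<partial>lborel)"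
      by (subst nn_integral_add) auto
    finally show ?thesis
      by (simp add: F plus_ennreal.rep_eq[symmetric] less_eq_ennreal.rep_eq[symmetric])
  next
    case PInf
    have F: "internal_energy m (density lborel f) = (if AE x in lborel. f x \<le> 1 then 0 else \<infinity>)"
      if "f \<in> {r1, r2, \<lambda>x. r1 x + s x / 2, \<lambda>x. r2 x - s x / 2}" for f
      unfolding PInf using that by (intro internal_energy_infinity reg \<mu>[OF refl that]) auto
    show ?thesis
    proof (cases "(AE x in lborel. r1 x \<le> 1) \<and> (AE x in lborel. r2 x \<le> 1)")
      case True
      then have "AE x in lborel. r1 x \<le> 1 \<and> r2 x \<le> 1" by auto
      then have "AE x in lborel. r1 x + s x / 2 \<le> 1" "AE x in lborel. r2 x - s x / 2 \<le> 1"
        by (eventually_elim, use bd in \<open>meson max.bounded_iff order_trans\<close>)+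
      then show ?thesis using True by (simp add: F)
    next
      case False
      then have top: "internal_energy m (density lborel r1) + internal_energy m (density lborel r2) = \<infinity>" by (auto simp: F)
      show ?thesis unfolding top by simp
    qed
  next
    case MInf
    then show ?thesis using m by simp
  qed
qed

section \<open>The comparison principle\<close>

lemma integrable_neg_part:
  fixes \<Phi> :: "'a::euclidean_space \<Rightarrow> real"
  assumes \<mu>: "\<mu> \<in> P2 A" and K: "0 \<le> K" "\<And>x. - \<Phi> x \<le> K * (1 + (norm x)\<^sup>2)"
  shows "(\<integral>\<^sup>+ x. ennreal (- \<Phi> x) \<partial>\<mu>) < \<infinity>"
proof -
  have s: "sets \<mu> = sets borel" and mass: "emeasure \<mu> UNIV = ennreal A"
    and mom: "(\<integral>\<^sup>+ x. ennreal ((norm x)\<^sup>2) \<partial>\<mu>) < \<infinity>" using \<mu> by (auto simp: P2_def)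
  have [measurable_cong]: "sets \<mu> = sets borel" by fact
  have sp: "space \<mu> = UNIV" using sets_eq_imp_space_eq[OF s] by simp
  have "(\<integral>\<^sup>+ x. ennreal (- \<Phi> x) \<partial>\<mu>) \<le> (\<integral>\<^sup>+ x. ennreal K * (1 + ennreal ((norm x)\<^sup>2)) \<partial>\<mu>)"
  proof (rule nn_integral_mono)
    fix x
    have "ennreal (- \<Phi> x) \<le> ennreal (K * (1 + (norm x)\<^sup>2))" by (intro ennreal_leI K)
    also have "\<dots> = ennreal K * (1 + ennreal ((norm x)\<^sup>2))" using K(1) by (simp add: ennreal_mult)
    finally show "ennreal (- \<Phi> x) \<le> ennreal K * (1 + ennreal ((norm x)\<^sup>2))" .
  qed
  also have "\<dots> = ennreal K * (emeasure \<mu> UNIV + (\<integral>\<^sup>+ x. ennreal ((norm x)\<^sup>2) \<partial>\<mu>))"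
    by (simp add: nn_integral_cmult nn_integral_add sp)
  also have "\<dots> < \<infinity>" using mass mom by (simp add: ennreal_mult_less_top)
  finally show ?thesis .
qed

lemma potential_energy_eq:
  assumes "integrable \<mu> f"
  shows "potential_energy f \<mu> = ereal (LINT x|\<mu>. f x)"
proof -
  have "(\<integral>\<^sup>+ x. ennreal (f x) \<partial>\<mu>) < \<infinity>" "(\<integral>\<^sup>+ x. ennreal (- f x) \<partial>\<mu>) < \<infinity>"
    using assms by (auto simp: real_integrable_def less_top)
  then obtain a b where ab: "0 \<le> a" "(\<integral>\<^sup>+ x. ennreal (f x) \<partial>\<mu>) = ennreal a" "0 \<le> b" "(\<integral>\<^sup>+ x. ennreal (- f x) \<partial>\<mu>) = ennreal b"
    by (metis less_top_ennreal infinity_ennreal_def)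
  then show ?thesis using assms
    by (simp add: potential_energy_def real_lebesgue_integral_def)
qed

text \<open>For a competitor an upper bound of the functional is enough, so the cost
  \<open>V\<close> of any plan may take the place of the squared distance.\<close>

lemma JKO_value:
  assumes "integrable \<mu> \<Phi>" "internal_energy m \<mu> = ereal I" "W2_sq \<mu> \<mu>0 \<le> ennreal V" "0 \<le> V" "0 < h"
  shows "JKO_functional m \<Phi> h \<mu>0 \<mu> \<le> ereal (I + (LINT x|\<mu>. \<Phi> x) + V / (2 * h))"
proof -
  have "enn2ereal (W2_sq \<mu> \<mu>0) \<le> ereal V"
    using assms(3,4) by (metis enn2ereal_ennreal less_eq_ennreal.rep_eq)
  then have "ereal (1 / (2 * h)) * enn2ereal (W2_sq \<mu> \<mu>0) \<le> ereal (1 / (2 * h)) * ereal V"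
    using assms(5) by (intro ereal_mult_left_mono) auto
  then have "ereal (I + (LINT x|\<mu>. \<Phi> x)) + ereal (1 / (2 * h)) * enn2ereal (W2_sq \<mu> \<mu>0) \<le> ereal (I + (LINT x|\<mu>. \<Phi> x)) + ereal (1 / (2 * h)) * ereal V"
    by (intro add_left_mono)
  then show ?thesis
    by (simp add: JKO_functional_def energy_def assms potential_energy_eq)
qed

text \<open>The internal energy and the transport term are nonnegative and the potential energy is
  not minus infinity, so a finite sum makes each term finite. In particular the measure is
  regular.\<close>

lemma JKO_finite:
  fixes \<Phi> :: "'a::euclidean_space \<Rightarrow> real"
  assumes \<mu>: "\<mu> \<in> P2 A" and \<Phi>: "\<Phi> \<in> borel_measurable borel"
    and K: "0 \<le> K" "\<And>x. - \<Phi> x \<le> K * (1 + (norm x)\<^sup>2)" and h: "0 < h"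
    and fin: "JKO_functional m \<Phi> h \<mu>0 \<mu> < \<infinity>"
  obtains I W where "regular \<mu>" "integrable \<mu> \<Phi>" "0 \<le> I" "0 \<le> W" "internal_energy m \<mu> = ereal I"
    "W2_sq \<mu> \<mu>0 = ennreal W" "JKO_functional m \<Phi> h \<mu>0 \<mu> = ereal (I + (LINT x|\<mu>. \<Phi> x) + W / (2 * h))"
proof -
  have neg: "(\<integral>\<^sup>+ x. ennreal (- \<Phi> x) \<partial>\<mu>) < \<infinity>" by (rule integrable_neg_part[OF \<mu> K])
  then obtain b where b: "0 \<le> b" "(\<integral>\<^sup>+ x. ennreal (- \<Phi> x) \<partial>\<mu>) = ennreal b"
    by (metis less_top_ennreal infinity_ennreal_def)
  define P where "P = potential_energy \<Phi> \<mu>"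
  define E where "E = internal_energy m \<mu>"
  define w where "w = ereal (1 / (2 * h)) * enn2ereal (W2_sq \<mu> \<mu>0)"
  have P: "P = enn2ereal (\<integral>\<^sup>+ x. ennreal (\<Phi> x) \<partial>\<mu>) - ereal b" using b by (simp add: P_def potential_energy_def)
  have "- ereal b \<le> P" unfolding P minus_ereal_def using b
    by (metis add.commute add_0 add_left_mono enn2ereal_nonneg)
  then have P1: "P \<noteq> -\<infinity>" by auto
  have E0: "0 \<le> E" unfolding E_def by (rule internal_energy_nonneg)
  have w0: "0 \<le> w" unfolding w_def using h by simp
  have sum: "E + P + w < \<infinity>" using fin by (simp add: JKO_functional_def energy_def E_def P_def w_def)
  have Ef: "E \<noteq> \<infinity>" and Pf: "P \<noteq> \<infinity>" and wf: "w \<noteq> \<infinity>"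
    using sum P1 E0 w0 by auto
  have reg: "regular \<mu>" using Ef by (auto simp: E_def internal_energy_def split: if_splits)
  have "(\<integral>\<^sup>+ x. ennreal (\<Phi> x) \<partial>\<mu>) \<noteq> \<infinity>" using Pf P b by auto
  moreover have "\<Phi> \<in> borel_measurable \<mu>" using \<Phi> \<mu> by (simp add: P2_def measurable_cong_sets[of \<mu> borel])
  ultimately have int: "integrable \<mu> \<Phi>" using neg by (auto simp: real_integrable_def)
  obtain I where I: "E = ereal I" "0 \<le> I" using Ef E0 by (cases E) auto
  have "W2_sq \<mu> \<mu>0 \<noteq> \<infinity>" using wf h by (auto simp: w_def)
  then obtain W where W: "W2_sq \<mu> \<mu>0 = ennreal W" "0 \<le> W" by (cases "W2_sq \<mu> \<mu>0") auto
  have "JKO_functional m \<Phi> h \<mu>0 \<mu> = ereal (I + (LINT x|\<mu>. \<Phi> x) + W / (2 * h))"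
    using I W by (simp add: JKO_functional_def energy_def potential_energy_eq[OF int] E_def)
  then show thesis using that[OF reg int I(2) W(2) I(1)[unfolded E_def] W(1)] by blast
qed

lemma W2_sq_finite:
  fixes \<mu> \<nu> :: "'a::euclidean_space measure"
  assumes \<mu>: "\<mu> \<in> P2 A" "regular \<mu>" and \<nu>: "\<nu> \<in> P2 A"
  shows "W2_sq \<mu> \<nu> < \<infinity>"
proof -
  have s: "sets \<mu> = sets borel" "emeasure \<mu> UNIV = ennreal A" "(\<integral>\<^sup>+ x. ennreal ((norm x)\<^sup>2) \<partial>\<mu>) < \<infinity>"
    "sets \<nu> = sets borel" "emeasure \<nu> UNIV = ennreal A" "(\<integral>\<^sup>+ x. ennreal ((norm x)\<^sup>2) \<partial>\<nu>) < \<infinity>"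
    using \<mu> \<nu> by (auto simp: P2_def)
  have [measurable_cong]: "sets \<mu> = sets borel" by fact
  obtain T where T[measurable]: "T \<in> borel_measurable borel" and d: "distr \<mu> borel T = \<nu>"
    using transport_map_exists[OF s(1) \<mu>(2) s(2,4,5)] by blast
  have "T \<in> transport_maps \<mu> \<nu>" by (simp add: transport_maps_def d)
  then have "W2_sq \<mu> \<nu> \<le> (\<integral>\<^sup>+ x. ennreal ((norm (T x - x))\<^sup>2) \<partial>\<mu>)"
    unfolding W2_sq_def by (rule INF_lower)
  also have "\<dots> \<le> (\<integral>\<^sup>+ x. 2 * ennreal ((norm (T x))\<^sup>2) + 2 * ennreal ((norm x)\<^sup>2) \<partial>\<mu>)"
  proof (rule nn_integral_mono)
    fix x
    have "(norm (T x - x))\<^sup>2 \<le> 2 * (norm (T x))\<^sup>2 + 2 * (norm x)\<^sup>2"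
      using norm_add_sq_le[of 1 "T x" "- x"] by simp
    then have "ennreal ((norm (T x - x))\<^sup>2) \<le> ennreal (2 * (norm (T x))\<^sup>2 + 2 * (norm x)\<^sup>2)" by (rule ennreal_leI)
    then show "ennreal ((norm (T x - x))\<^sup>2) \<le> 2 * ennreal ((norm (T x))\<^sup>2) + 2 * ennreal ((norm x)\<^sup>2)"
      by (simp add: ennreal_mult)
  qed
  also have "\<dots> = 2 * (\<integral>\<^sup>+ x. ennreal ((norm (T x))\<^sup>2) \<partial>\<mu>) + 2 * (\<integral>\<^sup>+ x. ennreal ((norm x)\<^sup>2) \<partial>\<mu>)"
    by (simp add: nn_integral_add nn_integral_cmult)
  also have "(\<integral>\<^sup>+ x. ennreal ((norm (T x))\<^sup>2) \<partial>\<mu>) = (\<integral>\<^sup>+ x. ennreal ((norm x)\<^sup>2) \<partial>\<nu>)"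
    unfolding d[symmetric] by (subst nn_integral_distr) auto
  also have "2 * (\<integral>\<^sup>+ x. ennreal ((norm x)\<^sup>2) \<partial>\<nu>) + 2 * (\<integral>\<^sup>+ x. ennreal ((norm x)\<^sup>2) \<partial>\<mu>) < \<infinity>"
    using s by (simp add: ennreal_mult_less_top)
  finally show ?thesis .
qed

text \<open>\<open>is_arg_min\<close> alone would admit a minimizer of infinite value; a competitor
  of finite value excludes this. A uniform density of height at most 1 on a cube meets the
  constraint for \<open>m = \<infinity>\<close> and satisfies \<open>r powr p \<le> r\<close> for
  finite exponents.\<close>

lemma JKO_finite_competitor:
  fixes \<mu>0 :: "'a::euclidean_space measure" and \<Phi> :: "'a \<Rightarrow> real"
  assumes A: "0 < A" and \<mu>0: "\<mu>0 \<in> P2 A" and \<Phi>: "continuous_on UNIV \<Phi>" and m: "1 < m" and h: "0 < h"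
  obtains \<mu> where "\<mu> \<in> P2 A" "JKO_functional m \<Phi> h \<mu>0 \<mu> < \<infinity>"
proof -
  \<comment> \<open>A side of length at least 1 makes the volume at least \<open>L\<close>, hence at
    least \<open>A\<close>, so the height \<open>A / vol\<close> is at most 1.\<close>
  define L where "L = max 1 A"
  define C where "C = cbox 0 (L *\<^sub>R One :: 'a)"
  define vol where "vol = measure lborel C"
  have [measurable]: "C \<in> sets borel" by (simp add: C_def)
  have L: "1 \<le> L" "A \<le> L" by (auto simp: L_def)
  have "vol = L ^ DIM('a)" unfolding vol_def C_def using L(1) by (subst content_cbox') (auto simp: box_ne_empty)
  moreover have "L ^ 1 \<le> L ^ DIM('a)" using L by (intro power_increasing) auto
  ultimately have vol: "A \<le> vol" "0 < vol" using L A by auto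
  define r where "r x = A / vol * indicator C x" for x
  have Ci: "integrable lborel (indicator C :: 'a \<Rightarrow> real)"
    unfolding C_def by (rule integrable_real_indicator[OF _ emeasure_lborel_cbox_finite]) simp
  have [measurable]: "r \<in> borel_measurable borel" unfolding r_def by measurable
  have r: "0 \<le> r x" "r x \<le> 1" for x using vol A by (auto simp: r_def indicator_def)
  have ri: "integrable lborel r" unfolding r_def using Ci by simp
  have rA: "(LBINT x. r x) = A" unfolding r_def using vol Ci by (simp add: vol_def)
  have bdd: "integrable lborel (\<lambda>x. f x * r x)" if f: "continuous_on UNIV f" for f :: "'a \<Rightarrow> real"
  proof -
    have [measurable]: "f \<in> borel_measurable borel" using f by (rule borel_measurable_continuous_onI)
    have "compact (f ` C)" unfolding C_def using f by (intro compact_continuous_image) (auto intro: continuous_on_subset)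
    then obtain B where B: "\<And>x. x \<in> C \<Longrightarrow> norm (f x) \<le> B" using compact_imp_bounded bounded_iff by (metis image_eqI)
    have bnd: "norm (f x * r x) \<le> norm (B * r x)" for x
    proof (cases "x \<in> C")
      case True
      then have "\<bar>f x\<bar> \<le> \<bar>B\<bar>" using B[OF True] by simp
      then show ?thesis using r(1)[of x] by (simp add: abs_mult mult_right_mono)
    qed (simp add: r_def)
    have "integrable lborel (\<lambda>x. B * r x)" using ri by simp
    then show ?thesis by (rule Bochner_Integration.integrable_bound) (use bnd in auto)
  qed
  define \<mu> where "\<mu> = density lborel r"
  have "integrable lborel (\<lambda>x. (norm x)\<^sup>2 * r x)" by (intro bdd continuous_intros)
  note P = density_in_P2[OF ri AE_I2[OF r(1)] this, folded \<mu>_def, unfolded rA]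
  have \<Phi>i: "integrable \<mu> \<Phi>"
    unfolding \<mu>_def using bdd[OF \<Phi>] borel_measurable_continuous_onI[OF \<Phi>] r
    by (subst integrable_density) (auto simp: mult.commute)
  have "internal_energy m \<mu> < \<infinity>"
  proof (cases m)
    case (real p)
    then have p: "1 < p" using m by simp
    have "(\<integral>\<^sup>+ x. ennreal (1 / p * r x powr p) \<partial>lborel) \<le> (\<integral>\<^sup>+ x. ennreal (r x) \<partial>lborel)"
    proof (intro nn_integral_mono ennreal_leI)
      fix x
      have "r x powr p \<le> r x powr 1" using r p by (intro powr_mono') auto
      then have "1 / p * r x powr p \<le> 1 * r x" using p r by (intro mult_mono) auto
      then show "1 / p * r x powr p \<le> r x" by simp
    qed
    also have "\<dots> < \<infinity>" using ri r by (simp add: nn_integral_eq_integral)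
    finally show ?thesis unfolding real internal_energy_finite[OF P(2,3) r(1)]
      by (metis enn2ereal_top infinity_ennreal_def less_ennreal.rep_eq top_ereal_def)
  next
    case PInf
    then show ?thesis using internal_energy_infinity[OF P(2,3)] r by simp
  qed (use m in simp)
  then obtain I where I: "internal_energy m \<mu> = ereal I"
    using internal_energy_nonneg[of m \<mu>] by (cases "internal_energy m \<mu>") auto
  obtain W where W: "W2_sq \<mu> \<mu>0 \<le> ennreal W" "0 \<le> W"
    using W2_sq_finite[OF P(1,2) \<mu>0] by (cases "W2_sq \<mu> \<mu>0") auto
  have "JKO_functional m \<Phi> h \<mu>0 \<mu> < \<infinity>"
    by (rule le_less_trans[OF JKO_value[OF \<Phi>i I W h]]) simp
  then show thesis using that P(1) by blast
qed

lemma near_optimal_map: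
  fixes r :: "'a::euclidean_space \<Rightarrow> real"
  assumes [measurable]: "r \<in> borel_measurable borel" and r: "\<And>x. 0 \<le> r x"
    and n: "n \<in> borel_measurable borel"
    and W: "W2_sq (density lborel r) (density lborel n) = ennreal W" "0 \<le> W" and d: "0 < d"
  obtains T where "T \<in> borel_measurable borel" "pushes T r n" "(LBINT x. r x * (norm (T x - x))\<^sup>2) \<le> W + d"
proof -
  have "W2_sq (density lborel r) (density lborel n) < ennreal (W + d)"
    using W d by (simp add: ennreal_less_iff)
  then obtain T where T: "T \<in> transport_maps (density lborel r) (density lborel n)"
    "(\<integral>\<^sup>+ x. ennreal ((norm (T x - x))\<^sup>2) \<partial>density lborel r) < ennreal (W + d)"
    unfolding W2_sq_def INF_less_iff by blast
  then have Tm[measurable]: "T \<in> borel_measurable borel" and dT: "distr (density lborel r) borel T = density lborel n"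
    by (auto simp: transport_maps_def)
  have p: "pushes T r n" by (rule pushes_distr[OF Tm _ n dT]) simp
  have "(LBINT x. r x * (norm (T x - x))\<^sup>2) \<le> W + d"
  proof -
    have "(\<integral>\<^sup>+ x. ennreal (r x * (norm (T x - x))\<^sup>2) \<partial>lborel) \<le> ennreal (W + d)"
      using T(2) by (subst (asm) nn_integral_density) (auto simp: ennreal_mult' r)
    then have "enn2real (\<integral>\<^sup>+ x. ennreal (r x * (norm (T x - x))\<^sup>2) \<partial>lborel) \<le> W + d"
      using W d by (intro enn2real_leI) auto
    then show ?thesis by (subst integral_eq_nn_integral) (auto simp: r)
  qed
  then show thesis using that Tm p by blast
qed

theorem theorem1p3:
  fixes \<Phi> :: "real ^ 'd \<Rightarrow> real"
    and lam M1 M2 h :: real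
    and m :: ereal
    and \<rho>01 \<rho>02 \<rho>1 \<rho>2 :: "(real ^ 'd) measure"
  assumes "C2 \<Phi>"
    and "hessian_bounded_below \<Phi> lam"
    and "2 < m"
    and "0 < M1" and "M1 \<le> M2"
    and "\<rho>01 \<in> P2 M1" and "regular \<rho>01"
    and "\<rho>02 \<in> P2 M2" and "regular \<rho>02"
    and "AE x in lborel. dens \<rho>01 x \<le> dens \<rho>02 x"
    and "m = \<infinity> \<Longrightarrow> esssup lborel (dens \<rho>01) \<le> 1"
    and "m = \<infinity> \<Longrightarrow> esssup lborel (dens \<rho>02) \<le> 1"
    and "0 < h"
    and "is_arg_min (JKO_functional m \<Phi> h \<rho>01) (\<lambda>\<rho>. \<rho> \<in> P2 M1) \<rho>1"
    and "is_arg_min (JKO_functional m \<Phi> h \<rho>02) (\<lambda>\<rho>. \<rho> \<in> P2 M2) \<rho>2"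
  shows "regular \<rho>1 \<and> regular \<rho>2 \<and> (AE x in lborel. dens \<rho>1 x \<le> dens \<rho>2 x)"
proof -
  note m = assms(3) and h = assms(13)
  have M: "0 < M1" "0 < M2" using assms(4,5) by auto
  have m1: "1 < m" using m by (cases m) auto
  have m1': "1 \<le> m" using m1 by simp
  have \<Phi>c: "continuous_on UNIV \<Phi>" by (rule C2_continuous[OF assms(1)])
  have \<Phi>m[measurable]: "\<Phi> \<in> borel_measurable borel" by (rule borel_measurable_continuous_onI[OF \<Phi>c])
  obtain K where K: "0 \<le> K" "\<And>x. - \<Phi> x \<le> K * (1 + (norm x)\<^sup>2)"
    using hessian_lower_bound[OF assms(1,2)] by blast
  have P1: "\<rho>1 \<in> P2 M1" and P2: "\<rho>2 \<in> P2 M2" using assms(14,15) by (auto simp: is_arg_min_def)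
  have min1: "JKO_functional m \<Phi> h \<rho>01 \<rho>1 \<le> JKO_functional m \<Phi> h \<rho>01 \<mu>" if "\<mu> \<in> P2 M1" for \<mu>
    using assms(14) that by (auto simp: is_arg_min_def not_less)
  have min2: "JKO_functional m \<Phi> h \<rho>02 \<rho>2 \<le> JKO_functional m \<Phi> h \<rho>02 \<mu>" if "\<mu> \<in> P2 M2" for \<mu>
    using assms(15) that by (auto simp: is_arg_min_def not_less)
  have fin1: "JKO_functional m \<Phi> h \<rho>01 \<rho>1 < \<infinity>"
  proof -
    obtain \<mu> where \<mu>: "\<mu> \<in> P2 M1" "JKO_functional m \<Phi> h \<rho>01 \<mu> < \<infinity>"
      using JKO_finite_competitor[OF M(1) assms(6) \<Phi>c m1 h] by blast
    show ?thesis by (rule le_less_trans[OF min1[OF \<mu>(1)] \<mu>(2)])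
  qed
  have fin2: "JKO_functional m \<Phi> h \<rho>02 \<rho>2 < \<infinity>"
  proof -
    obtain \<mu> where \<mu>: "\<mu> \<in> P2 M2" "JKO_functional m \<Phi> h \<rho>02 \<mu> < \<infinity>"
      using JKO_finite_competitor[OF M(2) assms(8) \<Phi>c m1 h] by blast
    show ?thesis by (rule le_less_trans[OF min2[OF \<mu>(1)] \<mu>(2)])
  qed
  obtain I1 W1 where 1: "regular \<rho>1" "integrable \<rho>1 \<Phi>" "0 \<le> I1" "0 \<le> W1" "internal_energy m \<rho>1 = ereal I1"
    "W2_sq \<rho>1 \<rho>01 = ennreal W1" "JKO_functional m \<Phi> h \<rho>01 \<rho>1 = ereal (I1 + (LINT x|\<rho>1. \<Phi> x) + W1 / (2 * h))"
    using JKO_finite[OF P1 \<Phi>m K h fin1] by blast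
  obtain I2 W2 where 2: "regular \<rho>2" "integrable \<rho>2 \<Phi>" "0 \<le> I2" "0 \<le> W2" "internal_energy m \<rho>2 = ereal I2"
    "W2_sq \<rho>2 \<rho>02 = ennreal W2" "JKO_functional m \<Phi> h \<rho>02 \<rho>2 = ereal (I2 + (LINT x|\<rho>2. \<Phi> x) + W2 / (2 * h))"
    using JKO_finite[OF P2 \<Phi>m K h fin2] by blast
  obtain r1 where r1m[measurable]: "r1 \<in> borel_measurable borel" and r1: "\<And>x. 0 \<le> r1 x" and d1: "\<rho>1 = density lborel r1"
    and a1: "AE x in lborel. dens \<rho>1 x = ennreal (r1 x)"
    and i1: "integrable lborel r1" and A1: "(LBINT x. r1 x) = M1" and q1: "integrable lborel (\<lambda>x. (norm x)\<^sup>2 * r1 x)"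
    by (rule P2_regular_density[OF P1 1(1) less_imp_le[OF M(1)]]) blast
  obtain r2 where r2m[measurable]: "r2 \<in> borel_measurable borel" and r2: "\<And>x. 0 \<le> r2 x" and d2: "\<rho>2 = density lborel r2"
    and a2: "AE x in lborel. dens \<rho>2 x = ennreal (r2 x)"
    and i2: "integrable lborel r2" and A2: "(LBINT x. r2 x) = M2" and q2: "integrable lborel (\<lambda>x. (norm x)\<^sup>2 * r2 x)"
    by (rule P2_regular_density[OF P2 2(1) less_imp_le[OF M(2)]]) blast
  obtain n1 where n1m[measurable]: "n1 \<in> borel_measurable borel" and n1: "\<And>x. 0 \<le> n1 x" and e1: "\<rho>01 = density lborel n1"
    and b1: "AE x in lborel. dens \<rho>01 x = ennreal (n1 x)"
    and j1: "integrable lborel n1" and p1: "integrable lborel (\<lambda>x. (norm x)\<^sup>2 * n1 x)"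
    by (rule P2_regular_density[OF assms(6,7) less_imp_le[OF M(1)]]) blast
  obtain n2 where n2m[measurable]: "n2 \<in> borel_measurable borel" and n2: "\<And>x. 0 \<le> n2 x" and e2: "\<rho>02 = density lborel n2"
    and b2: "AE x in lborel. dens \<rho>02 x = ennreal (n2 x)"
    and j2: "integrable lborel n2" and p2: "integrable lborel (\<lambda>x. (norm x)\<^sup>2 * n2 x)"
    by (rule P2_regular_density[OF assms(8,9) less_imp_le[OF M(2)]]) blast
  \<comment> \<open>A representative of the first initial density that lies below \<open>n2\<close>
    everywhere and not just almost everywhere.\<close>
  define n1' where "n1' x = min (n1 x) (n2 x)" for x
  have n1'm[measurable]: "n1' \<in> borel_measurable borel" unfolding n1'_def by measurable
  have n1': "0 \<le> n1' x" "n1' x \<le> n1 x" "n1' x \<le> n2 x" for x using n1 n2 by (auto simp: n1'_def)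
  have "AE x in lborel. n1' x = n1 x"
    using assms(10) b1 b2 by eventually_elim (use n2 in \<open>simp add: n1'_def\<close>)
  then have e1': "\<rho>01 = density lborel n1'" unfolding e1 by (intro density_cong) (auto elim!: eventually_mono)
  have j1': "integrable lborel n1'" by (rule integrable_le[OF j1]) (auto simp: n1')
  have p1': "integrable lborel (\<lambda>x. (norm x)\<^sup>2 * n1' x)" by (rule integrable_le[OF p1]) (auto simp: n1' mult_left_mono)
  have "AE x in lborel. r1 x \<le> r2 x"
  proof (rule ccontr)
    assume notle: "\<not> ?thesis"
    obtain c where c: "0 < c" and swap: "\<And>T1 T2. T1 \<in> borel_measurable borel \<Longrightarrow> T2 \<in> borel_measurable borel \<Longrightarrow>
         pushes T1 r1 n1' \<Longrightarrow> pushes T2 r2 n2 \<Longrightarrow> exchange c r1 r2 n1' n2 T1 T2"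
      by (rule uniform_swap[OF i1 i2 j1' j2 q1 q2 p1' p2 r1 r2 n1'(1,3) notle]) blast
    \<comment> \<open>The two maps together then cost at most \<open>W1 + W2 + c / 2\<close>, which
      is less than the saving \<open>c\<close> can make up for.\<close>
    have c4: "0 < c / 4" using c by simp
    obtain T1 where T1: "T1 \<in> borel_measurable borel" "pushes T1 r1 n1'" "(LBINT x. r1 x * (norm (T1 x - x))\<^sup>2) \<le> W1 + c / 4"
      using near_optimal_map[OF r1m r1 n1'm _ 1(4) c4] 1(6) unfolding d1 e1' by blast
    obtain T2 where T2: "T2 \<in> borel_measurable borel" "pushes T2 r2 n2" "(LBINT x. r2 x * (norm (T2 x - x))\<^sup>2) \<le> W2 + c / 4"
      using near_optimal_map[OF r2m r2 n2m _ 2(4) c4] 2(6) unfolding d2 e2 by blast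
    obtain s V1 V2 where si: "integrable lborel s" and s0: "(LBINT x. s x) = 0"
      and sb: "AE x in lborel. min 0 (r2 x - r1 x) \<le> s x \<and> s x \<le> max 0 (r2 x - r1 x)"
      and V: "0 \<le> V1" "0 \<le> V2" "W2_sq (density lborel (\<lambda>x. r1 x + s x / 2)) (density lborel n1') \<le> ennreal V1"
         "W2_sq (density lborel (\<lambda>x. r2 x - s x / 2)) (density lborel n2) \<le> ennreal V2"
      and gain: "V1 + V2 + c \<le> (LBINT x. r1 x * (norm (T1 x - x))\<^sup>2) + (LBINT x. r2 x * (norm (T2 x - x))\<^sup>2)"
      using swap[OF T1(1) T2(1) T1(2) T2(2)] unfolding exchange_def by blast
    \<comment> \<open>\<open>s\<close> is clamped between its bounds, which hold almost everywhere,
      so that \<open>k1\<close> and \<open>k2\<close> below are nonnegative everywhere; no integral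
      changes.\<close>
    define z where "z x = max (min 0 (r2 x - r1 x)) (min (s x) (max 0 (r2 x - r1 x)))" for x
    have [measurable]: "s \<in> borel_measurable borel" using si by auto
    have zm[measurable]: "z \<in> borel_measurable borel" unfolding z_def by measurable
    have zs: "AE x in lborel. z x = s x" using sb by eventually_elim (auto simp: z_def)
    have zb: "min 0 (r2 x - r1 x) \<le> z x \<and> z x \<le> max 0 (r2 x - r1 x)" for x by (auto simp: z_def)
    have zi: "integrable lborel z" using si zs by (subst integrable_cong_AE[of _ _ s]) auto
    have z0: "(LBINT x. z x) = 0" using s0 zs by (subst integral_cong_AE[of _ _ s]) auto
    have bd: "0 \<le> r1 x + z x / 2" "0 \<le> r2 x - z x / 2" "r1 x + z x / 2 \<le> r1 x + r2 x" "r2 x - z x / 2 \<le> r1 x + r2 x" for x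
      using zb[of x] r1[of x] r2[of x] by (auto simp: min_def max_def split: if_splits)
    define k1 where "k1 x = r1 x + z x / 2" for x
    define k2 where "k2 x = r2 x - z x / 2" for x
    have km[measurable]: "k1 \<in> borel_measurable borel" "k2 \<in> borel_measurable borel" unfolding k1_def k2_def by measurable
    have k: "0 \<le> k1 x" "0 \<le> k2 x" "k1 x \<le> r1 x + r2 x" "k2 x \<le> r1 x + r2 x" for x using bd[of x] by (auto simp: k1_def k2_def)
    have ki: "integrable lborel k1" "integrable lborel k2" unfolding k1_def k2_def using i1 i2 zi by auto
    have k2i: "integrable lborel (\<lambda>x. (norm x)\<^sup>2 * k1 x)" "integrable lborel (\<lambda>x. (norm x)\<^sup>2 * k2 x)"
    proof -
      have "integrable lborel (\<lambda>x. (norm x)\<^sup>2 * (r1 x + r2 x))" using q1 q2 by (simp add: distrib_left)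
      note le = integrable_le[OF this]
      show "integrable lborel (\<lambda>x. (norm x)\<^sup>2 * k1 x)" by (rule le) (use k in \<open>auto intro!: mult_left_mono\<close>)
      show "integrable lborel (\<lambda>x. (norm x)\<^sup>2 * k2 x)" by (rule le) (use k in \<open>auto intro!: mult_left_mono\<close>)
    qed
    have kA: "(LBINT x. k1 x) = M1" "(LBINT x. k2 x) = M2"
      unfolding k1_def k2_def using i1 i2 zi z0 A1 A2 by auto
    note D1 = density_in_P2[OF ki(1) AE_I2[OF k(1)] k2i(1), unfolded kA]
    note D2 = density_in_P2[OF ki(2) AE_I2[OF k(2)] k2i(2), unfolded kA]
    have dc: "density lborel (\<lambda>x. r1 x + s x / 2) = density lborel k1" "density lborel (\<lambda>x. r2 x - s x / 2) = density lborel k2"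
      using zs by (auto intro!: density_cong simp: k1_def k2_def elim!: eventually_mono)
    have Wk: "W2_sq (density lborel k1) \<rho>01 \<le> ennreal V1" "W2_sq (density lborel k2) \<rho>02 \<le> ennreal V2"
      using V(3,4) by (simp_all add: dc e1' e2)
    have IE: "internal_energy m (density lborel k1) + internal_energy m (density lborel k2) \<le> ereal (I1 + I2)"
    proof -
      have "internal_energy m (density lborel k1) + internal_energy m (density lborel k2)
         \<le> internal_energy m (density lborel r1) + internal_energy m (density lborel r2)"
        unfolding k1_def[abs_def] k2_def[abs_def]
      proof (rule internal_energy_transfer_le[OF m1' i1 i2 zi r1 r2 zb])
        fix \<mu> f assume "\<mu> = density lborel (f :: real ^ 'd \<Rightarrow> real)"
          and "f \<in> {r1, r2, \<lambda>x. r1 x + z x / 2, \<lambda>x. r2 x - z x / 2}"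
        then show "AE x in lborel. dens \<mu> x = ennreal (f x)"
          using a1 a2 D1(3) D2(3) unfolding d1 d2 k1_def[abs_def] k2_def[abs_def] by auto
      qed
      then show ?thesis using 1(5) 2(5) unfolding d1 d2 by simp
    qed
    have "internal_energy m (density lborel k1) \<noteq> \<infinity>" "internal_energy m (density lborel k2) \<noteq> \<infinity>"
      using IE internal_energy_nonneg[of m "density lborel k1"] internal_energy_nonneg[of m "density lborel k2"] by auto
    then obtain E1 E2 where E: "internal_energy m (density lborel k1) = ereal E1" "internal_energy m (density lborel k2) = ereal E2"
      using internal_energy_nonneg[of m "density lborel k1"] internal_energy_nonneg[of m "density lborel k2"]
      by (cases "internal_energy m (density lborel k1)"; cases "internal_energy m (density lborel k2)") auto
    have E12: "E1 + E2 \<le> I1 + I2" using IE by (simp add: E)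
    have F: "integrable lborel (\<lambda>x. r1 x * \<Phi> x)" "integrable lborel (\<lambda>x. r2 x * \<Phi> x)"
      using 1(2) 2(2) r1 r2 unfolding d1 d2 by (simp_all add: integrable_density)
    have Fz: "integrable lborel (\<lambda>x. z x * \<Phi> x)"
    proof (rule Bochner_Integration.integrable_bound)
      show "integrable lborel (\<lambda>x. \<bar>r1 x * \<Phi> x\<bar> + \<bar>r2 x * \<Phi> x\<bar>)" using F by auto
      have "\<bar>z x\<bar> \<le> r1 x + r2 x" for x using zb[of x] r1[of x] r2[of x] by (auto simp: min_def max_def abs_le_iff split: if_splits)
      then have "\<bar>z x\<bar> * \<bar>\<Phi> x\<bar> \<le> (r1 x + r2 x) * \<bar>\<Phi> x\<bar>" for x by (intro mult_right_mono) auto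
      then show "AE x in lborel. norm (z x * \<Phi> x) \<le> norm (\<bar>r1 x * \<Phi> x\<bar> + \<bar>r2 x * \<Phi> x\<bar>)"
        using r1 r2 by (intro AE_I2) (simp add: abs_mult distrib_right)
    qed measurable
    have Fk: "integrable lborel (\<lambda>x. k1 x * \<Phi> x)" "integrable lborel (\<lambda>x. k2 x * \<Phi> x)"
      using F Fz by (simp_all add: k1_def k2_def distrib_right left_diff_distrib)
    \<comment> \<open>What one density gains the other loses, so the potential energies change by
      opposite amounts.\<close>
    have Fsum: "(LBINT x. k1 x * \<Phi> x) + (LBINT x. k2 x * \<Phi> x) = (LBINT x. r1 x * \<Phi> x) + (LBINT x. r2 x * \<Phi> x)"
      using F Fz by (simp add: k1_def k2_def distrib_right left_diff_distrib)
    have \<Phi>k: "integrable (density lborel k1) \<Phi>" "integrable (density lborel k2) \<Phi>"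
      using Fk k by (simp_all add: integrable_density)
    have L: "(LINT x|density lborel f. \<Phi> x) = (LBINT x. f x * \<Phi> x)" if "f \<in> borel_measurable borel" "\<And>x. 0 \<le> f x" for f
      using that by (subst integral_density) auto
    have "I1 + (LBINT x. r1 x * \<Phi> x) + W1 / (2 * h) \<le> E1 + (LBINT x. k1 x * \<Phi> x) + V1 / (2 * h)"
      using order_trans[OF min1[OF D1(1)] JKO_value[OF \<Phi>k(1) E(1) Wk(1) V(1) h]] 1(7)
      by (simp add: d1 L k r1 km)
    moreover have "I2 + (LBINT x. r2 x * \<Phi> x) + W2 / (2 * h) \<le> E2 + (LBINT x. k2 x * \<Phi> x) + V2 / (2 * h)"
      using order_trans[OF min2[OF D2(1)] JKO_value[OF \<Phi>k(2) E(2) Wk(2) V(2) h]] 2(7)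
      by (simp add: d2 L k r2 km)
    \<comment> \<open>Neither minimality inequality is contradictory alone; in their sum the
      energies drop out and only the transport costs remain.\<close>
    ultimately have "W1 / (2 * h) + W2 / (2 * h) \<le> V1 / (2 * h) + V2 / (2 * h)" using E12 Fsum by linarith
    then have "(W1 + W2) / (2 * h) \<le> (V1 + V2) / (2 * h)" by (simp add: add_divide_distrib)
    then have "W1 + W2 \<le> V1 + V2" using h by (simp add: divide_le_cancel)
    then show False using gain T1(3) T2(3) c by linarith
  qed
  then have "AE x in lborel. dens \<rho>1 x \<le> dens \<rho>2 x"
    using a1 a2 by eventually_elim (simp add: ennreal_leI)
  then show ?thesis using 1(1) 2(1) by blast
qed

end
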